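(* (i) Let $G$ be a countably infinite abelian group and let $G \curvearrowright (X,\mu) = \prod_{g \in G} (\{0,1\},\mu_g)$ be any nonsingular Bernoulli action such that $\mu$ is nonatomic. Then $G \curvearrowright (X,\mu)$ is either dissipative or weakly mixing. (ii) Let $G$ be any countably infinite group and let $G \curvearrowright (X,\mu) = \prod_{g \in G} (\{0,1\},\mu_g)$ be a nonsingular Bernoulli action that is strongly conservative and for which there is a $\delta>0$ with $\mu_g(0) \in [\delta,1-\delta]$ for all $g \in G$. Then $G \curvearrowright (X,\mu)$ is weakly mixing.
   Context: Bernoulli action: given a countable group $G$ and probability measures $(\mu_g)_{g\in G}$ on $\{0,1\}$ with $\mu_g(0)\in(0,1)$ for all $g$, the Bernoulli action is the action of $G$ on $(X,\mu)=\prod_{g\in G}(\{0,1\},\mu_g)$ given by $(g\cdot x)_h = x_{g^{-1}h}$. An action of $G$ by Borel bijections of a standard probability space $(X,\mu)$ is nonsingular if each $g\in G$ maps null sets to null sets and so does $g^{-1}$. Write $\frac{d\mu(g\cdot x)}{d\mu(x)}$ for the Radon-Nikodym derivative at $x$ of the measure $\mathcal{U}\mapsto \mu(g\cdot \mathcal{U})$ with respect to $\mu$. A nonsingular action $G\curvearrowright(X,\mu)$ is ergodic if all $G$-invariant Borel sets have measure $0$ or $1$. It is weakly mixing if for every ergodic probability measure preserving (pmp) action $G\curvearrowright (Y,\eta)$ on a standard probability space, the diagonal action $G\curvearrowright (X\times Y,\mu\times\eta)$ is ergodic. It is dissipative if there exists a Borel set $\mathcal{U}\subset X$ such that the sets $(g\cdot\mathcal{U})_{g\in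 G}$ are disjoint and $\bigcup_{g\in G} g\cdot\mathcal{U}$ has measure $1$. A nonsingular action $G\curvearrowright (X,\mu)$ is strongly conservative if there exists a sequence of probability measures $\eta_n$ on $G$ with $$\sum_{g \in G} \eta_n(g)^2 \int_X \Bigl( \sum_{k \in G} \eta_n(gk^{-1}) \, \frac{d \mu(k \cdot x)}{d \mu(x)} \Bigr)^{-1} d \mu(x) \longrightarrow 0$$ as $n\to\infty$, where terms with $\eta_n(g)=0$ are zero. *)

theory Defs
  imports "HOL-Probability.Probability" "HOL-Algebra.Group_Action"
begin

text \<open>A group \<open>G\<close> is an object of HOL-Algebra, and an action is a map \<open>\<phi>\<close> such that \<open>g \<cdot> x = \<phi> g x\<close>
  for \<open>g \<in> carrier G\<close> and \<open>x\<close> in the space of the measure acted upon.\<close>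

definition standard_borel :: "'x measure \<Rightarrow> bool" where
  "standard_borel M \<longleftrightarrow>
     (\<exists>T. topspace T = space M \<and> completely_metrizable_space T \<and> second_countable T \<and>
          sets M = sigma_sets (space M) {U. openin T U})"

definition standard_prob_space :: "'x measure \<Rightarrow> bool" where
  "standard_prob_space M \<longleftrightarrow> prob_space M \<and> standard_borel M"

definition nonatomic :: "'x measure \<Rightarrow> bool" where
  "nonatomic M \<longleftrightarrow>
     (\<forall>A\<in>sets M. 0 < emeasure M A \<longrightarrow>
        (\<exists>B\<in>sets M. B \<subseteq> A \<and> 0 < emeasure M B \<and> emeasure M B < emeasure M A))"

definition borel_action ::
    "('g, 'b) monoid_scheme \<Rightarrow> 'x measure \<Rightarrow> ('g \<Rightarrow> 'x \<Rightarrow> 'x) \<Rightarrow> bool" where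
  "borel_action G M \<phi> \<longleftrightarrow>
     group_action G (space M) \<phi> \<and> (\<forall>g\<in>carrier G. \<phi> g \<in> measurable M M)"

definition nonsingular_action ::
    "('g, 'b) monoid_scheme \<Rightarrow> 'x measure \<Rightarrow> ('g \<Rightarrow> 'x \<Rightarrow> 'x) \<Rightarrow> bool" where
  "nonsingular_action G M \<phi> \<longleftrightarrow>
     borel_action G M \<phi> \<and>
     (\<forall>g\<in>carrier G. \<forall>N\<in>null_sets M.
        \<phi> g ` N \<in> null_sets M \<and> \<phi> (inv\<^bsub>G\<^esub> g) ` N \<in> null_sets M)"

definition pmp_action ::
    "('g, 'b) monoid_scheme \<Rightarrow> 'x measure \<Rightarrow> ('g \<Rightarrow> 'x \<Rightarrow> 'x) \<Rightarrow> bool" where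
  "pmp_action G M \<phi> \<longleftrightarrow>
     borel_action G M \<phi> \<and>
     (\<forall>g\<in>carrier G. \<forall>A\<in>sets M. emeasure M (\<phi> g ` A) = emeasure M A)"

definition ergodic_action ::
    "('g, 'b) monoid_scheme \<Rightarrow> 'x measure \<Rightarrow> ('g \<Rightarrow> 'x \<Rightarrow> 'x) \<Rightarrow> bool" where
  "ergodic_action G M \<phi> \<longleftrightarrow>
     (\<forall>A\<in>sets M. (\<forall>g\<in>carrier G. \<phi> g ` A = A) \<longrightarrow> emeasure M A = 0 \<or> emeasure M A = 1)"

definition diagonal_action ::
    "'x measure \<Rightarrow> ('g \<Rightarrow> 'x \<Rightarrow> 'x) \<Rightarrow> 'y measure \<Rightarrow> ('g \<Rightarrow> 'y \<Rightarrow> 'y) \<Rightarrow> 'g \<Rightarrow> 'x \<times> 'y \<Rightarrow> 'x \<times> 'y" where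
  "diagonal_action M \<phi> N \<psi> g = (\<lambda>z\<in>space (M \<Otimes>\<^sub>M N). (\<phi> g (fst z), \<psi> g (snd z)))"

text \<open>HOL cannot quantify over types inside a formula. The type of the points of the test space
  is therefore a parameter, and weak mixing is the property that \<open>weakly_mixing TYPE('y) G M \<phi>\<close> holds
  for all types \<open>'y\<close>, to be stated with a free type variable \<open>'y\<close>.\<close>

definition weakly_mixing ::
    "'y itself \<Rightarrow> ('g, 'b) monoid_scheme \<Rightarrow> 'x measure \<Rightarrow> ('g \<Rightarrow> 'x \<Rightarrow> 'x) \<Rightarrow> bool" where
  "weakly_mixing TY G M \<phi> \<longleftrightarrow>
     (\<forall>(N :: 'y measure) \<psi>.
        standard_prob_space N \<and> pmp_action G N \<psi> \<and> ergodic_action G N \<psi> \<longrightarrow>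
        ergodic_action G (M \<Otimes>\<^sub>M N) (diagonal_action M \<phi> N \<psi>))"

definition dissipative ::
    "('g, 'b) monoid_scheme \<Rightarrow> 'x measure \<Rightarrow> ('g \<Rightarrow> 'x \<Rightarrow> 'x) \<Rightarrow> bool" where
  "dissipative G M \<phi> \<longleftrightarrow>
     (\<exists>U\<in>sets M. disjoint_family_on (\<lambda>g. \<phi> g ` U) (carrier G) \<and>
        emeasure M (\<Union>g\<in>carrier G. \<phi> g ` U) = 1)"

text \<open>The measure \<open>U \<mapsto> \<mu> (g \<cdot> U)\<close> is the push-forward of \<open>\<mu>\<close> under the action of \<open>g\<^sup>-\<^sup>1\<close>, because
  \<open>g \<cdot> U\<close> is the preimage of \<open>U\<close> under \<open>g\<^sup>-\<^sup>1\<close>.\<close>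

definition action_deriv ::
    "('g, 'b) monoid_scheme \<Rightarrow> 'x measure \<Rightarrow> ('g \<Rightarrow> 'x \<Rightarrow> 'x) \<Rightarrow> 'g \<Rightarrow> 'x \<Rightarrow> ennreal" where
  "action_deriv G M \<phi> g = RN_deriv M (distr M M (\<phi> (inv\<^bsub>G\<^esub> g)))"

text \<open>A probability measure on the countable group \<open>G\<close> is a probability mass function supported on its
  carrier, and sums over \<open>G\<close> are integrals against counting measure. Everything is computed in
  \<open>ennreal\<close>, where \<open>inverse 0 = \<infinity>\<close> and \<open>0 * \<infinity> = 0\<close>; so the terms with \<open>\<eta>\<^sub>n(g) = 0\<close> vanish.\<close>

definition strongly_conservative ::
    "('g, 'b) monoid_scheme \<Rightarrow> 'x measure \<Rightarrow> ('g \<Rightarrow> 'x \<Rightarrow> 'x) \<Rightarrow> bool" where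
  "strongly_conservative G M \<phi> \<longleftrightarrow>
     (\<exists>\<eta> :: nat \<Rightarrow> 'g pmf. (\<forall>n. set_pmf (\<eta> n) \<subseteq> carrier G) \<and>
        (\<lambda>n. \<integral>\<^sup>+g. ennreal ((pmf (\<eta> n) g)\<^sup>2) *
                (\<integral>\<^sup>+x. inverse (\<integral>\<^sup>+k. ennreal (pmf (\<eta> n) (g \<otimes>\<^bsub>G\<^esub> inv\<^bsub>G\<^esub> k)) * action_deriv G M \<phi> k x
                                  \<partial>count_space (carrier G)) \<partial>M)
              \<partial>count_space (carrier G)) \<longlonglongrightarrow> 0)"

text \<open>The set \<open>{0, 1}\<close> is rendered by \<open>bool\<close>, with \<open>False\<close> for \<open>0\<close> and \<open>True\<close> for \<open>1\<close>.\<close>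

definition bernoulli_space ::
    "('g, 'b) monoid_scheme \<Rightarrow> ('g \<Rightarrow> bool pmf) \<Rightarrow> ('g \<Rightarrow> bool) measure" where
  "bernoulli_space G \<mu> = PiM (carrier G) (\<lambda>g. measure_pmf (\<mu> g))"

definition bernoulli_action ::
    "('g, 'b) monoid_scheme \<Rightarrow> 'g \<Rightarrow> ('g \<Rightarrow> bool) \<Rightarrow> 'g \<Rightarrow> bool" where
  "bernoulli_action G g =
     (\<lambda>x\<in>carrier G \<rightarrow>\<^sub>E (UNIV :: bool set). \<lambda>h\<in>carrier G. x (inv\<^bsub>G\<^esub> g \<otimes>\<^bsub>G\<^esub> h))"

lemma space_bernoulli_space: "space (bernoulli_space G \<mu>) = carrier G \<rightarrow>\<^sub>E UNIV"
  by (simp add: bernoulli_space_def space_PiM)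

lemma borel_action_bernoulli:
  assumes "group G"
  shows "borel_action G (bernoulli_space G \<mu>) (bernoulli_action G)"
proof -
  interpret group G by fact
  let ?E = "carrier G \<rightarrow>\<^sub>E (UNIV :: bool set)"
  let ?\<phi> = "bernoulli_action G"
  have mem: "?\<phi> g x \<in> ?E" if "g \<in> carrier G" "x \<in> ?E" for g x
    using that by (auto simp: bernoulli_action_def)
  have comp: "?\<phi> g (?\<phi> h x) = ?\<phi> (g \<otimes>\<^bsub>G\<^esub> h) x"
    if "g \<in> carrier G" "h \<in> carrier G" "x \<in> ?E" for g h x
    using that mem[OF that(2,3)]
    by (auto simp: bernoulli_action_def inv_mult_group m_assoc intro!: restrict_ext)
  have one: "?\<phi> \<one>\<^bsub>G\<^esub> x = x" if "x \<in> ?E" for x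
    using that by (auto simp: bernoulli_action_def PiE_def extensional_def fun_eq_iff)
  have bij: "?\<phi> g \<in> Bij ?E" if g: "g \<in> carrier G" for g
  proof -
    have "bij_betw (?\<phi> g) ?E ?E"
      by (rule bij_betw_byWitness[where f' = "?\<phi> (inv\<^bsub>G\<^esub> g)"])
        (use g in \<open>simp_all add: comp one mem image_subset_iff\<close>)
    then show ?thesis
      by (simp add: Bij_def bernoulli_action_def)
  qed
  have hom: "?\<phi> (g \<otimes>\<^bsub>G\<^esub> h) = compose ?E (?\<phi> g) (?\<phi> h)" if "g \<in> carrier G" "h \<in> carrier G" for g h
  proof
    fix x
    show "?\<phi> (g \<otimes>\<^bsub>G\<^esub> h) x = compose ?E (?\<phi> g) (?\<phi> h) x"
    proof (cases "x \<in> ?E")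
      case True
      with comp[OF that] show ?thesis by (simp add: compose_def del: PiE_iff)
    next
      case False
      then show ?thesis by (simp add: compose_def bernoulli_action_def del: PiE_iff)
    qed
  qed
  have "?\<phi> \<in> hom G (BijGroup ?E)"
    by (rule homI) (use bij hom in \<open>simp_all add: BijGroup_def\<close>)
  then have "group_action G ?E ?\<phi>"
    by (simp add: group_action_def group_hom_def group_hom_axioms_def group_BijGroup)
  moreover have "?\<phi> g \<in> measurable (bernoulli_space G \<mu>) (bernoulli_space G \<mu>)"
    if g: "g \<in> carrier G" for g
  proof -
    have "(\<lambda>x. \<lambda>h\<in>carrier G. x (inv\<^bsub>G\<^esub> g \<otimes>\<^bsub>G\<^esub> h)) \<in>
        measurable (bernoulli_space G \<mu>) (bernoulli_space G \<mu>)"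
      unfolding bernoulli_space_def
    proof (rule measurable_restrict)
      fix h assume "h \<in> carrier G"
      with g have "inv\<^bsub>G\<^esub> g \<otimes>\<^bsub>G\<^esub> h \<in> carrier G" by simp
      from measurable_component_singleton[OF this, of "\<lambda>g. measure_pmf (\<mu> g)"]
      show "(\<lambda>x. x (inv\<^bsub>G\<^esub> g \<otimes>\<^bsub>G\<^esub> h)) \<in>
          measurable (PiM (carrier G) (\<lambda>g. measure_pmf (\<mu> g))) (measure_pmf (\<mu> h))"
        by (simp cong: measurable_cong_sets)
    qed
    then show ?thesis
      by (subst measurable_cong) (auto simp: space_bernoulli_space bernoulli_action_def)
  qed
  ultimately show ?thesis
    by (simp add: borel_action_def space_bernoulli_space)
qed

end

theory Submission
  imports Defs
begin

text \<open>Draw \<open>h\<close> from a probability \<open>\<eta>\<close> on \<open>G\<close> and \<open>x\<close> from \<open>\<mu>\<close>, reveal \<open>z = h \<cdot> x\<close>, and resample \<open>h'\<close> from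
  the conditional law of \<open>h\<close> given \<open>z\<close>. The point \<open>h'\<^sup>-\<^sup>1 \<cdot> z\<close> has again law \<open>\<mu>\<close>, lies in the orbit of \<open>x\<close>, and
  strong conservativity says exactly that the probability of \<open>h' = h\<close> can be made small, so that
  \<open>k = h'\<^sup>-\<^sup>1 h\<close> tends to infinity. Change \<open>x\<close> in finitely many coordinates to \<open>\<tau> x\<close>. A cylinder set does not
  distinguish \<open>k \<cdot> x\<close> from \<open>k \<cdot> \<tau> x\<close> for \<open>k\<close> near infinity, so an invariant set \<open>A\<close> can separate \<open>x\<close> from
  \<open>\<tau> x\<close> only if the two conditional laws are nearly singular. They have an explicit mutual density.

  If the marginals stay away from \<open>0\<close> and \<open>1\<close>, this density is bounded when \<open>\<tau>\<close> flips one coordinate, so \<open>A\<close>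
  is a tail event. For abelian \<open>G\<close>, let \<open>\<tau>\<close> exchange the values of two coordinates. By Kakutani's
  criterion the density is bounded off a set of \<open>k\<close> which contributes only finitely many pairs of distinct
  values, so \<open>A\<close> is an exchangeable event, and these are trivial because \<open>\<mu>\<close> is nonatomic. The same argument
  shows that the conservative part is null or conull. In the conull case strong conservativity
  follows from amenability, in the null case the essentially free action has a fundamental domain.\<close>

section \<open>Quasi-invariant actions\<close>

text \<open>Weak mixing is about products with a measure preserving action. Such a factor has
  derivative 1, so the conditional laws and the collision probability on the product depend on the
  first coordinate only, and the comparison of \<open>x\<close> with \<open>\<tau> x\<close> runs
  there unchanged, with the second coordinate fixed. It shows that almost every section of an
  invariant set is a tail or an exchangeable event.

  Single flips do not suffice for abelian groups: the marginals may approach 0 or 1, which makes the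
  density factor at \<open>k\<close> unbounded. Exchanging the values at \<open>i\<close> and
  \<open>j\<close> compares the marginals at \<open>k \<otimes> i\<close> and
  \<open>k \<otimes> j\<close>. By commutativity these coordinates differ by the fixed translation
  by \<open>j \<otimes> inv i\<close>, and nonsingularity of this one translation makes the
  distances of the paired marginals summable over \<open>k\<close>. Where the density factor is very
  large or very small, this distance bounds the probability of distinct values at the pair. Since
  \<open>k\<close> carries the distinct values of \<open>x\<close> to exactly that pair, bad
  displacements lead into a set of small measure, which the resampled point rarely visits.\<close>

lemma ennreal_mult_le_sum_squares:
  fixes a b :: ennreal
  shows "a * b \<le> a\<^sup>2 + b\<^sup>2"
proof (cases "a \<le> b")
  case True
  then have "a * b \<le> b * b" by (rule mult_right_mono) simp
  then show ?thesis by (simp add: power2_eq_square add_increasing)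
next
  case False
  then have "a * b \<le> a * a" by (intro mult_left_mono) simp_all
  then show ?thesis by (simp add: power2_eq_square add_increasing2)
qed

text \<open>\<open>a / d1\<close> and \<open>a * ennreal t * r / d2\<close> are the values of two
  conditional laws at one point, with normalising integrals \<open>d1\<close> and \<open>d2\<close>.
  If \<open>d2 \<le> r * d1\<close>, a lower bound on the density factor \<open>t\<close> dominates
  the first law by the second; \<open>ennreal_weight_ge\<close> treats the opposite case, with an
  upper bound on \<open>t\<close>.\<close>

lemma ennreal_weight_le:
  fixes a d1 d2 r :: ennreal
  assumes "0 < d1" "d1 < \<infinity>" "0 < d2" "d2 < \<infinity>" "r < \<infinity>" "a < \<infinity>"
    and "d2 \<le> r * d1" "1 \<le> \<kappa> * t" "0 \<le> t" "0 \<le> \<kappa>"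
  shows "a / d1 \<le> ennreal \<kappa> * (a * ennreal t * r / d2)"
proof -
  obtain x where x: "a = ennreal x" "0 \<le> x" using assms by (cases a) auto
  obtain y where y: "d1 = ennreal y" "0 \<le> y" using assms by (cases d1) auto
  obtain z where z: "d2 = ennreal z" "0 \<le> z" using assms by (cases d2) auto
  obtain s where s: "r = ennreal s" "0 \<le> s" using assms by (cases r) auto
  have pos: "0 < y" "0 < z" using assms y z by auto
  have zy: "z \<le> s * y" using assms(7) y z s by (simp add: ennreal_mult'[symmetric] del: ennreal_mult)
  have "x * z * 1 \<le> x * (s * y) * (\<kappa> * t)"
    using zy assms x z by (intro mult_mono) auto
  then have "x / y \<le> \<kappa> * (x * t * s / z)"
    using pos by (simp add: field_simps)
  then show ?thesis
    using x y z s pos assms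
    by (simp add: divide_ennreal ennreal_mult'[symmetric])
qed

lemma ennreal_weight_ge:
  fixes a d1 d2 r :: ennreal
  assumes "0 < d1" "d1 < \<infinity>" "0 < d2" "d2 < \<infinity>" "r < \<infinity>" "a < \<infinity>"
    and "r * d1 \<le> d2" "t \<le> \<kappa>" "0 \<le> t"
  shows "a * ennreal t * r / d2 \<le> ennreal \<kappa> * (a / d1)"
proof -
  obtain x where x: "a = ennreal x" "0 \<le> x" using assms by (cases a) auto
  obtain y where y: "d1 = ennreal y" "0 \<le> y" using assms by (cases d1) auto
  obtain z where z: "d2 = ennreal z" "0 \<le> z" using assms by (cases d2) auto
  obtain s where s: "r = ennreal s" "0 \<le> s" using assms by (cases r) auto
  have pos: "0 < y" "0 < z" using assms y z by auto
  have zy: "s * y \<le> z" using assms(7) y z s by (simp add: ennreal_mult'[symmetric] del: ennreal_mult)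
  have "x * t * (s * y) \<le> x * \<kappa> * z"
    using zy assms x y s by (intro mult_mono) auto
  then have "x * t * s / z \<le> \<kappa> * (x / y)"
    using pos by (simp add: field_simps)
  then show ?thesis
    using x y z s pos assms
    by (simp add: divide_ennreal ennreal_mult'[symmetric])
qed

lemma borel_measurable_nn_integral_count_space:
  fixes f :: "'i \<Rightarrow> 'a \<Rightarrow> ennreal"
  assumes "countable I" and f[measurable]: "\<And>i. i \<in> I \<Longrightarrow> f i \<in> borel_measurable M"
  shows "(\<lambda>x. \<integral>\<^sup>+i. f i x \<partial>count_space I) \<in> borel_measurable M"
proof (cases "finite I")
  case True
  then show ?thesis by (simp add: nn_integral_count_space_finite)
next
  case False
  then have "I \<noteq> {}" by auto
  note * = bij_betw_from_nat_into[OF \<open>countable I\<close> False]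
  have "(\<lambda>x. \<integral>\<^sup>+i. f i x \<partial>count_space I) = (\<lambda>x. \<Sum>n. f (from_nat_into I n) x)"
    by (simp add: nn_integral_bij_count_space[symmetric, OF *] nn_integral_count_space_nat)
  moreover have "(\<lambda>x. \<Sum>n. f (from_nat_into I n) x) \<in> borel_measurable M"
    using from_nat_into[OF \<open>I \<noteq> {}\<close>] by measurable
  ultimately show ?thesis by simp
qed

lemma (in sigma_finite_measure) AE_eq_of_nn_integral_indicator_eq:
  assumes [measurable]: "f \<in> borel_measurable M" "f' \<in> borel_measurable M"
    and eq: "\<And>A. A \<in> sets M \<Longrightarrow> (\<integral>\<^sup>+x. indicator A x * f x \<partial>M) = (\<integral>\<^sup>+x. indicator A x * f' x \<partial>M)"
  shows "AE x in M. f x = f' x"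
proof -
  have "density M f = density M f'"
    by (rule measure_eqI) (auto simp: emeasure_density eq[unfolded mult.commute[of "indicator _ _"]])
  then show ?thesis
    by (subst (asm) density_unique_iff) auto
qed

text \<open>The derivative \<open>w\<close> is a parameter characterised by
  \<open>nn_integral_act\<close>, rather than \<open>RN_deriv\<close> itself. The diagonal action
  with a measure preserving one is then an instance with the derivative \<open>w g (fst z)\<close>
  as it stands, not merely up to null sets.\<close>

locale quasi_invariant_action = group G + prob_space M
  for G :: "('g, 'b) monoid_scheme" (structure) and M :: "'x measure" +
  fixes \<phi> :: "'g \<Rightarrow> 'x \<Rightarrow> 'x" and w :: "'g \<Rightarrow> 'x \<Rightarrow> ennreal"
  assumes countable_carrier: "countable (carrier G)"
    and act_measurable: "g \<in> carrier G \<Longrightarrow> \<phi> g \<in> measurable M M"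
    and act_one: "x \<in> space M \<Longrightarrow> \<phi> \<one> x = x"
    and act_mult: "g \<in> carrier G \<Longrightarrow> h \<in> carrier G \<Longrightarrow> x \<in> space M \<Longrightarrow> \<phi> (g \<otimes> h) x = \<phi> g (\<phi> h x)"
    and deriv_measurable: "g \<in> carrier G \<Longrightarrow> w g \<in> borel_measurable M"
    and deriv_pos: "g \<in> carrier G \<Longrightarrow> AE x in M. 0 < w g x"
    and nn_integral_act: "g \<in> carrier G \<Longrightarrow> u \<in> borel_measurable M \<Longrightarrow>
           (\<integral>\<^sup>+x. u (\<phi> g x) * w g x \<partial>M) = (\<integral>\<^sup>+x. u x \<partial>M)"
begin

lemma act_space: "g \<in> carrier G \<Longrightarrow> x \<in> space M \<Longrightarrow> \<phi> g x \<in> space M"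
  using act_measurable measurable_space by metis

lemma act_inv [simp]: "g \<in> carrier G \<Longrightarrow> x \<in> space M \<Longrightarrow> \<phi> (inv g) (\<phi> g x) = x"
  and act_inv' [simp]: "g \<in> carrier G \<Longrightarrow> x \<in> space M \<Longrightarrow> \<phi> g (\<phi> (inv g) x) = x"
  by (simp_all add: act_mult[symmetric] act_one)

lemma nn_integral_deriv:
  assumes g: "g \<in> carrier G" and u: "u \<in> borel_measurable M"
  shows "(\<integral>\<^sup>+x. u x * w g x \<partial>M) = (\<integral>\<^sup>+x. u (\<phi> (inv g) x) \<partial>M)"
proof -
  have [measurable]: "(\<lambda>x. u (\<phi> (inv g) x)) \<in> borel_measurable M"
    using measurable_compose[OF act_measurable u, of "inv g"] g by simp
  have "(\<integral>\<^sup>+x. u x * w g x \<partial>M) = (\<integral>\<^sup>+x. u (\<phi> (inv g) (\<phi> g x)) * w g x \<partial>M)"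
    using g by (intro nn_integral_cong) simp
  also have "\<dots> = (\<integral>\<^sup>+x. u (\<phi> (inv g) x) \<partial>M)"
    by (rule nn_integral_act[OF g]) simp
  finally show ?thesis .
qed

lemma AE_act:
  assumes g: "g \<in> carrier G" and P: "AE x in M. P x"
  shows "AE x in M. P (\<phi> g x)"
proof -
  obtain N where N: "{x \<in> space M. \<not> P x} \<subseteq> N" "emeasure M N = 0" "N \<in> sets M"
    using P by (auto elim: AE_E)
  note [measurable] = N(3) act_measurable[OF g] deriv_measurable[OF g]
  have "(\<integral>\<^sup>+x. indicator N (\<phi> g x) * w g x \<partial>M) = 0"
    using nn_integral_act[OF g, of "indicator N"] N by simp
  then have "AE x in M. indicator N (\<phi> g x) * w g x = 0"
    by (subst (asm) nn_integral_0_iff_AE) auto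
  with deriv_pos[OF g] AE_space show ?thesis
  proof eventually_elim
    case (elim x)
    then have "\<phi> g x \<notin> N" by (auto simp: indicator_def split: if_splits)
    then show ?case using N(1) act_space[OF g elim(2)] by auto
  qed
qed

text \<open>Chain rule for densities: integrated over a set, both sides give the measure of its
  translate by \<open>g \<otimes> h\<close>.\<close>

lemma deriv_mult:
  assumes g: "g \<in> carrier G" and h: "h \<in> carrier G"
  shows "AE x in M. w (g \<otimes> h) x = w g (\<phi> h x) * w h x"
proof (rule AE_eq_of_nn_integral_indicator_eq)
  have [measurable]: "\<phi> h \<in> measurable M M" "\<phi> (inv h) \<in> measurable M M"
    "w g \<in> borel_measurable M" "w h \<in> borel_measurable M" "w (g \<otimes> h) \<in> borel_measurable M"
    using g h by (auto intro: act_measurable deriv_measurable)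
  show "w (g \<otimes> h) \<in> borel_measurable M" "(\<lambda>x. w g (\<phi> h x) * w h x) \<in> borel_measurable M"
    by measurable
  fix A assume [measurable]: "A \<in> sets M"
  let ?u = "indicator A :: 'x \<Rightarrow> ennreal"
  have "(\<integral>\<^sup>+x. ?u x * (w g (\<phi> h x) * w h x) \<partial>M)
      = (\<integral>\<^sup>+x. ?u (\<phi> (inv h) (\<phi> h x)) * w g (\<phi> h x) * w h x \<partial>M)"
    using h by (intro nn_integral_cong) (simp add: mult.assoc)
  also have "\<dots> = (\<integral>\<^sup>+x. ?u (\<phi> (inv h) x) * w g x \<partial>M)"
    using g h by (intro nn_integral_act) measurable
  also have "\<dots> = (\<integral>\<^sup>+x. ?u (\<phi> (inv h) (\<phi> (inv g) x)) \<partial>M)"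
    using g h by (intro nn_integral_deriv[of g "\<lambda>x. ?u (\<phi> (inv h) x)"]) measurable
  also have "\<dots> = (\<integral>\<^sup>+x. ?u (\<phi> (inv (g \<otimes> h)) x) \<partial>M)"
    using g h by (intro nn_integral_cong) (simp add: inv_mult_group act_mult)
  also have "\<dots> = (\<integral>\<^sup>+x. ?u x * w (g \<otimes> h) x \<partial>M)"
    using g h by (intro nn_integral_deriv[symmetric]) auto
  finally show "(\<integral>\<^sup>+x. ?u x * w (g \<otimes> h) x \<partial>M) = (\<integral>\<^sup>+x. ?u x * (w g (\<phi> h x) * w h x) \<partial>M)" ..
qed

lemma deriv_finite:
  assumes g: "g \<in> carrier G"
  shows "AE x in M. w g x < \<infinity>"
proof -
  have "(\<integral>\<^sup>+x. w g x \<partial>M) = 1"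
    using nn_integral_act[OF g, of "\<lambda>_. 1"] by (simp add: emeasure_space_1)
  then have "AE x in M. w g x \<noteq> \<infinity>"
    using deriv_measurable[OF g] by (intro nn_integral_PInf_AE) auto
  then show ?thesis by eventually_elim (simp add: less_top)
qed

lemma deriv_one: "AE x in M. w \<one> x = 1"
  by (rule AE_eq_of_nn_integral_indicator_eq)
     (auto simp: deriv_measurable nn_integral_deriv act_one cong: nn_integral_cong)

lemma deriv_inv:
  assumes g: "g \<in> carrier G"
  shows "AE x in M. w (inv g) (\<phi> g x) = inverse (w g x)"
proof -
  have "AE x in M. w (inv g \<otimes> g) x = w (inv g) (\<phi> g x) * w g x"
    using g by (intro deriv_mult) auto
  with deriv_one deriv_pos[OF g] deriv_finite[OF g] show ?thesis
  proof eventually_elim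
    case (elim x)
    then have "w (inv g) (\<phi> g x) * w g x = 1" using g by simp
    then have "w (inv g) (\<phi> g x) * w g x / w g x = inverse (w g x)" 
      by (simp add: divide_ennreal_def)
    moreover have "w (inv g) (\<phi> g x) * w g x / w g x = w (inv g) (\<phi> g x)"
      using elim by (intro ennreal_mult_divide_eq) auto
    ultimately show ?case by simp
  qed
qed

end

section \<open>Resampling a group element from its conditional law\<close>

context quasi_invariant_action
begin

text \<open>Draw \<open>h\<close> from \<open>\<eta>\<close> and \<open>x\<close> from \<open>M\<close>, and reveal only \<open>z = h \<cdot> x\<close>. Then \<open>mix\<close> is the density of
  the law of \<open>z\<close>, \<open>resample\<close> is the conditional law of \<open>h\<close> given \<open>z\<close>, and \<open>collision\<close> is the
  probability that a second, conditionally independent, draw of \<open>h\<close> gives the same result.\<close>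

definition weight :: "('g \<Rightarrow> ennreal) \<Rightarrow> 'g \<Rightarrow> 'x \<Rightarrow> ennreal" where
  "weight \<eta> h z = \<eta> h * w (inv h) z"

definition mix :: "('g \<Rightarrow> ennreal) \<Rightarrow> 'x \<Rightarrow> ennreal" where
  "mix \<eta> z = (\<integral>\<^sup>+h. weight \<eta> h z \<partial>count_space (carrier G))"

definition resample :: "('g \<Rightarrow> ennreal) \<Rightarrow> 'x \<Rightarrow> 'g \<Rightarrow> ennreal" where
  "resample \<eta> z h = weight \<eta> h z / mix \<eta> z"

definition collision :: "('g \<Rightarrow> ennreal) \<Rightarrow> ennreal" where
  "collision \<eta> = (\<integral>\<^sup>+z. (\<integral>\<^sup>+h. (weight \<eta> h z)\<^sup>2 / mix \<eta> z \<partial>count_space (carrier G)) \<partial>M)"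

lemma weight_measurable: "h \<in> carrier G \<Longrightarrow> weight \<eta> h \<in> borel_measurable M"
  unfolding weight_def by (intro borel_measurable_times_ennreal deriv_measurable) auto

lemma mix_measurable: "mix \<eta> \<in> borel_measurable M"
  unfolding mix_def
  by (intro borel_measurable_nn_integral_count_space weight_measurable countable_carrier)

lemma resample_measurable: "h \<in> carrier G \<Longrightarrow> (\<lambda>z. resample \<eta> z h) \<in> borel_measurable M"
  unfolding resample_def by (intro borel_measurable_divide_ennreal weight_measurable mix_measurable)

lemma AE_weight_finite:
  assumes "\<And>h. \<eta> h < \<infinity>"
  shows "AE z in M. \<forall>h\<in>carrier G. weight \<eta> h z < \<infinity>"
  unfolding AE_ball_countable[OF countable_carrier]
proof
  fix h assume "h \<in> carrier G"
  then have "AE z in M. w (inv h) z < \<infinity>" by (intro deriv_finite) simp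
  then show "AE z in M. weight \<eta> h z < \<infinity>"
    by eventually_elim (use assms[of h] in \<open>auto simp: weight_def ennreal_mult_less_top\<close>)
qed

text \<open>Two descriptions of one joint law of \<open>(h, z)\<close>: by the density
  \<open>weight \<eta> h z\<close>, or by independent draws of \<open>h\<close> and \<open>x\<close>
  with \<open>z = \<phi> h x\<close>. Every computation below passes between them.\<close>

lemma nn_integral_mix:
  assumes u: "\<And>h. h \<in> carrier G \<Longrightarrow> u h \<in> borel_measurable M"
  shows "(\<integral>\<^sup>+z. \<integral>\<^sup>+h. weight \<eta> h z * u h z \<partial>count_space (carrier G) \<partial>M)
       = (\<integral>\<^sup>+h. \<eta> h * (\<integral>\<^sup>+x. u h (\<phi> h x) \<partial>M) \<partial>count_space (carrier G))"
proof -
  have "(\<integral>\<^sup>+z. \<integral>\<^sup>+h. weight \<eta> h z * u h z \<partial>count_space (carrier G) \<partial>M)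
      = (\<integral>\<^sup>+h. \<integral>\<^sup>+z. weight \<eta> h z * u h z \<partial>M \<partial>count_space (carrier G))"
    by (intro nn_integral_count_space_nn_integral countable_carrier
        borel_measurable_times_ennreal weight_measurable u)
  also have "\<dots> = (\<integral>\<^sup>+h. \<eta> h * (\<integral>\<^sup>+x. u h (\<phi> h x) \<partial>M) \<partial>count_space (carrier G))"
  proof (rule nn_integral_cong)
    fix h assume "h \<in> space (count_space (carrier G))"
    then have h: "h \<in> carrier G" by simp
    have [measurable]: "u h \<in> borel_measurable M" "w (inv h) \<in> borel_measurable M"
      using h by (auto intro: u deriv_measurable)
    have "(\<integral>\<^sup>+z. weight \<eta> h z * u h z \<partial>M) = \<eta> h * (\<integral>\<^sup>+z. u h z * w (inv h) z \<partial>M)"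
      by (subst nn_integral_cmult[symmetric]) (auto simp: weight_def mult_ac)
    also have "(\<integral>\<^sup>+z. u h z * w (inv h) z \<partial>M) = (\<integral>\<^sup>+x. u h (\<phi> h x) \<partial>M)"
      using h by (subst nn_integral_deriv) auto
    finally show "(\<integral>\<^sup>+z. weight \<eta> h z * u h z \<partial>M) = \<eta> h * (\<integral>\<^sup>+x. u h (\<phi> h x) \<partial>M)" .
  qed
  finally show ?thesis .
qed

lemma mix_total:
  assumes "(\<integral>\<^sup>+h. \<eta> h \<partial>count_space (carrier G)) = 1"
  shows "(\<integral>\<^sup>+z. mix \<eta> z \<partial>M) = 1"
  using nn_integral_mix[of "\<lambda>_ _. 1" \<eta>] assms by (simp add: mix_def emeasure_space_1)

lemma AE_mix_finite:
  assumes "(\<integral>\<^sup>+h. \<eta> h \<partial>count_space (carrier G)) = 1"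
  shows "AE z in M. mix \<eta> z < \<infinity>"
proof -
  have "AE z in M. mix \<eta> z \<noteq> \<infinity>"
    using mix_total[OF assms] by (intro nn_integral_PInf_AE mix_measurable) simp
  then show ?thesis by eventually_elim (simp add: less_top)
qed

lemma weight_le_mix: "h \<in> carrier G \<Longrightarrow> weight \<eta> h z \<le> mix \<eta> z"
  unfolding mix_def
  by (rule order_trans[OF _ nn_integral_ge_point[of h "carrier G" "\<lambda>h. weight \<eta> h z"]]) auto

lemma AE_mix_pos:
  assumes "(\<integral>\<^sup>+h. \<eta> h \<partial>count_space (carrier G)) = 1"
  shows "AE z in M. 0 < mix \<eta> z"
proof -
  have "\<exists>h\<in>carrier G. \<eta> h \<noteq> 0"
  proof (rule ccontr)
    assume "\<not> ?thesis"
    then have "(\<integral>\<^sup>+h. \<eta> h \<partial>count_space (carrier G)) = (\<integral>\<^sup>+h. 0 \<partial>count_space (carrier G))"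
      by (intro nn_integral_cong) auto
    with assms show False by simp
  qed
  then obtain h where h: "h \<in> carrier G" "\<eta> h \<noteq> 0" by auto
  from h(1) have "AE z in M. 0 < w (inv h) z" by (intro deriv_pos) simp
  then show ?thesis
  proof eventually_elim
    case (elim z)
    then have "0 < weight \<eta> h z"
      using h by (auto simp: weight_def ennreal_zero_less_mult_iff zero_less_iff_neq_zero)
    then show ?case using weight_le_mix[OF h(1)] by (rule less_le_trans)
  qed
qed

lemma resample_total:
  assumes "0 < mix \<eta> z" "mix \<eta> z < \<infinity>"
  shows "(\<integral>\<^sup>+h. resample \<eta> z h \<partial>count_space (carrier G)) = 1"
  unfolding resample_def using assms
  by (subst nn_integral_divide) (auto simp: mix_def[symmetric] ennreal_divide_self)

text \<open>Given \<open>z\<close>, the draws \<open>h\<close> and \<open>h'\<close> have the same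
  law, so \<open>\<phi> (inv h') z\<close> is distributed like \<open>\<phi> (inv h) z\<close>,
  which is \<open>x\<close>. The form with an inequality avoids a discussion of the points where
  \<open>mix\<close> is \<open>0\<close> or \<open>\<infinity>\<close>.\<close>

lemma resample_invariance:
  assumes u: "u \<in> borel_measurable M"
  shows "(\<integral>\<^sup>+h. \<eta> h * (\<integral>\<^sup>+x. \<integral>\<^sup>+h'. resample \<eta> (\<phi> h x) h' * u (\<phi> (inv h' \<otimes> h) x)
            \<partial>count_space (carrier G) \<partial>M) \<partial>count_space (carrier G)) \<le>
         (\<integral>\<^sup>+h. \<eta> h \<partial>count_space (carrier G)) * (\<integral>\<^sup>+x. u x \<partial>M)"
proof -
  let ?N = "count_space (carrier G)"
  let ?F = "\<lambda>z. \<integral>\<^sup>+h'. resample \<eta> z h' * u (\<phi> (inv h') z) \<partial>?N"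
  have m: "(\<lambda>z. u (\<phi> (inv h) z)) \<in> borel_measurable M" if "h \<in> carrier G" for h
    using measurable_compose[OF act_measurable u, of "inv h"] that by simp
  have F: "?F \<in> borel_measurable M"
    by (intro borel_measurable_nn_integral_count_space borel_measurable_times_ennreal
        resample_measurable m countable_carrier)
  have "(\<integral>\<^sup>+h. \<eta> h * (\<integral>\<^sup>+x. \<integral>\<^sup>+h'. resample \<eta> (\<phi> h x) h' * u (\<phi> (inv h' \<otimes> h) x) \<partial>?N \<partial>M) \<partial>?N)
      = (\<integral>\<^sup>+h. \<eta> h * (\<integral>\<^sup>+x. ?F (\<phi> h x) \<partial>M) \<partial>?N)"
    by (intro nn_integral_cong arg_cong2[where f="(*)"]) (auto simp: act_mult)
  also have "\<dots> = (\<integral>\<^sup>+z. \<integral>\<^sup>+h. weight \<eta> h z * ?F z \<partial>?N \<partial>M)"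
    using F by (subst nn_integral_mix) auto
  also have "\<dots> = (\<integral>\<^sup>+z. mix \<eta> z * ?F z \<partial>M)"
    by (simp add: nn_integral_multc mix_def)
  also have "\<dots> \<le> (\<integral>\<^sup>+z. (\<integral>\<^sup>+h'. weight \<eta> h' z * u (\<phi> (inv h') z) \<partial>?N) \<partial>M)"
  proof (rule nn_integral_mono)
    fix z
    \<comment> \<open>For \<open>mix \<eta> z\<close> equal to \<open>0\<close> or
      \<open>\<infinity>\<close> the left side is \<open>0\<close> in \<open>ennreal\<close>;
      otherwise the factors cancel.\<close>
    have "mix \<eta> z * (weight \<eta> h' z / mix \<eta> z) \<le> weight \<eta> h' z" for h'
      by (metis ennreal_times_divide ennreal_mult_divide_eq mult.commute mult_divide_eq_ennreal
          ennreal_divide_zero ennreal_zero_divide ennreal_divide_top ennreal_top_mult_left order_refl zero_le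
          mult_zero_left mult_zero_right)
    then have "mix \<eta> z * (resample \<eta> z h' * u (\<phi> (inv h') z)) \<le> weight \<eta> h' z * u (\<phi> (inv h') z)" for h'
      unfolding resample_def mult.assoc[symmetric] by (intro mult_right_mono) auto
    then show "mix \<eta> z * ?F z \<le> (\<integral>\<^sup>+h'. weight \<eta> h' z * u (\<phi> (inv h') z) \<partial>?N)"
      by (subst nn_integral_cmult[symmetric]) (auto intro!: nn_integral_mono)
  qed
  also have "\<dots> = (\<integral>\<^sup>+h'. \<eta> h' * (\<integral>\<^sup>+x. u (\<phi> (inv h') (\<phi> h' x)) \<partial>M) \<partial>?N)"
    by (rule nn_integral_mix[OF m])
  also have "\<dots> = (\<integral>\<^sup>+h'. \<eta> h' * (\<integral>\<^sup>+x. u x \<partial>M) \<partial>?N)"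
    by (intro nn_integral_cong arg_cong2[where f="(*)"]) auto
  also have "\<dots> = (\<integral>\<^sup>+h. \<eta> h \<partial>?N) * (\<integral>\<^sup>+x. u x \<partial>M)"
    by (rule nn_integral_multc) auto
  finally show ?thesis .
qed

text \<open>The displacement is \<open>k\<close> exactly when \<open>h' = h \<otimes> inv k\<close>,
  so the probability is an integral of products of the weights of \<open>h\<close> and
  \<open>h \<otimes> inv k\<close>, divided by \<open>mix\<close>. A product is at most the sum of
  the squares, and reindexing turns both sums of squares into
  \<open>collision \<eta>\<close>.\<close>

lemma resample_displacement:
  assumes k: "k \<in> carrier G"
  shows "(\<integral>\<^sup>+h. \<eta> h * (\<integral>\<^sup>+x. \<integral>\<^sup>+h'. resample \<eta> (\<phi> h x) h' * indicator {k} (inv h' \<otimes> h)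
            \<partial>count_space (carrier G) \<partial>M) \<partial>count_space (carrier G)) \<le> 2 * collision \<eta>"
proof -
  let ?N = "count_space (carrier G)"
  have ik: "inv h' \<otimes> h = k \<longleftrightarrow> h' = h \<otimes> inv k" if "h' \<in> carrier G" "h \<in> carrier G" for h h'
    using that k by (metis inv_closed inv_inv inv_mult_group inv_solve_left m_assoc m_closed r_inv r_one l_inv l_one)
  have hk: "h \<in> carrier G \<Longrightarrow> h \<otimes> inv k \<in> carrier G" for h using k by simp
  have 1: "(\<integral>\<^sup>+h'. resample \<eta> z h' * indicator {k} (inv h' \<otimes> h) \<partial>?N) = resample \<eta> z (h \<otimes> inv k)"
    if h: "h \<in> carrier G" for h z
  proof -
    have "(\<integral>\<^sup>+h'. resample \<eta> z h' * indicator {k} (inv h' \<otimes> h) \<partial>?N)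
        = (\<integral>\<^sup>+h'. resample \<eta> z (h \<otimes> inv k) * indicator {h \<otimes> inv k} h' \<partial>?N)"
      using h ik by (intro nn_integral_cong) (auto simp: indicator_def)
    also have "\<dots> = resample \<eta> z (h \<otimes> inv k)"
      using hk[OF h] by (simp add: nn_integral_cmult)
    finally show ?thesis .
  qed
  have "(\<integral>\<^sup>+h. \<eta> h * (\<integral>\<^sup>+x. \<integral>\<^sup>+h'. resample \<eta> (\<phi> h x) h' * indicator {k} (inv h' \<otimes> h) \<partial>?N \<partial>M) \<partial>?N)
      = (\<integral>\<^sup>+h. \<eta> h * (\<integral>\<^sup>+x. resample \<eta> (\<phi> h x) (h \<otimes> inv k) \<partial>M) \<partial>?N)"
    by (intro nn_integral_cong arg_cong2[where f="(*)"]) (auto simp: 1)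
  also have "\<dots> = (\<integral>\<^sup>+z. \<integral>\<^sup>+h. weight \<eta> h z * resample \<eta> z (h \<otimes> inv k) \<partial>?N \<partial>M)"
    by (rule nn_integral_mix[symmetric]) (intro resample_measurable hk)
  also have "\<dots> \<le> (\<integral>\<^sup>+z. \<integral>\<^sup>+h. (weight \<eta> h z)\<^sup>2 / mix \<eta> z + (weight \<eta> (h \<otimes> inv k) z)\<^sup>2 / mix \<eta> z \<partial>?N \<partial>M)"
    by (intro nn_integral_mono)
       (auto simp: resample_def ennreal_times_divide add_divide_distrib_ennreal[symmetric]
             intro!: divide_right_mono_ennreal ennreal_mult_le_sum_squares)
  also have "\<dots> = (\<integral>\<^sup>+z. (\<integral>\<^sup>+h. (weight \<eta> h z)\<^sup>2 / mix \<eta> z \<partial>?N)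
                + (\<integral>\<^sup>+h. (weight \<eta> (h \<otimes> inv k) z)\<^sup>2 / mix \<eta> z \<partial>?N) \<partial>M)"
    by (intro nn_integral_cong nn_integral_add) auto
  also have "\<dots> = (\<integral>\<^sup>+z. (\<integral>\<^sup>+h. (weight \<eta> h z)\<^sup>2 / mix \<eta> z \<partial>?N)
                + (\<integral>\<^sup>+h. (weight \<eta> h z)\<^sup>2 / mix \<eta> z \<partial>?N) \<partial>M)"
  proof -
    have "bij_betw (\<lambda>h. h \<otimes> inv k) (carrier G) (carrier G)"
      by (rule bij_betw_byWitness[where f'="\<lambda>h. h \<otimes> k"]) (use k in \<open>auto simp: m_assoc\<close>)
    then show ?thesis by (subst nn_integral_bij_count_space) auto
  qed
  also have "\<dots> = 2 * collision \<eta>"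
  proof -
    have "(\<lambda>z. \<integral>\<^sup>+h. (weight \<eta> h z)\<^sup>2 / mix \<eta> z \<partial>?N) \<in> borel_measurable M"
      unfolding power2_eq_square
      by (intro borel_measurable_nn_integral_count_space countable_carrier borel_measurable_divide_ennreal
          mix_measurable borel_measurable_times_ennreal weight_measurable)
    then show ?thesis by (simp add: nn_integral_add collision_def mult_2)
  qed
  finally show ?thesis .
qed

end

text \<open>On \<open>X0\<close> the conditional laws at \<open>x\<close> and at \<open>\<tau> x\<close> have density \<open>t\<close> with respect to each other, up to
  normalisation. When \<open>t\<close> lies in \<open>[1/\<kappa>, \<kappa>]\<close> off a set \<open>Bad\<close> of small conditional probability, one of the two
  laws is at most \<open>\<kappa>\<close> times the other there, and \<open>1\<close> can be charged to that one.\<close>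

locale perturbation = quasi_invariant_action G M \<phi> w
  for G :: "('g, 'b) monoid_scheme" (structure) and M :: "'x measure" and \<phi> and w +
  fixes \<tau> :: "'x \<Rightarrow> 'x" and X0 :: "'x set" and c :: ennreal
    and t :: "'g \<Rightarrow> real" and \<kappa> :: real and Bad :: "'g set"
  assumes tau_measurable: "\<tau> \<in> measurable M M"
    and X0_sets: "X0 \<in> sets M"
    and c_finite: "c < \<infinity>"
    and tau_bound: "\<And>u. u \<in> borel_measurable M \<Longrightarrow>
           (\<integral>\<^sup>+x. indicator X0 x * u (\<tau> x) \<partial>M) \<le> c * (\<integral>\<^sup>+x. u x \<partial>M)"
    and kappa: "1 \<le> \<kappa>"
    and t_bounds: "\<And>k. k \<in> carrier G - Bad \<Longrightarrow> 1 / \<kappa> \<le> t k \<and> t k \<le> \<kappa>"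
    and deriv_tau: "AE x in M. x \<in> X0 \<longrightarrow> (\<forall>h\<in>carrier G. \<exists>r. 0 < r \<and> r < \<infinity> \<and>
           (\<forall>h'\<in>carrier G. w (inv h') (\<phi> h (\<tau> x))
              = w (inv h') (\<phi> h x) * ennreal (t (inv h' \<otimes> h)) * r))"
    and Bad_escape: "\<And>e::real. (0::real) < e \<Longrightarrow> \<exists>K' \<Phi>. finite K' \<and> K' \<subseteq> carrier G \<and> \<Phi> \<in> sets M \<and> emeasure M \<Phi> < ennreal e \<and>
           (\<forall>k\<in>Bad \<inter> carrier G - K'. \<forall>x\<in>X0. \<phi> k x \<in> \<Phi> \<and> \<phi> k (\<tau> x) \<in> \<Phi>)"
begin

lemma tau_space: "x \<in> space M \<Longrightarrow> \<tau> x \<in> space M"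
  using tau_measurable measurable_space by metis

lemma AE_tau:
  assumes P: "AE x in M. P x"
  shows "AE x in M. x \<in> X0 \<longrightarrow> P (\<tau> x)"
proof -
  obtain N where N: "{x \<in> space M. \<not> P x} \<subseteq> N" "emeasure M N = 0" "N \<in> sets M"
    using P by (auto elim: AE_E)
  note [measurable] = N(3) tau_measurable X0_sets
  have "(\<integral>\<^sup>+x. indicator X0 x * indicator N (\<tau> x) \<partial>M) \<le> 0"
    using tau_bound[of "indicator N"] N by simp
  then have "AE x in M. indicator X0 x * indicator N (\<tau> x) = (0::ennreal)"
    by (subst nn_integral_0_iff_AE[symmetric]) auto
  with AE_space show ?thesis
  proof eventually_elim
    case (elim x)
    then show ?case using N(1) tau_space[OF elim(1)] by (auto simp: indicator_def split: if_splits)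
  qed
qed

text \<open>The four ways in which a resampled displacement and point can account for a separation
  of \<open>x\<close> from \<open>\<tau> x\<close>. The term for \<open>S\<close> carries the factor
  \<open>\<kappa>\<close> because only one of the two points need land in \<open>S\<close>, possibly
  the one whose law is not being charged. Bad displacements pass the test at both points, so the
  terms for \<open>K'\<close> and \<open>\<Phi>\<close> have coefficient 1.\<close>

definition test :: "'x set \<Rightarrow> 'g set \<Rightarrow> 'g set \<Rightarrow> 'x set \<Rightarrow> 'g \<Rightarrow> 'x \<Rightarrow> ennreal" where
  "test S K K' \<Phi> k y = ennreal \<kappa> * indicator S y + ennreal \<kappa> * indicator K k + indicator K' k + indicator \<Phi> y"

definition expected_test :: "('g \<Rightarrow> ennreal) \<Rightarrow> 'x set \<Rightarrow> 'g set \<Rightarrow> 'g set \<Rightarrow> 'x set \<Rightarrow> 'g \<Rightarrow> 'x \<Rightarrow> ennreal" where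
  "expected_test \<eta> S K K' \<Phi> h x = (\<integral>\<^sup>+h'. resample \<eta> (\<phi> h x) h' *
      test S K K' \<Phi> (inv h' \<otimes> h) (\<phi> (inv h' \<otimes> h) x) \<partial>count_space (carrier G))"

text \<open>A displacement \<open>k\<close> preserves the separation by the invariant set
  \<open>A\<close>. If \<open>k \<notin> K\<close>, then \<open>H\<close> does not separate the
  displaced points, so exactly one of them lies in the symmetric difference \<open>S\<close>. Hence
  for every \<open>h'\<close> the test succeeds at \<open>x\<close> or at
  \<open>\<tau> x\<close>.\<close>

lemma separation_le_expected_test:
  assumes D: "0 < mix \<eta> (\<phi> h x)" "mix \<eta> (\<phi> h x) < \<infinity>" "0 < mix \<eta> (\<phi> h (\<tau> x))" "mix \<eta> (\<phi> h (\<tau> x)) < \<infinity>"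
    and fin: "\<And>h'. h' \<in> carrier G \<Longrightarrow> weight \<eta> h' (\<phi> h x) < \<infinity>"
    and h: "h \<in> carrier G"
    and x: "x \<in> X0" "x \<in> space M"
    and r: "r < \<infinity>" "\<And>h'. h' \<in> carrier G \<Longrightarrow> w (inv h') (\<phi> h (\<tau> x))
              = w (inv h') (\<phi> h x) * ennreal (t (inv h' \<otimes> h)) * r"
    and A: "\<And>g y. g \<in> carrier G \<Longrightarrow> y \<in> space M \<Longrightarrow> \<phi> g y \<in> A \<longleftrightarrow> y \<in> A"
    and sep: "(x \<in> A) \<noteq> (\<tau> x \<in> A)"
    and HK: "\<And>k. k \<in> carrier G - K \<Longrightarrow> \<phi> k x \<in> H \<longleftrightarrow> \<phi> k (\<tau> x) \<in> H"
    and S: "S = (A - H) \<union> (H - A)"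
    and Phi: "\<And>k. k \<in> Bad \<inter> carrier G - K' \<Longrightarrow> \<phi> k x \<in> \<Phi> \<and> \<phi> k (\<tau> x) \<in> \<Phi>"
  shows "1 \<le> expected_test \<eta> S K K' \<Phi> h x + expected_test \<eta> S K K' \<Phi> h (\<tau> x)"
proof -
  let ?N = "count_space (carrier G)"
  let ?q = "\<lambda>h'. resample \<eta> (\<phi> h x) h'" and ?q' = "\<lambda>h'. resample \<eta> (\<phi> h (\<tau> x)) h'"
  let ?k = "\<lambda>h'. inv h' \<otimes> h"
  let ?U = "\<lambda>h'. test S K K' \<Phi> (?k h') (\<phi> (?k h') x)" and ?U' = "\<lambda>h'. test S K K' \<Phi> (?k h') (\<phi> (?k h') (\<tau> x))"
  have kc: "?k h' \<in> carrier G" if "h' \<in> carrier G" for h' using that h by simp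
  have sum_eq: "expected_test \<eta> S K K' \<Phi> h x + expected_test \<eta> S K K' \<Phi> h (\<tau> x)
      = (\<integral>\<^sup>+h'. ?q h' * ?U h' + ?q' h' * ?U' h' \<partial>?N)"
    unfolding expected_test_def by (rule nn_integral_add[symmetric]) auto
  have q'_eq: "?q' h' = weight \<eta> h' (\<phi> h x) * ennreal (t (?k h')) * r / mix \<eta> (\<phi> h (\<tau> x))"
    if "h' \<in> carrier G" for h'
    using r(2)[OF that] by (simp add: resample_def weight_def mult_ac)
  have test_ge: "1 \<le> test S K K' \<Phi> k y"
    if "k \<in> K' \<or> y \<in> \<Phi>" for k y
  proof -
    have "1 \<le> (indicator K' k + indicator \<Phi> y :: ennreal)"
      using that by (auto simp: indicator_def)
    also have "\<dots> \<le> test S K K' \<Phi> k y"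
      unfolding test_def add.assoc[of _ "indicator K' k"] by (rule add_increasing) simp_all
    finally show ?thesis .
  qed
  have test_ge_kappa: "ennreal \<kappa> \<le> test S K K' \<Phi> k y" if "k \<in> K \<or> y \<in> S" for k y
  proof -
    have "ennreal \<kappa> \<le> ennreal \<kappa> * indicator S y + ennreal \<kappa> * indicator K k"
      using that by (auto simp: indicator_def)
    also have "\<dots> \<le> test S K K' \<Phi> k y"
      unfolding test_def add.assoc[of _ "indicator K' k"] by (rule add_increasing2) simp_all
    finally show ?thesis .
  qed
  have bad: "1 \<le> ?U h'" "1 \<le> ?U' h'" if "h' \<in> carrier G" "?k h' \<in> Bad" for h'
    using Phi[of "?k h'"] kc[OF that(1)] that by (auto intro!: test_ge)
  have good: "\<phi> (?k h') x \<in> S \<or> \<phi> (?k h') (\<tau> x) \<in> S \<or> ?k h' \<in> K" if "h' \<in> carrier G" for h'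
    using HK[of "?k h'"] sep A[OF kc[OF that] x(2)] A[OF kc[OF that] tau_space[OF x(2)]] kc[OF that]
    unfolding S by auto
  have good_le: "p \<le> ?q h' * ?U h' + ?q' h' * ?U' h'"
    if "h' \<in> carrier G" "p \<le> ennreal \<kappa> * ?q h'" "p \<le> ennreal \<kappa> * ?q' h'" for h' p
    using good[OF that(1)]
  proof (elim disjE)
    assume "\<phi> (?k h') x \<in> S"
    then have "ennreal \<kappa> \<le> ?U h'" by (intro test_ge_kappa) simp
    then have "?q h' * ennreal \<kappa> \<le> ?q h' * ?U h'" by (rule mult_left_mono) simp
    then have "p \<le> ?q h' * ?U h'" by (rule order_trans[OF that(2)[unfolded mult.commute[of "ennreal \<kappa>"]]])
    then show ?thesis by (simp add: add_increasing2)
  next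
    assume "\<phi> (?k h') (\<tau> x) \<in> S"
    then have "ennreal \<kappa> \<le> ?U' h'" by (intro test_ge_kappa) simp
    then have "?q' h' * ennreal \<kappa> \<le> ?q' h' * ?U' h'" by (rule mult_left_mono) simp
    then have "p \<le> ?q' h' * ?U' h'" by (rule order_trans[OF that(3)[unfolded mult.commute[of "ennreal \<kappa>"]]])
    then show ?thesis by (simp add: add_increasing)
  next
    assume "?k h' \<in> K"
    then have "ennreal \<kappa> \<le> ?U h'" by (intro test_ge_kappa) simp
    then have "?q h' * ennreal \<kappa> \<le> ?q h' * ?U h'" by (rule mult_left_mono) simp
    then have "p \<le> ?q h' * ?U h'" by (rule order_trans[OF that(2)[unfolded mult.commute[of "ennreal \<kappa>"]]])
    then show ?thesis by (simp add: add_increasing2)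
  qed
  have kap: "p \<le> ennreal \<kappa> * p" for p
  proof -
    have "1 \<le> ennreal \<kappa>" using kappa by (metis ennreal_1 ennreal_leI)
    then have "1 * p \<le> ennreal \<kappa> * p" by (rule mult_right_mono) simp
    then show ?thesis by simp
  qed
  have t0: "0 \<le> t (?k h')" "1 \<le> \<kappa> * t (?k h')" "t (?k h') \<le> \<kappa>" if "h' \<in> carrier G" "?k h' \<notin> Bad" for h'
  proof -
    have "1 / \<kappa> \<le> t (?k h')" "t (?k h') \<le> \<kappa>" using t_bounds kc that by auto
    then show "1 \<le> \<kappa> * t (?k h')" "t (?k h') \<le> \<kappa>" "0 \<le> t (?k h')" using kappa
      by (auto simp: field_simps intro: order_trans[of 0 "1 / \<kappa>"])
  qed
  show ?thesis
  \<comment> \<open>The inequality between the normalising integrals decides which law is dominated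
    by the other; its total mass is the \<open>1\<close> of the claim. Each case then needs only one
    of the two bounds on \<open>t\<close>.\<close>
  proof (cases "mix \<eta> (\<phi> h (\<tau> x)) \<le> r * mix \<eta> (\<phi> h x)")
    case True
    have "1 = (\<integral>\<^sup>+h'. ?q h' \<partial>?N)" using D by (intro resample_total[symmetric])
    also have "\<dots> \<le> (\<integral>\<^sup>+h'. ?q h' * ?U h' + ?q' h' * ?U' h' \<partial>?N)"
    proof (rule nn_integral_mono)
      fix h' assume "h' \<in> space ?N" then have h': "h' \<in> carrier G" by simp
      show "?q h' \<le> ?q h' * ?U h' + ?q' h' * ?U' h'"
      proof (cases "?k h' \<in> Bad")
        case True
        then have "?q h' * 1 \<le> ?q h' * ?U h'" using bad h' by (intro mult_left_mono) auto
        then show ?thesis by (simp add: add_increasing2)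
      next
        case False
        have "?q h' \<le> ennreal \<kappa> * ?q' h'"
          unfolding q'_eq[OF h'] unfolding resample_def
          using D fin[OF h'] r(1) True t0[OF h' False] kappa by (intro ennreal_weight_le) auto
        then show ?thesis using h' kap by (intro good_le) auto
      qed
    qed
    finally show ?thesis by (simp add: sum_eq)
  next
    case False
    have "1 = (\<integral>\<^sup>+h'. ?q' h' \<partial>?N)" using D by (intro resample_total[symmetric])
    also have "\<dots> \<le> (\<integral>\<^sup>+h'. ?q h' * ?U h' + ?q' h' * ?U' h' \<partial>?N)"
    proof (rule nn_integral_mono)
      fix h' assume "h' \<in> space ?N" then have h': "h' \<in> carrier G" by simp
      show "?q' h' \<le> ?q h' * ?U h' + ?q' h' * ?U' h'"
      proof (cases "?k h' \<in> Bad")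
        case True
        then have "?q' h' * 1 \<le> ?q' h' * ?U' h'" using bad h' by (intro mult_left_mono) auto
        then show ?thesis by (simp add: add_increasing)
      next
        case good: False
        have "?q' h' \<le> ennreal \<kappa> * ?q h'"
          unfolding q'_eq[OF h'] unfolding resample_def
          using D fin[OF h'] r(1) False t0[OF h' good] kappa by (intro ennreal_weight_ge) auto
        then show ?thesis using h' kap by (intro good_le) auto
      qed
    qed
    finally show ?thesis by (simp add: sum_eq)
  qed
qed

lemma expected_test_measurable:
  assumes [measurable]: "S \<in> sets M" "\<Phi> \<in> sets M" and h: "h \<in> carrier G"
  shows "expected_test \<eta> S K K' \<Phi> h \<in> borel_measurable M"
  unfolding expected_test_def test_def
proof (intro borel_measurable_nn_integral_count_space countable_carrier borel_measurable_times_ennreal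
    borel_measurable_add)
  fix h' assume h': "h' \<in> carrier G"
  have [measurable]: "\<phi> (inv h' \<otimes> h) \<in> measurable M M" "\<phi> h \<in> measurable M M"
    using h h' by (auto intro: act_measurable)
  note [measurable] = resample_measurable[OF h', of \<eta>]
  show "(\<lambda>x. resample \<eta> (\<phi> h x) h') \<in> borel_measurable M" by measurable
  show "(\<lambda>x. indicator S (\<phi> (inv h' \<otimes> h) x) :: ennreal) \<in> borel_measurable M" by measurable
  show "(\<lambda>x. indicator \<Phi> (\<phi> (inv h' \<otimes> h) x) :: ennreal) \<in> borel_measurable M" by measurable
qed auto

text \<open>\<open>test\<close> is a sum of indicators of two kinds. Those of a set of points are
  controlled by \<open>resample_invariance\<close>, those of a finite set of displacements by
  \<open>resample_displacement\<close>, element by element.\<close>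

lemma nn_integral_expected_test:
  assumes eta: "(\<integral>\<^sup>+h. \<eta> h \<partial>count_space (carrier G)) = 1"
    and S: "S \<in> sets M" and Phi: "\<Phi> \<in> sets M"
    and K: "finite K" "K \<subseteq> carrier G" and K': "finite K'" "K' \<subseteq> carrier G"
  shows "(\<integral>\<^sup>+h. \<eta> h * (\<integral>\<^sup>+x. expected_test \<eta> S K K' \<Phi> h x \<partial>M) \<partial>count_space (carrier G))
    \<le> ennreal \<kappa> * emeasure M S + emeasure M \<Phi> + (ennreal \<kappa> * of_nat (card K) + of_nat (card K')) * (2 * collision \<eta>)"
proof -
  let ?N = "count_space (carrier G)"
  define E where "E F = (\<integral>\<^sup>+h. \<eta> h * (\<integral>\<^sup>+x. \<integral>\<^sup>+h'. resample \<eta> (\<phi> h x) h' * F (inv h' \<otimes> h) (\<phi> (inv h' \<otimes> h) x)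
       \<partial>?N \<partial>M) \<partial>?N)" for F :: "'g \<Rightarrow> 'x \<Rightarrow> ennreal"
  have meas: "(\<lambda>x. \<integral>\<^sup>+h'. resample \<eta> (\<phi> h x) h' * F (inv h' \<otimes> h) (\<phi> (inv h' \<otimes> h) x) \<partial>?N) \<in> borel_measurable M"
    if "h \<in> carrier G" "\<And>k. k \<in> carrier G \<Longrightarrow> F k \<in> borel_measurable M" for F h
    using that
    by (intro borel_measurable_nn_integral_count_space countable_carrier borel_measurable_times_ennreal
        measurable_compose[OF act_measurable, of h] resample_measurable
        measurable_compose[OF act_measurable, of "inv _ \<otimes> h"]) auto
  have E_add: "E (\<lambda>k y. F k y + F' k y) = E F + E F'"
    if "\<And>k. k \<in> carrier G \<Longrightarrow> F k \<in> borel_measurable M" "\<And>k. k \<in> carrier G \<Longrightarrow> F' k \<in> borel_measurable M" for F F'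
    unfolding E_def
  proof (subst nn_integral_add[symmetric], simp, simp, intro nn_integral_cong)
    fix h assume "h \<in> space ?N"
    then have h: "h \<in> carrier G" by simp
    let ?I = "\<lambda>F x. \<integral>\<^sup>+h'. resample \<eta> (\<phi> h x) h' * F (inv h' \<otimes> h) (\<phi> (inv h' \<otimes> h) x) \<partial>?N"
    have "(\<integral>\<^sup>+x. ?I (\<lambda>k y. F k y + F' k y) x \<partial>M) = (\<integral>\<^sup>+x. ?I F x + ?I F' x \<partial>M)"
      by (intro nn_integral_cong) (simp add: distrib_left nn_integral_add)
    also have "\<dots> = (\<integral>\<^sup>+x. ?I F x \<partial>M) + (\<integral>\<^sup>+x. ?I F' x \<partial>M)"
      by (rule nn_integral_add[OF meas[OF h that(1)] meas[OF h that(2)]])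
    finally show "\<eta> h * (\<integral>\<^sup>+x. ?I (\<lambda>k y. F k y + F' k y) x \<partial>M)
        = \<eta> h * (\<integral>\<^sup>+x. ?I F x \<partial>M) + \<eta> h * (\<integral>\<^sup>+x. ?I F' x \<partial>M)"
      by (simp add: distrib_left)
  qed
  have E_cmult: "E (\<lambda>k y. a * F k y) = a * E F"
    if "\<And>k. k \<in> carrier G \<Longrightarrow> F k \<in> borel_measurable M" for F a
    unfolding E_def
  proof (subst nn_integral_cmult[symmetric], simp, intro nn_integral_cong)
    fix h assume "h \<in> space ?N"
    then have h: "h \<in> carrier G" by simp
    let ?I = "\<lambda>F x. \<integral>\<^sup>+h'. resample \<eta> (\<phi> h x) h' * F (inv h' \<otimes> h) (\<phi> (inv h' \<otimes> h) x) \<partial>?N"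
    have "(\<integral>\<^sup>+x. ?I (\<lambda>k y. a * F k y) x \<partial>M) = (\<integral>\<^sup>+x. a * ?I F x \<partial>M)"
      by (intro nn_integral_cong) (simp add: mult.left_commute[of _ a] nn_integral_cmult)
    also have "\<dots> = a * (\<integral>\<^sup>+x. ?I F x \<partial>M)"
      by (rule nn_integral_cmult[OF meas[OF h that]])
    finally show "\<eta> h * (\<integral>\<^sup>+x. ?I (\<lambda>k y. a * F k y) x \<partial>M) = a * (\<eta> h * (\<integral>\<^sup>+x. ?I F x \<partial>M))"
      by (simp add: mult.left_commute)
  qed
  have E_point: "E (\<lambda>k y. indicator {j} k) \<le> 2 * collision \<eta>" if "j \<in> carrier G" for j
    unfolding E_def using resample_displacement[OF that] .
  have E_fin: "E (\<lambda>k y. indicator J k) \<le> of_nat (card J) * (2 * collision \<eta>)" if "finite J" "J \<subseteq> carrier G" for J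
    using that
  proof induction
    case empty
    show ?case by (simp add: E_def)
  next
    case (insert j J)
    have "E (\<lambda>k y. indicator (insert j J) k) = E (\<lambda>k y. indicator {j} k + indicator J k)"
      using insert by (intro arg_cong[where f=E] ext) (auto simp: indicator_def)
    also have "\<dots> = E (\<lambda>k y. indicator {j} k) + E (\<lambda>k y. indicator J k)"
      by (rule E_add) auto
    also have "\<dots> \<le> 2 * collision \<eta> + of_nat (card J) * (2 * collision \<eta>)"
      using insert by (intro add_mono E_point) auto
    also have "\<dots> = of_nat (card (insert j J)) * (2 * collision \<eta>)"
      using insert by (simp add: distrib_right)
    finally show ?case .
  qed
  have E_set: "E (\<lambda>k y. indicator B y) \<le> emeasure M B" if "B \<in> sets M" for B
    using resample_invariance[of "indicator B" \<eta>] that eta by (simp add: E_def)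
  have "(\<integral>\<^sup>+h. \<eta> h * (\<integral>\<^sup>+x. expected_test \<eta> S K K' \<Phi> h x \<partial>M) \<partial>?N) = E (test S K K' \<Phi>)"
    unfolding expected_test_def E_def ..
  also have "\<dots> = ennreal \<kappa> * E (\<lambda>k y. indicator S y) + ennreal \<kappa> * E (\<lambda>k y. indicator K k)
      + E (\<lambda>k y. indicator K' k) + E (\<lambda>k y. indicator \<Phi> y)"
    unfolding test_def using S Phi by (simp add: E_add E_cmult)
  also have "\<dots> \<le> ennreal \<kappa> * emeasure M S + ennreal \<kappa> * (of_nat (card K) * (2 * collision \<eta>))
      + of_nat (card K') * (2 * collision \<eta>) + emeasure M \<Phi>"
    by (intro add_mono mult_left_mono E_set E_fin S Phi K K') auto
  also have "\<dots> = ennreal \<kappa> * emeasure M S + emeasure M \<Phi> + (ennreal \<kappa> * of_nat (card K) + of_nat (card K')) * (2 * collision \<eta>)"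
    by (simp add: algebra_simps)
  finally show ?thesis .
qed

text \<open>On the separated set the expected tests at \<open>x\<close> and \<open>\<tau> x\<close>
  add up to at least 1. The second is brought back to \<open>x\<close> by \<open>tau_bound\<close>,
  whence the factor \<open>1 + c\<close>.\<close>

lemma separation_bound:
  assumes eta: "(\<integral>\<^sup>+h. \<eta> h \<partial>count_space (carrier G)) = 1" "\<And>h. \<eta> h < \<infinity>"
    and A: "A \<in> sets M" "\<And>g y. g \<in> carrier G \<Longrightarrow> y \<in> space M \<Longrightarrow> \<phi> g y \<in> A \<longleftrightarrow> y \<in> A"
    and H: "H \<in> sets M" and K: "finite K" "K \<subseteq> carrier G"
    and HK: "\<And>k x. k \<in> carrier G - K \<Longrightarrow> x \<in> X0 \<Longrightarrow> \<phi> k x \<in> H \<longleftrightarrow> \<phi> k (\<tau> x) \<in> H"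
    and K': "finite K'" "K' \<subseteq> carrier G" and Phi: "\<Phi> \<in> sets M"
    and bad: "\<And>k x. k \<in> Bad \<inter> carrier G - K' \<Longrightarrow> x \<in> X0 \<Longrightarrow> \<phi> k x \<in> \<Phi> \<and> \<phi> k (\<tau> x) \<in> \<Phi>"
  shows "emeasure M {x\<in>X0. (x \<in> A) \<noteq> (\<tau> x \<in> A)} \<le> (1 + c) *
      (ennreal \<kappa> * emeasure M ((A - H) \<union> (H - A)) + emeasure M \<Phi>
        + (ennreal \<kappa> * of_nat (card K) + of_nat (card K')) * (2 * collision \<eta>))"
proof -
  let ?N = "count_space (carrier G)"
  let ?S = "(A - H) \<union> (H - A)"
  let ?\<Delta> = "{x\<in>X0. (x \<in> A) \<noteq> (\<tau> x \<in> A)}"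
  let ?Q = "\<lambda>h x. expected_test \<eta> ?S K K' \<Phi> h x"
  have S: "?S \<in> sets M" using A H by auto
  have "?\<Delta> = {x\<in>space M. x \<in> X0 \<and> (x \<in> A) \<noteq> (\<tau> x \<in> A)}"
    using sets.sets_into_space[OF X0_sets] by auto
  also have "\<dots> \<in> sets M"
    using A(1) X0_sets tau_measurable by measurable
  finally have D[measurable]: "?\<Delta> \<in> sets M" .
  have *: "emeasure M ?\<Delta> \<le> (1 + c) * (\<integral>\<^sup>+x. ?Q h x \<partial>M)" if h: "h \<in> carrier G" for h
  proof -
    note [measurable] = expected_test_measurable[OF S Phi h] X0_sets tau_measurable
    have m: "AE x in M. 0 < mix \<eta> (\<phi> h x) \<and> mix \<eta> (\<phi> h x) < \<infinity>"
      using AE_mix_pos[OF eta(1)] AE_mix_finite[OF eta(1)] by (intro AE_act[OF h]) auto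
    have "emeasure M ?\<Delta> = (\<integral>\<^sup>+x. indicator ?\<Delta> x \<partial>M)"
      by (rule nn_integral_indicator[OF D, symmetric])
    also have "\<dots> \<le> (\<integral>\<^sup>+x. ?Q h x + indicator X0 x * ?Q h (\<tau> x) \<partial>M)"
    proof (rule nn_integral_mono_AE)
      show "AE x in M. indicator ?\<Delta> x \<le> ?Q h x + indicator X0 x * ?Q h (\<tau> x)"
        using m AE_tau[OF m] AE_act[OF h AE_weight_finite[of \<eta>, OF eta(2)]] deriv_tau AE_space
      proof eventually_elim
        case (elim x)
        show ?case
        proof (cases "x \<in> ?\<Delta>")
          case True
          then have x: "x \<in> X0" "(x \<in> A) \<noteq> (\<tau> x \<in> A)" by auto
          obtain r where r: "r < \<infinity>" "\<And>h'. h' \<in> carrier G \<Longrightarrow> w (inv h') (\<phi> h (\<tau> x))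
              = w (inv h') (\<phi> h x) * ennreal (t (inv h' \<otimes> h)) * r"
            using elim(4) x(1) h by blast
          have "1 \<le> ?Q h x + ?Q h (\<tau> x)"
            by (rule separation_le_expected_test[where A=A and H=H, OF _ _ _ _ _ h x(1) elim(5) r A(2) x(2)])
               (use elim x HK bad in auto)
          then show ?thesis using True x by simp
        qed simp
      qed
    qed
    also have "\<dots> = (\<integral>\<^sup>+x. ?Q h x \<partial>M) + (\<integral>\<^sup>+x. indicator X0 x * ?Q h (\<tau> x) \<partial>M)"
      by (rule nn_integral_add) measurable
    also have "\<dots> \<le> (\<integral>\<^sup>+x. ?Q h x \<partial>M) + c * (\<integral>\<^sup>+x. ?Q h x \<partial>M)"
      by (intro add_left_mono tau_bound) measurable
    finally show ?thesis by (simp add: distrib_right)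
  qed
  \<comment> \<open>The bound \<open>*\<close> holds for each \<open>h\<close>, but only the average
    of its right side over \<open>\<eta>\<close> is controlled. The left side is constant in
    \<open>h\<close>.\<close>
  have "emeasure M ?\<Delta> = (\<integral>\<^sup>+h. \<eta> h * emeasure M ?\<Delta> \<partial>?N)"
    by (simp add: nn_integral_multc eta)
  also have "\<dots> \<le> (\<integral>\<^sup>+h. (1 + c) * (\<eta> h * (\<integral>\<^sup>+x. ?Q h x \<partial>M)) \<partial>?N)"
  proof (rule nn_integral_mono)
    fix h assume "h \<in> space ?N"
    then have "\<eta> h * emeasure M ?\<Delta> \<le> \<eta> h * ((1 + c) * (\<integral>\<^sup>+x. ?Q h x \<partial>M))"
      by (intro mult_left_mono *) auto
    then show "\<eta> h * emeasure M ?\<Delta> \<le> (1 + c) * (\<eta> h * (\<integral>\<^sup>+x. ?Q h x \<partial>M))"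
      by (simp add: mult.left_commute)
  qed
  also have "\<dots> = (1 + c) * (\<integral>\<^sup>+h. \<eta> h * (\<integral>\<^sup>+x. ?Q h x \<partial>M) \<partial>?N)"
    by (rule nn_integral_cmult) auto
  also have "\<dots> \<le> (1 + c) * (ennreal \<kappa> * emeasure M ?S + emeasure M \<Phi>
        + (ennreal \<kappa> * of_nat (card K) + of_nat (card K')) * (2 * collision \<eta>))"
    by (intro mult_left_mono nn_integral_expected_test eta S Phi K K') auto
  finally show ?thesis .
qed

text \<open>The order of choices matters: \<open>H\<close> and \<open>\<Phi>\<close> come with
  finite sets \<open>K\<close> and \<open>K'\<close> of uncontrolled size, and only then is
  \<open>\<eta>\<close> chosen with a collision probability small compared with these sizes.\<close>

lemma invariant_under_tau:
  assumes collision: "\<And>e::real. (0::real) < e \<Longrightarrow> \<exists>\<eta>. (\<integral>\<^sup>+h. \<eta> h \<partial>count_space (carrier G)) = 1 \<and>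
        (\<forall>h. \<eta> h < \<infinity>) \<and> collision \<eta> < ennreal e"
    and A: "A \<in> sets M" "\<And>g y. g \<in> carrier G \<Longrightarrow> y \<in> space M \<Longrightarrow> \<phi> g y \<in> A \<longleftrightarrow> y \<in> A"
    and approx: "\<And>e::real. (0::real) < e \<Longrightarrow> \<exists>H K. H \<in> sets M \<and> emeasure M ((A - H) \<union> (H - A)) < ennreal e \<and>
        finite K \<and> K \<subseteq> carrier G \<and> (\<forall>k\<in>carrier G - K. \<forall>x\<in>X0. \<phi> k x \<in> H \<longleftrightarrow> \<phi> k (\<tau> x) \<in> H)"
  shows "AE x in M. x \<in> X0 \<longrightarrow> (x \<in> A \<longleftrightarrow> \<tau> x \<in> A)"
proof -
  let ?\<Delta> = "{x\<in>X0. (x \<in> A) \<noteq> (\<tau> x \<in> A)}"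
  obtain c' where c': "c = ennreal c'" "0 \<le> c'" using c_finite by (cases c) auto
  have "emeasure M ?\<Delta> \<le> ennreal e" if e: "0 < e" for e
  proof -
    \<comment> \<open>There are three error terms, each at most \<open>\<kappa> * e1\<close>, and
      the whole is multiplied by \<open>1 + c'\<close>.\<close>
    define e1 where "e1 = e / (3 * (1 + c') * \<kappa>)"
    have e1: "0 < e1" using e c' kappa by (simp add: e1_def)
    obtain H K where H: "H \<in> sets M" "emeasure M ((A - H) \<union> (H - A)) < e1" and
      K: "finite K" "K \<subseteq> carrier G" "\<forall>k\<in>carrier G - K. \<forall>x\<in>X0. \<phi> k x \<in> H \<longleftrightarrow> \<phi> k (\<tau> x) \<in> H"
      using approx[OF e1] by blast
    obtain K' \<Phi> where K': "finite K'" "K' \<subseteq> carrier G" "\<Phi> \<in> sets M" "emeasure M \<Phi> < e1"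
      "\<forall>k\<in>Bad \<inter> carrier G - K'. \<forall>x\<in>X0. \<phi> k x \<in> \<Phi> \<and> \<phi> k (\<tau> x) \<in> \<Phi>"
      using Bad_escape[OF e1] by blast
    \<comment> \<open>The summand \<open>1\<close> keeps \<open>n\<close> positive when
      \<open>K\<close> and \<open>K'\<close> are empty.\<close>
    define n where "n = \<kappa> * card K + card K' + 1"
    have n: "0 < n" using kappa by (simp add: n_def add_nonneg_pos)
    obtain \<eta> where eta: "(\<integral>\<^sup>+h. \<eta> h \<partial>count_space (carrier G)) = 1" "\<And>h. \<eta> h < \<infinity>" "collision \<eta> < ennreal (e1 / (2 * n))"
      using collision[of "e1 / (2 * n)"] e1 n by auto
    have n_eq: "ennreal \<kappa> * of_nat (card K) + of_nat (card K') \<le> ennreal n"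
      using kappa unfolding n_def ennreal_of_nat_eq_real_of_nat
      by (simp add: ennreal_mult'[symmetric] ennreal_plus[symmetric] ennreal_leI del: ennreal_plus)
    have "emeasure M ?\<Delta> \<le> (1 + c) *
      (ennreal \<kappa> * emeasure M ((A - H) \<union> (H - A)) + emeasure M \<Phi>
        + (ennreal \<kappa> * of_nat (card K) + of_nat (card K')) * (2 * collision \<eta>))"
      using K K' by (intro separation_bound eta A H) auto
    also have "\<dots> \<le> ennreal (1 + c') * (ennreal \<kappa> * ennreal e1 + ennreal e1 + ennreal n * (2 * ennreal (e1 / (2 * n))))"
      using H(2) K'(4) eta(3) n_eq c'
      by (intro mult_mono add_mono mult_left_mono) (auto simp: ennreal_plus)
    also have "\<dots> = ennreal ((1 + c') * (\<kappa> * e1 + e1 + n * (2 * (e1 / (2 * n)))))"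
    proof -
      have two: "(2::ennreal) = ennreal 2" by simp
      show ?thesis
        unfolding two using n e1 c' kappa
        by (simp add: ennreal_mult'[symmetric] ennreal_plus[symmetric] del: ennreal_plus ennreal_numeral)
    qed
    also have "\<dots> \<le> ennreal e"
    proof (rule ennreal_leI)
      have "n * (2 * (e1 / (2 * n))) = e1" using n by (simp add: field_simps)
      moreover have "e1 \<le> \<kappa> * e1" using e1 kappa by simp
      ultimately have "(1 + c') * (\<kappa> * e1 + e1 + n * (2 * (e1 / (2 * n)))) \<le> (1 + c') * (3 * (\<kappa> * e1))"
        using c' by (intro mult_left_mono) auto
      also have "\<dots> = e" using kappa c' unfolding e1_def by (simp add: field_simps add_nonneg_eq_0_iff)
      finally show "(1 + c') * (\<kappa> * e1 + e1 + n * (2 * (e1 / (2 * n)))) \<le> e" .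
    qed
    finally show ?thesis .
  qed
  then have "emeasure M ?\<Delta> \<le> 0" by - (rule ennreal_le_epsilon, simp)
  then have "emeasure M ?\<Delta> = 0" by simp
  moreover have "?\<Delta> = {x\<in>space M. x \<in> X0 \<and> (x \<in> A) \<noteq> (\<tau> x \<in> A)}"
    using sets.sets_into_space[OF X0_sets] by auto
  moreover have "{x\<in>space M. x \<in> X0 \<and> (x \<in> A) \<noteq> (\<tau> x \<in> A)} \<in> sets M"
    using A(1) X0_sets tau_measurable by measurable
  ultimately show ?thesis
    by (intro AE_I[where N="?\<Delta>"]) auto
qed

end

text \<open>The sets that can be approximated form a sigma-algebra. For a countable union, half of
  the error is spent on truncating it to finitely many members, the other half on approximating
  these.\<close>

lemma (in finite_measure) approximation_by_algebra:
  assumes gen: "sets M = sigma_sets (space M) E"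
    and sets: "\<And>H. H \<in> \<A> \<Longrightarrow> H \<in> sets M"
    and empty: "{} \<in> \<A>"
    and compl: "\<And>H. H \<in> \<A> \<Longrightarrow> space M - H \<in> \<A>"
    and union: "\<And>H H'. H \<in> \<A> \<Longrightarrow> H' \<in> \<A> \<Longrightarrow> H \<union> H' \<in> \<A>"
    and base: "\<And>A e. A \<in> E \<Longrightarrow> 0 < e \<Longrightarrow> \<exists>H\<in>\<A>. measure M ((A - H) \<union> (H - A)) < e"
    and A: "A \<in> sets M" and e: "0 < (e::real)"
  shows "\<exists>H\<in>\<A>. measure M ((A - H) \<union> (H - A)) < e"
proof -
  have "A \<in> sigma_sets (space M) E" using A gen by simp
  then show ?thesis using e
  proof (induction arbitrary: e)
    case (Basic a)
    then show ?case by (rule base)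
  next
    case Empty
    then show ?case by (intro bexI[of _ "{}"] empty) simp
  next
    case (Compl a)
    then obtain H where H: "H \<in> \<A>" "measure M ((a - H) \<union> (H - a)) < e" by blast
    have "a \<subseteq> space M" using Compl(1) gen sets.sets_into_space by blast
    moreover have "H \<subseteq> space M" using sets[OF H(1)] sets.sets_into_space by blast
    ultimately have "((space M - a) - (space M - H)) \<union> ((space M - H) - (space M - a)) = (a - H) \<union> (H - a)"
      by blast
    then show ?case using H compl by (intro bexI[of _ "space M - H"]) auto
  next
    case (Union a)
    have a[measurable]: "a i \<in> sets M" for i using Union(1) gen by blast
    have "(\<lambda>n. measure M (\<Union>i<n. a i)) \<longlonglongrightarrow> measure M (\<Union>n. \<Union>i<n. a i)"
      by (rule finite_Lim_measure_incseq) (auto simp: incseq_def intro: less_le_trans)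
    moreover have "(\<Union>n. \<Union>i<n. a i) = (\<Union>i. a i)" by blast
    ultimately have "\<forall>\<^sub>F n in sequentially. measure M (\<Union>i. a i) - e / 2 < measure M (\<Union>i<n. a i)"
      using Union(3) by (intro order_tendstoD(1)[where y="measure M (\<Union>i. a i)"]) auto
    then obtain n where n: "measure M (\<Union>i. a i) - e / 2 < measure M (\<Union>i<n. a i)"
      by (auto dest: eventually_happens)
    \<comment> \<open>The denominator has \<open>n + 1\<close> instead of \<open>n\<close> so as to
      be nonzero for the empty union.\<close>
    have "\<exists>H\<in>\<A>. measure M ((a i - H) \<union> (H - a i)) < e / (2 * (n + 1))" for i
      using Union(3) by (intro Union.IH) auto
    then obtain H where H: "\<And>i. H i \<in> \<A>" "\<And>i. measure M ((a i - H i) \<union> (H i - a i)) < e / (2 * (n + 1))"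
      by metis
    note [measurable] = sets[OF H(1)]
    have UH: "(\<Union>i<k. H i) \<in> \<A>" for k :: nat
    proof (induction k)
      case (Suc k)
      then show ?case using union[OF H(1) Suc, of k] by (simp add: lessThan_Suc)
    qed (simp add: empty)
    let ?H = "\<Union>i<n. H i" and ?A = "\<Union>i. a i"
    have "measure M ((?A - ?H) \<union> (?H - ?A))
        \<le> measure M ((?A - (\<Union>i<n. a i)) \<union> (\<Union>i<n. (a i - H i) \<union> (H i - a i)))"
      by (rule finite_measure_mono) auto
    also have "\<dots> \<le> measure M (?A - (\<Union>i<n. a i)) + measure M (\<Union>i<n. (a i - H i) \<union> (H i - a i))"
      by (rule measure_Un_le) auto
    also have "\<dots> \<le> measure M (?A - (\<Union>i<n. a i)) + (\<Sum>i<n. measure M ((a i - H i) \<union> (H i - a i)))"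
      by (intro add_left_mono finite_measure_subadditive_finite) auto
    also have "\<dots> \<le> measure M (?A - (\<Union>i<n. a i)) + (\<Sum>i<n. e / (2 * (n + 1)))"
      using H(2) by (intro add_left_mono sum_mono) (auto intro: less_imp_le)
    also have "measure M (?A - (\<Union>i<n. a i)) = measure M ?A - measure M (\<Union>i<n. a i)"
      by (rule finite_measure_Diff) auto
    also have "measure M ?A - measure M (\<Union>i<n. a i) + (\<Sum>i<n. e / (2 * (n + 1))) < e / 2 + e / 2"
    proof (rule add_less_le_mono)
      show "(\<Sum>i<n. e / (2 * (n + 1))) \<le> e / 2"
        using Union(3) by (simp add: field_simps)
    qed (use n in simp)
    finally show ?case using UH[of n] by auto
  qed
qed

text \<open>Substituting \<open>z = \<phi> g x\<close> and \<open>h = g \<otimes> inv k\<close>, the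
  chain rule shows that the inner integral over \<open>k\<close> is
  \<open>mix \<eta> (\<phi> g x) * w g x\<close>, and \<open>w g x\<close> cancels against the
  derivative contained in \<open>weight\<close>. The right side is the expression in the definition
  of strong conservativity.\<close>

lemma (in quasi_invariant_action) collision_eq:
  assumes eta: "(\<integral>\<^sup>+h. \<eta> h \<partial>count_space (carrier G)) = 1"
  shows "collision \<eta> = (\<integral>\<^sup>+g. (\<eta> g)\<^sup>2 * (\<integral>\<^sup>+x. inverse (\<integral>\<^sup>+k. \<eta> (g \<otimes> inv k) * w k x
            \<partial>count_space (carrier G)) \<partial>M) \<partial>count_space (carrier G))"
proof -
  let ?N = "count_space (carrier G)"
  have "collision \<eta> = (\<integral>\<^sup>+z. \<integral>\<^sup>+h. weight \<eta> h z * (weight \<eta> h z / mix \<eta> z) \<partial>?N \<partial>M)"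
    unfolding collision_def by (simp add: ennreal_times_divide power2_eq_square)
  also have "\<dots> = (\<integral>\<^sup>+h. \<eta> h * (\<integral>\<^sup>+x. weight \<eta> h (\<phi> h x) / mix \<eta> (\<phi> h x) \<partial>M) \<partial>?N)"
    by (intro nn_integral_mix borel_measurable_divide_ennreal weight_measurable mix_measurable)
  also have "\<dots> = (\<integral>\<^sup>+g. (\<eta> g)\<^sup>2 * (\<integral>\<^sup>+x. inverse (\<integral>\<^sup>+k. \<eta> (g \<otimes> inv k) * w k x \<partial>?N) \<partial>M) \<partial>?N)"
  proof (rule nn_integral_cong)
    fix g assume "g \<in> space ?N"
    then have g: "g \<in> carrier G" by simp
    have bij: "bij_betw (\<lambda>k. g \<otimes> inv k) (carrier G) (carrier G)"
      by (rule bij_betw_byWitness[where f'="\<lambda>h. inv h \<otimes> g"])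
         (use g in \<open>auto simp: inv_mult_group m_assoc m_assoc[symmetric]\<close>)
    have all: "AE x in M. \<forall>k\<in>carrier G. w (k \<otimes> inv g \<otimes> g) x = w (k \<otimes> inv g) (\<phi> g x) * w g x"
      unfolding AE_ball_countable[OF countable_carrier] using g by (intro ballI deriv_mult) auto
    have mx: "AE x in M. 0 < mix \<eta> (\<phi> g x) \<and> mix \<eta> (\<phi> g x) < \<infinity>"
      using AE_mix_pos[OF eta] AE_mix_finite[OF eta] by (intro AE_act[OF g]) auto
    have "(\<integral>\<^sup>+x. weight \<eta> g (\<phi> g x) / mix \<eta> (\<phi> g x) \<partial>M)
        = (\<integral>\<^sup>+x. \<eta> g * inverse (\<integral>\<^sup>+k. \<eta> (g \<otimes> inv k) * w k x \<partial>?N) \<partial>M)"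
    proof (rule nn_integral_cong_AE)
      show "AE x in M. weight \<eta> g (\<phi> g x) / mix \<eta> (\<phi> g x)
          = \<eta> g * inverse (\<integral>\<^sup>+k. \<eta> (g \<otimes> inv k) * w k x \<partial>?N)"
        using all mx deriv_inv[OF g] deriv_pos[OF g] deriv_finite[OF g]
      proof eventually_elim
        case (elim x)
        have "(\<integral>\<^sup>+k. \<eta> (g \<otimes> inv k) * w k x \<partial>?N)
            = (\<integral>\<^sup>+k. weight \<eta> (g \<otimes> inv k) (\<phi> g x) * w g x \<partial>?N)"
        proof (rule nn_integral_cong)
          fix k assume "k \<in> space ?N"
          then have k: "k \<in> carrier G" by simp
          have "w k x = w (k \<otimes> inv g) (\<phi> g x) * w g x"
            using elim(1) k g by (metis inv_solve_right' m_closed inv_closed)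
          then show "\<eta> (g \<otimes> inv k) * w k x = weight \<eta> (g \<otimes> inv k) (\<phi> g x) * w g x"
            using g k by (simp add: weight_def inv_mult_group mult.assoc)
        qed
        also have "\<dots> = (\<integral>\<^sup>+k. weight \<eta> (g \<otimes> inv k) (\<phi> g x) \<partial>?N) * w g x"
          by (rule nn_integral_multc) auto
        also have "(\<integral>\<^sup>+k. weight \<eta> (g \<otimes> inv k) (\<phi> g x) \<partial>?N) = mix \<eta> (\<phi> g x)"
          unfolding mix_def by (rule nn_integral_bij_count_space[OF bij])
        finally have "inverse (\<integral>\<^sup>+k. \<eta> (g \<otimes> inv k) * w k x \<partial>?N) = inverse (mix \<eta> (\<phi> g x)) * inverse (w g x)"
          using elim by (simp add: ennreal_inverse_mult)
        then show ?case using elim(3) by (simp add: weight_def divide_ennreal_def mult_ac)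
      qed
    qed
    also have "\<dots> = \<eta> g * (\<integral>\<^sup>+x. inverse (\<integral>\<^sup>+k. \<eta> (g \<otimes> inv k) * w k x \<partial>?N) \<partial>M)"
      using deriv_measurable
      by (intro nn_integral_cmult measurable_compose[OF _ borel_measurable_inverse_ennreal]
          borel_measurable_nn_integral_count_space countable_carrier borel_measurable_times_ennreal) auto
    finally show "\<eta> g * (\<integral>\<^sup>+x. weight \<eta> g (\<phi> g x) / mix \<eta> (\<phi> g x) \<partial>M) =
        (\<eta> g)\<^sup>2 * (\<integral>\<^sup>+x. inverse (\<integral>\<^sup>+k. \<eta> (g \<otimes> inv k) * w k x \<partial>?N) \<partial>M)"
      by (simp add: power2_eq_square mult.assoc)
  qed
  finally show ?thesis .
qed

lemma quasi_invariant_action_action_deriv: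
  fixes G :: "('g, 'b) monoid_scheme" (structure)
  assumes "group G" "prob_space M" "countable (carrier G)" "nonsingular_action G M \<phi>"
  shows "quasi_invariant_action G M \<phi> (action_deriv G M \<phi>)"
proof -
  interpret group G by fact
  interpret prob_space M by fact
  have act: "group_action G (space M) \<phi>"
    and meas: "\<And>g. g \<in> carrier G \<Longrightarrow> \<phi> g \<in> measurable M M"
    and null: "\<And>g N. g \<in> carrier G \<Longrightarrow> N \<in> null_sets M \<Longrightarrow> \<phi> g ` N \<in> null_sets M"
    using assms(4) by (auto simp: nonsingular_action_def borel_action_def)
  interpret act: group_action G "space M" \<phi> by (rule act)
  have one: "\<phi> \<one> x = x" if "x \<in> space M" for x
    using act.id_eq_one that by (metis restrict_apply')
  have mult: "\<phi> (g \<otimes> h) x = \<phi> g (\<phi> h x)" if "g \<in> carrier G" "h \<in> carrier G" "x \<in> space M" for g h x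
    using act.composition_rule that by simp
  have sp: "\<phi> g x \<in> space M" if "g \<in> carrier G" "x \<in> space M" for g x
    using act.element_image that by blast
  have inv1: "\<phi> (inv g) (\<phi> g x) = x" "\<phi> g (\<phi> (inv g) x) = x" if "g \<in> carrier G" "x \<in> space M" for g x
    using that by (simp_all add: mult[symmetric] one)
  have vimage_eq: "\<phi> (inv g) -` B \<inter> space M = \<phi> g ` B" if "g \<in> carrier G" "B \<subseteq> space M" for g B
  proof (intro equalityI subsetI)
    fix x assume x: "x \<in> \<phi> (inv g) -` B \<inter> space M"
    then show "x \<in> \<phi> g ` B" using inv1(2)[OF that(1), of x] by (intro image_eqI[of _ _ "\<phi> (inv g) x"]) auto
  next
    fix x assume "x \<in> \<phi> g ` B"
    then show "x \<in> \<phi> (inv g) -` B \<inter> space M" using that sp inv1(1) by auto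
  qed
  have ac: "absolutely_continuous M (distr M M (\<phi> (inv g)))" if g: "g \<in> carrier G" for g
    unfolding absolutely_continuous_def
  proof
    fix B assume B: "B \<in> null_sets M"
    then have Bm: "B \<in> sets M" "B \<subseteq> space M" using sets.sets_into_space by auto
    have "emeasure (distr M M (\<phi> (inv g))) B = emeasure M (\<phi> g ` B)"
      using Bm g meas[of "inv g"] vimage_eq[OF g Bm(2)] by (simp add: emeasure_distr)
    also have "\<dots> = 0" using null[OF g B] by auto
    finally show "B \<in> null_sets (distr M M (\<phi> (inv g)))" using Bm by auto
  qed
  have int: "(\<integral>\<^sup>+x. u (\<phi> g x) * action_deriv G M \<phi> g x \<partial>M) = (\<integral>\<^sup>+x. u x \<partial>M)"
    if g: "g \<in> carrier G" and u: "u \<in> borel_measurable M" for g u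
  proof -
    have [measurable]: "(\<lambda>x. u (\<phi> g x)) \<in> borel_measurable M" "\<phi> (inv g) \<in> measurable M M"
      using measurable_compose[OF meas u] meas g by auto
    have "(\<integral>\<^sup>+x. u (\<phi> g x) * action_deriv G M \<phi> g x \<partial>M) = (\<integral>\<^sup>+x. u (\<phi> g x) \<partial>distr M M (\<phi> (inv g)))"
      unfolding action_deriv_def using ac[OF g]
      by (subst RN_deriv_nn_integral[OF ac[OF g]]) (auto simp: mult.commute)
    also have "\<dots> = (\<integral>\<^sup>+x. u (\<phi> g (\<phi> (inv g) x)) \<partial>M)"
      by (rule nn_integral_distr) auto
    also have "\<dots> = (\<integral>\<^sup>+x. u x \<partial>M)"
      using inv1(2)[OF g] by (intro nn_integral_cong) simp
    finally show ?thesis .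
  qed
  have m: "action_deriv G M \<phi> g \<in> borel_measurable M" for g
    unfolding action_deriv_def by simp
  \<comment> \<open>The derivative integrates to 0 over its zero set \<open>?E\<close>, so the
    translate \<open>?P\<close> of \<open>?E\<close> by \<open>g\<close> is null. Nonsingularity of
    \<open>inv g\<close> brings this back to \<open>?E\<close>.\<close>
  have pos: "AE x in M. 0 < action_deriv G M \<phi> g x" if g: "g \<in> carrier G" for g
  proof -
    let ?E = "{x\<in>space M. action_deriv G M \<phi> g x = 0}"
    let ?P = "\<phi> (inv g) -` ?E \<inter> space M"
    note [measurable] = m[of g] meas[OF g] meas[OF inv_closed[OF g]]
    have "emeasure M ?P = (\<integral>\<^sup>+x. indicator ?P x \<partial>M)"
      by (intro nn_integral_indicator[symmetric]) measurable
    also have "\<dots> = (\<integral>\<^sup>+x. indicator ?P (\<phi> g x) * action_deriv G M \<phi> g x \<partial>M)"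
      by (rule int[OF g, symmetric]) measurable
    also have "\<dots> = (\<integral>\<^sup>+x. 0 \<partial>M)"
      using inv1(1)[OF g] by (intro nn_integral_cong) (auto simp: indicator_def)
    finally have P: "?P \<in> null_sets M" by (intro null_setsI) auto
    have "?E = \<phi> (inv g) ` ?P"
      using vimage_eq[OF inv_closed[OF g], of ?P] g inv1 sp by (auto simp: image_iff)
    with null[OF inv_closed[OF g] P] have "?E \<in> null_sets M" by simp
    then have "AE x in M. x \<notin> ?E" by (rule AE_not_in)
    with AE_space show ?thesis by eventually_elim (auto simp: zero_less_iff_neq_zero)
  qed
  show ?thesis
    by unfold_locales (use assms(3) meas one mult m pos int in auto)
qed

lemma pmp_action_distr:
  fixes G :: "('g, 'b) monoid_scheme" (structure)
  assumes "group G" "pmp_action G N \<psi>" and g: "g \<in> carrier G"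
  shows "distr N N (\<psi> g) = N"
proof (rule measure_eqI)
  have "group_action G (space N) \<psi>" and meas: "\<psi> g \<in> measurable N N"
    and pres: "\<And>A. A \<in> sets N \<Longrightarrow> emeasure N (\<psi> g ` A) = emeasure N A"
    using assms by (auto simp: pmp_action_def borel_action_def)
  then interpret act: group_action G "space N" \<psi> by simp
  fix A assume "A \<in> sets (distr N N (\<psi> g))"
  then have A: "A \<in> sets N" by simp
  then have "A \<subseteq> space N" by (rule sets.sets_into_space)
  then have "\<psi> g ` (\<psi> g -` A \<inter> space N) = A"
    using act.surj_prop[OF g] by (blast dest: equalityD2)
  then show "emeasure (distr N N (\<psi> g)) A = emeasure N A"
    using meas pres[of "\<psi> g -` A \<inter> space N"] A by (simp add: emeasure_distr measurable_sets)
qed simp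

section \<open>Diagonal actions\<close>

context quasi_invariant_action
begin

lemma quasi_invariant_diagonal:
  assumes "prob_space N" and pmp: "pmp_action G N \<psi>"
  shows "quasi_invariant_action G (M \<Otimes>\<^sub>M N) (diagonal_action M \<phi> N \<psi>) (\<lambda>g z. w g (fst z))"
proof -
  interpret N: prob_space N by fact
  interpret P: pair_prob_space M N ..
  have act: "group_action G (space N) \<psi>" and meas: "\<And>g. g \<in> carrier G \<Longrightarrow> \<psi> g \<in> measurable N N"
    using pmp by (auto simp: pmp_action_def borel_action_def)
  interpret act: group_action G "space N" \<psi> by (rule act)
  have D: "diagonal_action M \<phi> N \<psi> g z = (\<phi> g (fst z), \<psi> g (snd z))" if "z \<in> space (M \<Otimes>\<^sub>M N)" for g z
    using that by (simp add: diagonal_action_def)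
  have Dm: "diagonal_action M \<phi> N \<psi> g \<in> measurable (M \<Otimes>\<^sub>M N) (M \<Otimes>\<^sub>M N)" if g: "g \<in> carrier G" for g
  proof -
    note [measurable] = act_measurable[OF g] meas[OF g]
    have "(\<lambda>z. (\<phi> g (fst z), \<psi> g (snd z))) \<in> measurable (M \<Otimes>\<^sub>M N) (M \<Otimes>\<^sub>M N)" by measurable
    then show ?thesis using D by (subst measurable_cong) auto
  qed
  have Dsp: "diagonal_action M \<phi> N \<psi> g z \<in> space (M \<Otimes>\<^sub>M N)" if "g \<in> carrier G" "z \<in> space (M \<Otimes>\<^sub>M N)" for g z
    using measurable_space[OF Dm] that by simp
  show ?thesis
  proof unfold_locales
    show "countable (carrier G)" by (rule countable_carrier)
    fix g h assume g: "g \<in> carrier G"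
    show "diagonal_action M \<phi> N \<psi> g \<in> measurable (M \<Otimes>\<^sub>M N) (M \<Otimes>\<^sub>M N)" by (rule Dm[OF g])
    note [measurable] = act_measurable[OF g] meas[OF g] deriv_measurable[OF g]
    show "(\<lambda>z. w g (fst z)) \<in> borel_measurable (M \<Otimes>\<^sub>M N)" by measurable
    show "AE z in M \<Otimes>\<^sub>M N. 0 < w g (fst z)"
      using deriv_pos[OF g] by (intro P.AE_pair_measure) (auto simp: eventually_mono)
    fix u :: "_ \<Rightarrow> ennreal" assume u[measurable]: "u \<in> borel_measurable (M \<Otimes>\<^sub>M N)"
    have "(\<integral>\<^sup>+z. u (diagonal_action M \<phi> N \<psi> g z) * w g (fst z) \<partial>(M \<Otimes>\<^sub>M N))
        = (\<integral>\<^sup>+z. u (\<phi> g (fst z), \<psi> g (snd z)) * w g (fst z) \<partial>(M \<Otimes>\<^sub>M N))"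
      by (intro nn_integral_cong) (simp add: D)
    also have "\<dots> = (\<integral>\<^sup>+x. \<integral>\<^sup>+y. u (\<phi> g x, \<psi> g y) * w g x \<partial>N \<partial>M)"
      by (subst N.nn_integral_fst[symmetric]) auto
    also have "\<dots> = (\<integral>\<^sup>+x. (\<integral>\<^sup>+y. u (\<phi> g x, y) \<partial>N) * w g x \<partial>M)"
    proof (rule nn_integral_cong)
      fix x assume x: "x \<in> space M"
      have [measurable]: "(\<lambda>y. u (\<phi> g x, y)) \<in> borel_measurable N"
        using act_space[OF g x] by measurable
      have "(\<integral>\<^sup>+y. u (\<phi> g x, \<psi> g y) * w g x \<partial>N) = (\<integral>\<^sup>+y. u (\<phi> g x, \<psi> g y) \<partial>N) * w g x"
        by (rule nn_integral_multc) measurable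
      also have "(\<integral>\<^sup>+y. u (\<phi> g x, \<psi> g y) \<partial>N) = (\<integral>\<^sup>+y. u (\<phi> g x, y) \<partial>distr N N (\<psi> g))"
        by (rule nn_integral_distr[symmetric]) auto
      also have "distr N N (\<psi> g) = N" by (rule pmp_action_distr[OF group_axioms pmp g])
      finally show "(\<integral>\<^sup>+y. u (\<phi> g x, \<psi> g y) * w g x \<partial>N) = (\<integral>\<^sup>+y. u (\<phi> g x, y) \<partial>N) * w g x" .
    qed
    also have "\<dots> = (\<integral>\<^sup>+x. (\<integral>\<^sup>+y. u (x, y) \<partial>N) \<partial>M)"
      by (rule nn_integral_act[OF g, of "\<lambda>x. \<integral>\<^sup>+y. u (x, y) \<partial>N"]) measurable
    also have "\<dots> = (\<integral>\<^sup>+z. u z \<partial>(M \<Otimes>\<^sub>M N))"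
      by (rule N.nn_integral_fst) auto
    finally show "(\<integral>\<^sup>+z. u (diagonal_action M \<phi> N \<psi> g z) * w g (fst z) \<partial>(M \<Otimes>\<^sub>M N)) = (\<integral>\<^sup>+z. u z \<partial>(M \<Otimes>\<^sub>M N))" .
  next
    fix z assume z: "z \<in> space (M \<Otimes>\<^sub>M N)"
    then have z': "fst z \<in> space M" "snd z \<in> space N" by (auto simp: space_pair_measure)
    have "\<psi> \<one> (snd z) = snd z" using act.id_eq_one z' by (metis restrict_apply')
    then show "diagonal_action M \<phi> N \<psi> \<one> z = z" by (simp add: D z act_one z')
    fix g h assume gh: "g \<in> carrier G" "h \<in> carrier G"
    show "diagonal_action M \<phi> N \<psi> (g \<otimes> h) z = diagonal_action M \<phi> N \<psi> g (diagonal_action M \<phi> N \<psi> h z)"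
      using act.composition_rule[OF z'(2) gh] Dsp[OF gh(2) z] by (simp add: D z act_mult gh z')
  qed
qed

lemma collision_diagonal:
  assumes "prob_space N" and pmp: "pmp_action G N \<psi>"
  shows "quasi_invariant_action.collision G (M \<Otimes>\<^sub>M N) (\<lambda>g z. w g (fst z)) \<eta> = collision \<eta>"
proof -
  interpret N: prob_space N by fact
  interpret D: quasi_invariant_action G "M \<Otimes>\<^sub>M N" "diagonal_action M \<phi> N \<psi>" "\<lambda>g z. w g (fst z)"
    by (rule quasi_invariant_diagonal) fact+
  let ?f = "\<lambda>x. \<integral>\<^sup>+h. (weight \<eta> h x)\<^sup>2 / mix \<eta> x \<partial>count_space (carrier G)"
  have [measurable]: "?f \<in> borel_measurable M"
    unfolding power2_eq_square
    by (intro borel_measurable_nn_integral_count_space countable_carrier borel_measurable_divide_ennreal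
        mix_measurable borel_measurable_times_ennreal weight_measurable)
  have "D.collision \<eta> = (\<integral>\<^sup>+z. ?f (fst z) \<partial>(M \<Otimes>\<^sub>M N))"
    unfolding D.collision_def D.mix_def D.weight_def mix_def weight_def ..
  also have "\<dots> = (\<integral>\<^sup>+x. \<integral>\<^sup>+y. ?f x \<partial>N \<partial>M)"
    by (subst N.nn_integral_fst[symmetric]) auto
  also have "\<dots> = collision \<eta>"
    by (simp add: N.emeasure_space_1 collision_def)
  finally show ?thesis .
qed

end

section \<open>Bernoulli measures\<close>

locale bernoulli = group G for G :: "('g, 'b) monoid_scheme" (structure) +
  fixes \<mu> :: "'g \<Rightarrow> bool pmf"
  assumes countable_G: "countable (carrier G)"
    and nondegenerate: "g \<in> carrier G \<Longrightarrow> pmf (\<mu> g) False \<in> {0<..<1}"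
begin

abbreviation X :: "('g \<Rightarrow> bool) measure" where "X \<equiv> bernoulli_space G \<mu>"

abbreviation p :: "'g \<Rightarrow> bool \<Rightarrow> real" where "p g \<equiv> pmf (\<mu> g)"

sublocale product: product_prob_space "\<lambda>g. measure_pmf (\<mu> g)" "carrier G"
  by unfold_locales

sublocale prob_space X
  unfolding bernoulli_space_def by (rule product.P.prob_space_axioms)

lemma p_sum: "p g b + p g (\<not> b) = 1"
proof -
  have "(\<Sum>b\<in>UNIV. p g b) = 1" by (rule sum_pmf_eq_1) auto
  then show ?thesis by (cases b) (simp_all add: UNIV_bool)
qed

lemma p_not: "p g (\<not> b) = 1 - p g b"
  using p_sum[of g b] by simp

lemma p_pos: "g \<in> carrier G \<Longrightarrow> 0 < p g b"
  using nondegenerate[of g] p_not[of g False] by (cases b) auto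

lemma space_X: "space X = carrier G \<rightarrow>\<^sub>E UNIV"
  by (rule space_bernoulli_space)

lemma sets_X: "sets X = sets (PiM (carrier G) (\<lambda>_. count_space UNIV))"
  unfolding bernoulli_space_def by (rule sets_PiM_cong) auto

lemma coordinate_measurable [measurable (raw)]:
  assumes "f \<in> measurable N X" "j \<in> carrier G"
  shows "(\<lambda>x. f x j) \<in> measurable N (count_space UNIV)"
proof -
  have "f \<in> measurable N (PiM (carrier G) (\<lambda>_. count_space UNIV))"
    using assms(1) sets_X by (simp cong: measurable_cong_sets)
  then show ?thesis using assms(2) by measurable
qed

lemma coordinate_sets:
  assumes "j \<in> carrier G"
  shows "{x\<in>space X. x j \<in> S} \<in> sets X"
proof -
  have "(\<lambda>x. x j) \<in> measurable X (count_space UNIV)"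
    using assms by (intro coordinate_measurable) auto
  from measurable_sets[OF this, of S] show ?thesis
    by (simp add: vimage_def Int_def conj_commute)
qed

lemma cylinder_sets:
  assumes "finite J" "J \<subseteq> carrier G"
  shows "{x\<in>space X. \<forall>j\<in>J. x j \<in> S j} \<in> sets X"
  using assms by (intro sets.sets_Collect_finite_All coordinate_sets) auto

definition flip :: "'g \<Rightarrow> ('g \<Rightarrow> bool) \<Rightarrow> 'g \<Rightarrow> bool" where
  "flip j x = x(j := \<not> x j)"

text \<open>The density, at points whose coordinate \<open>j\<close> is \<open>b\<close>, of the
  image of the Bernoulli measure under \<open>flip j\<close>.\<close>

definition odds :: "'g \<Rightarrow> bool \<Rightarrow> real" where
  "odds j b = p j (\<not> b) / p j b"

lemma flip_flip [simp]: "flip j (flip j x) = x"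
  by (simp add: flip_def)

lemma flip_same [simp]: "flip j x j = (\<not> x j)"
  by (simp add: flip_def)

lemma flip_other [simp]: "i \<noteq> j \<Longrightarrow> flip j x i = x i"
  by (simp add: flip_def)

lemma flip_commute: "i \<noteq> j \<Longrightarrow> flip i (flip j x) = flip j (flip i x)"
  by (auto simp: flip_def fun_upd_twist)

lemma odds_pos: "j \<in> carrier G \<Longrightarrow> 0 < odds j b"
  by (simp add: odds_def p_pos)

lemma odds_not: "j \<in> carrier G \<Longrightarrow> odds j (\<not> b) = 1 / odds j b"
  by (simp add: odds_def)

lemma flip_measurable [measurable]:
  assumes "j \<in> carrier G"
  shows "flip j \<in> measurable X X"
proof -
  have "flip j \<in> measurable X (PiM (carrier G) (\<lambda>_. count_space UNIV))"
  proof (rule measurable_PiM_single')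
    show "flip j \<in> space X \<rightarrow> carrier G \<rightarrow>\<^sub>E space (count_space UNIV)"
      using assms by (auto simp: space_X flip_def PiE_iff extensional_def)
    fix i assume i: "i \<in> carrier G"
    show "(\<lambda>x. flip j x i) \<in> measurable X (count_space UNIV)"
      using i assms by (cases "i = j") simp_all
  qed
  then show ?thesis using sets_X by (simp cong: measurable_cong_sets)
qed

lemma flip_space: "j \<in> carrier G \<Longrightarrow> x \<in> space X \<Longrightarrow> flip j x \<in> space X"
  using flip_measurable measurable_space by metis

lemma nn_integral_coordinate:
  assumes j: "j \<in> carrier G" and u: "u \<in> borel_measurable X"
  defines "R \<equiv> PiM (carrier G - {j}) (\<lambda>g. measure_pmf (\<mu> g))"
  shows "(\<integral>\<^sup>+x. u x \<partial>X) = ennreal (p j True) * (\<integral>\<^sup>+x. u (x(j := True)) \<partial>R)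
                        + ennreal (p j False) * (\<integral>\<^sup>+x. u (x(j := False)) \<partial>R)"
proof -
  interpret R: prob_space R
    unfolding R_def by (intro prob_space_PiM prob_space_measure_pmf)
  have X_eq: "X = PiM (insert j (carrier G - {j})) (\<lambda>g. measure_pmf (\<mu> g))"
    unfolding bernoulli_space_def using j by (simp add: insert_absorb)
  have upd: "(\<lambda>(b, x). x(j := b)) \<in> measurable (measure_pmf (\<mu> j) \<Otimes>\<^sub>M R) X"
    unfolding bernoulli_space_def R_def split_beta'
    by (rule measurable_fun_upd[where J="carrier G - {j}"]) (use j in auto)
  have "(\<integral>\<^sup>+x. u x \<partial>X) = (\<integral>\<^sup>+x. u x \<partial>distr (measure_pmf (\<mu> j) \<Otimes>\<^sub>M R) X (\<lambda>(b, x). x(j := b)))"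
    unfolding X_eq R_def by (subst distr_pair_PiM_eq_PiM) (auto intro: prob_space_measure_pmf)
  also have "\<dots> = (\<integral>\<^sup>+z. u ((\<lambda>(b, x). x(j := b)) z) \<partial>(measure_pmf (\<mu> j) \<Otimes>\<^sub>M R))"
    by (subst nn_integral_distr[OF upd]) (use u in auto)
  also have "\<dots> = (\<integral>\<^sup>+b. \<integral>\<^sup>+x. u (x(j := b)) \<partial>R \<partial>measure_pmf (\<mu> j))"
    using measurable_compose[OF upd u] by (subst R.nn_integral_fst[symmetric]) auto
  also have "\<dots> = ennreal (p j True) * (\<integral>\<^sup>+x. u (x(j := True)) \<partial>R)
      + ennreal (p j False) * (\<integral>\<^sup>+x. u (x(j := False)) \<partial>R)"
    by (simp add: nn_integral_measure_pmf nn_integral_count_space_finite UNIV_bool add.commute)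
  finally show ?thesis .
qed

lemma nn_integral_flip:
  assumes j: "j \<in> carrier G" and u[measurable]: "u \<in> borel_measurable X"
  shows "(\<integral>\<^sup>+x. u (flip j x) * ennreal (odds j (x j)) \<partial>X) = (\<integral>\<^sup>+x. u x \<partial>X)"
proof -
  define R where "R = PiM (carrier G - {j}) (\<lambda>g. measure_pmf (\<mu> g))"
  have upd: "(\<lambda>x. u (x(j := b))) \<in> borel_measurable R" for b
  proof -
    have "(\<lambda>x. x(j := b)) \<in> measurable R X"
      unfolding R_def bernoulli_space_def using j
      by (intro measurable_fun_upd[where J="carrier G - {j}"]) auto
    from measurable_compose[OF this u] show ?thesis .
  qed
  have [measurable]: "(\<lambda>x. ennreal (odds j (x j))) \<in> borel_measurable X"
    using j by measurable
  have fl: "flip j (x(j := b)) = x(j := \<not> b)" for x b by (simp add: flip_def)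
  have o: "p j b * odds j b = p j (\<not> b)" for b
    using p_pos[OF j, of b] by (simp add: odds_def)
  have "(\<integral>\<^sup>+x. u (flip j x) * ennreal (odds j (x j)) \<partial>X)
      = ennreal (p j True) * (\<integral>\<^sup>+x. u (x(j := False)) * ennreal (odds j True) \<partial>R)
      + ennreal (p j False) * (\<integral>\<^sup>+x. u (x(j := True)) * ennreal (odds j False) \<partial>R)"
    using j by (subst nn_integral_coordinate[OF j]) (auto simp: R_def fl)
  also have "\<dots> = ennreal (p j True * odds j True) * (\<integral>\<^sup>+x. u (x(j := False)) \<partial>R)
      + ennreal (p j False * odds j False) * (\<integral>\<^sup>+x. u (x(j := True)) \<partial>R)"
    using odds_pos[OF j, THEN less_imp_le] by (simp add: nn_integral_multc nn_integral_cmult upd ennreal_mult' mult_ac)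
  also have "\<dots> = (\<integral>\<^sup>+x. u x \<partial>X)"
    by (subst nn_integral_coordinate[OF j u]) (simp add: o R_def add.commute)
  finally show ?thesis .
qed

text \<open>On the points with \<open>x j = b\<close> the density of the flip is constant, with
  inverse \<open>odds j (\<not> b)\<close>. This is the form of change of variables asked for in
  \<open>tau_bound\<close>.\<close>

lemma nn_integral_flip_le:
  assumes j: "j \<in> carrier G" and u[measurable]: "u \<in> borel_measurable X"
  shows "(\<integral>\<^sup>+x. of_bool (x j = b) * u (flip j x) \<partial>X) \<le> ennreal (odds j (\<not> b)) * (\<integral>\<^sup>+x. u x \<partial>X)"
proof -
  note [measurable] = flip_measurable[OF j]
  have [measurable]: "(\<lambda>x. ennreal (odds j (x j))) \<in> borel_measurable X"
    using j by measurable
  have "(\<integral>\<^sup>+x. of_bool (x j = b) * u (flip j x) \<partial>X)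
      \<le> (\<integral>\<^sup>+x. ennreal (odds j (\<not> b)) * (u (flip j x) * ennreal (odds j (x j))) \<partial>X)"
  proof (rule nn_integral_mono)
    fix x
    have "odds j (\<not> b) * odds j b = 1"
      using odds_pos[OF j, of b] j by (simp add: odds_not)
    then have one: "ennreal (odds j (\<not> b)) * ennreal (odds j b) = 1"
      using odds_pos[OF j, THEN less_imp_le] by (simp flip: ennreal_mult)
    have "ennreal (odds j (\<not> b)) * (u (flip j x) * ennreal (odds j b)) = u (flip j x)"
      by (metis one mult.left_commute mult.right_neutral)
    then show "of_bool (x j = b) * u (flip j x) \<le> ennreal (odds j (\<not> b)) * (u (flip j x) * ennreal (odds j (x j)))"
      by (cases "x j = b") auto
  qed
  also have "\<dots> = ennreal (odds j (\<not> b)) * (\<integral>\<^sup>+x. u x \<partial>X)"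
    by (subst nn_integral_cmult) (auto simp: nn_integral_flip[OF j u])
  finally show ?thesis .
qed

lemma AE_flip:
  assumes j: "j \<in> carrier G" and P: "AE x in X. P x"
  shows "AE x in X. P (flip j x)"
proof -
  obtain N where N: "{x \<in> space X. \<not> P x} \<subseteq> N" "emeasure X N = 0" "N \<in> sets X"
    using P by (auto elim: AE_E)
  note [measurable] = N(3) flip_measurable[OF j]
  have [measurable]: "(\<lambda>x. ennreal (odds j (x j))) \<in> borel_measurable X"
    using j by measurable
  have "(\<integral>\<^sup>+x. indicator N (flip j x) * ennreal (odds j (x j)) \<partial>X) = 0"
    using nn_integral_flip[OF j, of "indicator N"] N by simp
  then have "AE x in X. indicator N (flip j x) * ennreal (odds j (x j)) = 0"
    by (subst (asm) nn_integral_0_iff_AE) auto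
  with AE_space show ?thesis
  proof eventually_elim
    case (elim x)
    moreover have "0 < ennreal (odds j (x j))" using odds_pos[OF j] by simp
    ultimately have "flip j x \<notin> N" by (auto simp: indicator_def split: if_splits)
    then show ?case using N(1) flip_space[OF j elim(1)] by auto
  qed
qed

text \<open>The flip exchanges the parts of \<open>A\<close> with \<open>x j = True\<close> and
  \<open>x j = False\<close>, and its density gives them masses in the ratio of
  \<open>p j True\<close> to \<open>p j False\<close>. So \<open>A\<close> is independent of the
  coordinate \<open>j\<close>.\<close>

lemma measure_flip_invariant_coordinate:
  assumes j: "j \<in> carrier G" and A[measurable]: "A \<in> sets X"
    and inv: "AE x in X. flip j x \<in> A \<longleftrightarrow> x \<in> A"
  shows "measure X {x\<in>A. x j \<in> S} = measure X A * measure (\<mu> j) S"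
proof -
  note [measurable] = flip_measurable[OF j]
  have Ab_eq: "{x\<in>A. x j = b} = {x\<in>space X. x \<in> A \<and> x j = b}" for b
    using sets.sets_into_space[OF A] by auto
  have Ab[measurable]: "{x\<in>A. x j = b} \<in> sets X" for b
    unfolding Ab_eq using j by measurable
  have rel: "emeasure X {x\<in>A. x j = (\<not> b)} = ennreal (odds j b) * emeasure X {x\<in>A. x j = b}" for b
  proof -
    have "emeasure X {x\<in>A. x j = (\<not> b)} = (\<integral>\<^sup>+x. indicator {x\<in>A. x j = (\<not> b)} x \<partial>X)"
      by (rule nn_integral_indicator[symmetric]) measurable
    also have "\<dots> = (\<integral>\<^sup>+x. indicator {x\<in>A. x j = (\<not> b)} (flip j x) * ennreal (odds j (x j)) \<partial>X)"
      by (rule nn_integral_flip[OF j, symmetric]) measurable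
    also have "\<dots> = (\<integral>\<^sup>+x. ennreal (odds j b) * indicator {x\<in>A. x j = b} x \<partial>X)"
    proof (rule nn_integral_cong_AE)
      show "AE x in X. indicator {x\<in>A. x j = (\<not> b)} (flip j x) * ennreal (odds j (x j))
          = ennreal (odds j b) * indicator {x\<in>A. x j = b} x"
        using inv by eventually_elim (auto simp: indicator_def)
    qed
    also have "\<dots> = ennreal (odds j b) * emeasure X {x\<in>A. x j = b}"
      by (rule nn_integral_cmult_indicator) measurable
    finally show ?thesis .
  qed
  have rel': "measure X {x\<in>A. x j = (\<not> b)} = odds j b * measure X {x\<in>A. x j = b}" for b
  proof -
    have "ennreal (measure X {x\<in>A. x j = (\<not> b)}) = ennreal (odds j b * measure X {x\<in>A. x j = b})"
      using odds_pos[OF j, of b] rel[of b] by (simp add: emeasure_eq_measure ennreal_mult)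
    then show ?thesis using odds_pos[OF j, of b] by (simp add: ennreal_inj)
  qed
  have b: "measure X {x\<in>A. x j = b} = measure X A * p j b" for b
  proof -
    have "measure X A = measure X ({x\<in>A. x j = b} \<union> {x\<in>A. x j = (\<not> b)})"
      by (rule arg_cong[where f="measure X"]) auto
    also have "\<dots> = measure X {x\<in>A. x j = b} + measure X {x\<in>A. x j = (\<not> b)}"
      by (rule finite_measure_Union) auto
    also have "\<dots> = measure X {x\<in>A. x j = b} * (1 + odds j b)"
      by (simp add: rel' algebra_simps)
    also have "1 + odds j b = 1 / p j b"
      using p_pos[OF j, of b] p_not[of j b] by (simp add: odds_def field_simps)
    finally show ?thesis using p_pos[OF j, of b] by simp
  qed
  have "measure X {x\<in>A. x j \<in> S} = measure X (\<Union>b\<in>S. {x\<in>A. x j = b})"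
    by (rule arg_cong[where f="measure X"]) auto
  also have "\<dots> = (\<Sum>b\<in>S. measure X {x\<in>A. x j = b})"
    by (rule finite_measure_finite_Union) (auto simp: disjoint_family_on_def)
  also have "\<dots> = measure X A * measure (\<mu> j) S"
    by (simp add: b sum_distrib_left measure_measure_pmf_finite)
  finally show ?thesis .
qed

text \<open>Conditions on other coordinates are not affected by \<open>flip i\<close>, so
  intersecting \<open>A\<close> with them keeps the invariance needed for one more
  coordinate.\<close>

lemma measure_flip_invariant_cylinder:
  assumes A[measurable]: "A \<in> sets X"
    and inv: "\<And>j. j \<in> carrier G \<Longrightarrow> AE x in X. flip j x \<in> A \<longleftrightarrow> x \<in> A"
    and J: "finite J" "J \<subseteq> carrier G"
  shows "measure X {x\<in>A. \<forall>j\<in>J. x j \<in> S j} = measure X A * (\<Prod>j\<in>J. measure (\<mu> j) (S j))"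
  using J
proof induction
  case empty
  then show ?case by simp
next
  case (insert i J)
  let ?A = "{x\<in>A. \<forall>j\<in>J. x j \<in> S j}"
  have "?A = A \<inter> {x\<in>space X. \<forall>j\<in>J. x j \<in> S j}"
    using sets.sets_into_space[OF A] by auto
  also have "\<dots> \<in> sets X"
    using insert by (intro sets.Int A cylinder_sets) auto
  finally have "?A \<in> sets X" .
  moreover have "AE x in X. flip i x \<in> ?A \<longleftrightarrow> x \<in> ?A"
  proof -
    have "AE x in X. flip i x \<in> A \<longleftrightarrow> x \<in> A" using inv insert by simp
    then show ?thesis
    proof eventually_elim
      case (elim x)
      have "flip i x j = x j" if "j \<in> J" for j using that insert by (metis flip_other)
      then show ?case using elim by auto
    qed
  qed
  ultimately have "measure X {x\<in>?A. x i \<in> S i} = measure X ?A * measure (\<mu> i) (S i)"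
    using insert by (intro measure_flip_invariant_coordinate) auto
  moreover have "{x\<in>?A. x i \<in> S i} = {x\<in>A. \<forall>j\<in>insert i J. x j \<in> S j}" by auto
  ultimately show ?case using insert by (simp add: mult_ac)
qed

text \<open>Kolmogorov's argument: \<open>A\<close> is independent of every cylinder, hence of every
  measurable set, in particular of itself. The independence is expressed as equality of two
  densities, which finite cylinders determine.\<close>

lemma flip_zero_one:
  assumes A[measurable]: "A \<in> sets X"
    and inv: "\<And>j. j \<in> carrier G \<Longrightarrow> AE x in X. flip j x \<in> A \<longleftrightarrow> x \<in> A"
  shows "measure X A = 0 \<or> measure X A = 1"
proof -
  let ?P = "density X (indicator A)" and ?Q = "density X (\<lambda>_. ennreal (measure X A))"
  have "?P = ?Q"
  proof (rule measure_eqI_PiM_infinite[where I="carrier G" and M="\<lambda>g. measure_pmf (\<mu> g)"])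
    show "finite_measure ?P"
      by (rule finite_measureI) (simp add: emeasure_density)
    fix S J assume J: "finite J" "J \<subseteq> carrier G"
    let ?C = "prod_emb (carrier G) (\<lambda>g. measure_pmf (\<mu> g)) J (Pi\<^sub>E J S)"
    have C: "?C = {x\<in>space X. \<forall>j\<in>J. x j \<in> S j}"
      using J by (auto simp: prod_emb_def space_X PiE_iff extensional_def)
    have Cm[measurable]: "?C \<in> sets X"
      unfolding bernoulli_space_def using J by (intro sets_PiM_I) auto
    have "{x\<in>A. \<forall>j\<in>J. x j \<in> S j} = A \<inter> ?C"
      unfolding C using sets.sets_into_space[OF A] by auto
    moreover have "measure X ?C = (\<Prod>j\<in>J. measure (\<mu> j) (S j))"
      using J by (simp add: bernoulli_space_def product.measure_PiM_emb)
    ultimately have "measure X (A \<inter> ?C) = measure X A * measure X ?C"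
      using measure_flip_invariant_cylinder[OF A inv J, of S] by simp
    then show "emeasure ?P ?C = emeasure ?Q ?C"
      by (simp add: emeasure_density indicator_inter_arith[symmetric] nn_integral_cmult_indicator
          emeasure_eq_measure ennreal_mult'[symmetric])
  qed (simp_all add: bernoulli_space_def)
  then have "emeasure ?P A = emeasure ?Q A" by simp
  then have "ennreal (measure X A) = ennreal (measure X A) * ennreal (measure X A)"
    by (simp add: emeasure_density nn_integral_cmult_indicator emeasure_eq_measure
        indicator_inter_arith[symmetric])
  then have "measure X A = measure X A * measure X A"
    by (simp add: ennreal_mult'[symmetric] del: mult_cancel_left2)
  then show ?thesis by auto
qed

definition depends_on :: "'g set \<Rightarrow> ('g \<Rightarrow> bool) set \<Rightarrow> bool" where
  "depends_on L H \<longleftrightarrow> (\<forall>x\<in>space X. \<forall>x'\<in>space X. (\<forall>l\<in>L. x l = x' l) \<longrightarrow> (x \<in> H \<longleftrightarrow> x' \<in> H))"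

lemma depends_on_empty: "depends_on L {}"
  by (simp add: depends_on_def)

lemma depends_on_Diff: "depends_on L H \<Longrightarrow> depends_on L (space X - H)"
  unfolding depends_on_def by blast

lemma depends_on_Un:
  assumes "depends_on L H" "depends_on L' H'"
  shows "depends_on (L \<union> L') (H \<union> H')"
  unfolding depends_on_def
proof (intro ballI impI)
  fix x x' assume x: "x \<in> space X" "x' \<in> space X" "\<forall>l\<in>L \<union> L'. x l = x' l"
  have "x \<in> H \<longleftrightarrow> x' \<in> H" "x \<in> H' \<longleftrightarrow> x' \<in> H'"
    using assms x unfolding depends_on_def ball_Un by blast+
  then show "x \<in> H \<union> H' \<longleftrightarrow> x' \<in> H \<union> H'" by simp
qed

lemma cylinder_approximation:
  assumes A: "A \<in> sets X" and e: "0 < (e::real)"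
  shows "\<exists>H L. H \<in> sets X \<and> finite L \<and> L \<subseteq> carrier G \<and> depends_on L H \<and> measure X ((A - H) \<union> (H - A)) < e"
proof -
  define cyl where "cyl = {H\<in>sets X. \<exists>L. finite L \<and> L \<subseteq> carrier G \<and> depends_on L H}"
  have cylI: "H \<in> cyl" if "H \<in> sets X" "finite L" "L \<subseteq> carrier G" "depends_on L H" for H L
    unfolding cyl_def using that by blast
  have cylE: "\<exists>L. finite L \<and> L \<subseteq> carrier G \<and> depends_on L H" "H \<in> sets X" if "H \<in> cyl" for H
    using that unfolding cyl_def by auto
  have "\<exists>H\<in>cyl. measure X ((A - H) \<union> (H - A)) < e"
  proof (rule approximation_by_algebra[OF _ _ _ _ _ _ A e])
    show "sets X = sigma_sets (space X)
       {{f\<in>(\<Pi>\<^sub>E i\<in>carrier G. UNIV). f i \<in> B} | i B. i \<in> carrier G \<and> B \<in> sets (count_space (UNIV::bool set))}"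
      unfolding sets_X sets_PiM_single space_X by simp
    show "H \<in> sets X" if "H \<in> cyl" for H using that by (rule cylE)
    show "{} \<in> cyl" using depends_on_empty[of "{}"] by (intro cylI[of _ "{}"]) auto
    show "space X - H \<in> cyl" if H: "H \<in> cyl" for H
    proof -
      obtain L where L: "finite L" "L \<subseteq> carrier G" "depends_on L H" using cylE(1)[OF H] by auto
      show ?thesis by (rule cylI[OF _ L(1,2) depends_on_Diff[OF L(3)]]) (use cylE(2)[OF H] in auto)
    qed
    show "H \<union> H' \<in> cyl" if H: "H \<in> cyl" and H': "H' \<in> cyl" for H H'
    proof -
      obtain L where L: "finite L" "L \<subseteq> carrier G" "depends_on L H" using cylE(1)[OF H] by auto
      obtain L' where L': "finite L'" "L' \<subseteq> carrier G" "depends_on L' H'" using cylE(1)[OF H'] by auto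
      show ?thesis
        by (rule cylI[OF _ _ _ depends_on_Un[OF L(3) L'(3)]]) (use cylE(2)[OF H] cylE(2)[OF H'] L L' in auto)
    qed
    fix a and d :: real assume a: "a \<in> {{f\<in>(\<Pi>\<^sub>E i\<in>carrier G. UNIV). f i \<in> B} | i B. i \<in> carrier G \<and> B \<in> sets (count_space (UNIV::bool set))}"
      and d: "0 < d"
    then obtain i B where i: "a = {f\<in>(\<Pi>\<^sub>E i\<in>carrier G. UNIV). f i \<in> B}" "i \<in> carrier G" by auto
    have "a \<in> sets X"
      unfolding sets_X sets_PiM_single using a by auto
    moreover have "depends_on {i} a" using i by (auto simp: depends_on_def space_X)
    ultimately have "a \<in> cyl" using i by (intro cylI[of a "{i}"]) auto
    then show "\<exists>H\<in>cyl. measure X ((a - H) \<union> (H - a)) < d"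
      using d by (intro bexI[of _ a]) auto
  qed
  then obtain H where H: "H \<in> cyl" "measure X ((A - H) \<union> (H - A)) < e" by (rule bexE)
  then show ?thesis using cylE[OF H(1)] by (intro exI[of _ H]) auto
qed

text \<open>Finite dependence is demanded in the first coordinate only, since the points to be
  compared share the second. Rectangles reduce to \<open>cylinder_approximation\<close> by replacing
  their first side.\<close>

lemma cylinder_approximation_pair:
  fixes N :: "'y measure"
  assumes "prob_space N" and A: "A \<in> sets (X \<Otimes>\<^sub>M N)" and e: "0 < (e::real)"
  shows "\<exists>H L. H \<in> sets (X \<Otimes>\<^sub>M N) \<and> finite L \<and> L \<subseteq> carrier G \<and>
     (\<forall>x\<in>space X. \<forall>x'\<in>space X. \<forall>y. (\<forall>l\<in>L. x l = x' l) \<longrightarrow> ((x, y) \<in> H \<longleftrightarrow> (x', y) \<in> H)) \<and>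
     measure (X \<Otimes>\<^sub>M N) ((A - H) \<union> (H - A)) < e"
proof -
  interpret N: prob_space N by fact
  interpret P: pair_prob_space X N ..
  define dep where "dep L H \<longleftrightarrow> (\<forall>x\<in>space X. \<forall>x'\<in>space X. \<forall>y. (\<forall>l\<in>L. x l = x' l) \<longrightarrow> ((x, y) \<in> H \<longleftrightarrow> (x', y) \<in> H))"
    for L and H :: "(('g \<Rightarrow> bool) \<times> 'y) set"
  define cyl where "cyl = {H\<in>sets (X \<Otimes>\<^sub>M N). \<exists>L. finite L \<and> L \<subseteq> carrier G \<and> dep L H}"
  have cylI: "H \<in> cyl" if "H \<in> sets (X \<Otimes>\<^sub>M N)" "finite L" "L \<subseteq> carrier G" "dep L H" for H L
    unfolding cyl_def using that by blast
  have cylE: "\<exists>L. finite L \<and> L \<subseteq> carrier G \<and> dep L H" "H \<in> sets (X \<Otimes>\<^sub>M N)" if "H \<in> cyl" for H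
    using that unfolding cyl_def by auto
  have "\<exists>H\<in>cyl. measure (X \<Otimes>\<^sub>M N) ((A - H) \<union> (H - A)) < e"
  proof (rule P.approximation_by_algebra[OF _ _ _ _ _ _ A e])
    show "sets (X \<Otimes>\<^sub>M N) = sigma_sets (space (X \<Otimes>\<^sub>M N)) {a \<times> b | a b. a \<in> sets X \<and> b \<in> sets N}"
      by (simp add: sets_pair_measure space_pair_measure)
    show "H \<in> sets (X \<Otimes>\<^sub>M N)" if "H \<in> cyl" for H using that by (rule cylE)
    show "{} \<in> cyl" by (intro cylI[of _ "{}"]) (auto simp: dep_def)
    show "space (X \<Otimes>\<^sub>M N) - H \<in> cyl" if H: "H \<in> cyl" for H
    proof -
      obtain L where L: "finite L" "L \<subseteq> carrier G" "dep L H" using cylE(1)[OF H] by auto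
      have "dep L (space (X \<Otimes>\<^sub>M N) - H)"
        unfolding dep_def
      proof (intro ballI allI impI)
        fix x x' y assume x: "x \<in> space X" "x' \<in> space X" "\<forall>l\<in>L. x l = x' l"
        have "(x, y) \<in> H \<longleftrightarrow> (x', y) \<in> H"
          using L(3) x unfolding dep_def by blast
        then show "(x, y) \<in> space (X \<Otimes>\<^sub>M N) - H \<longleftrightarrow> (x', y) \<in> space (X \<Otimes>\<^sub>M N) - H"
          using x by (simp add: space_pair_measure)
      qed
      then show ?thesis using cylE(2)[OF H] by (intro cylI[OF _ L(1,2)]) auto
    qed
    show "H \<union> H' \<in> cyl" if H: "H \<in> cyl" and H': "H' \<in> cyl" for H H'
    proof -
      obtain L where L: "finite L" "L \<subseteq> carrier G" "dep L H" using cylE(1)[OF H] by auto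
      obtain L' where L': "finite L'" "L' \<subseteq> carrier G" "dep L' H'" using cylE(1)[OF H'] by auto
      have "dep (L \<union> L') (H \<union> H')"
        unfolding dep_def
      proof (intro ballI allI impI)
        fix x x' y assume x: "x \<in> space X" "x' \<in> space X" "\<forall>l\<in>L \<union> L'. x l = x' l"
        have "(x, y) \<in> H \<longleftrightarrow> (x', y) \<in> H" "(x, y) \<in> H' \<longleftrightarrow> (x', y) \<in> H'"
          using L(3) L'(3) x unfolding dep_def ball_Un by blast+
        then show "(x, y) \<in> H \<union> H' \<longleftrightarrow> (x', y) \<in> H \<union> H'" by simp
      qed
      then show ?thesis using cylE(2)[OF H] cylE(2)[OF H'] L L' by (intro cylI[of _ "L \<union> L'"]) auto
    qed
    fix ab and d :: real assume "ab \<in> {a \<times> b | a b. a \<in> sets X \<and> b \<in> sets N}" and d: "0 < d"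
    then obtain a b where ab: "ab = a \<times> b" and [measurable]: "a \<in> sets X" "b \<in> sets N" by auto
    obtain H L where H[measurable]: "H \<in> sets X" and L: "finite L" "L \<subseteq> carrier G" "depends_on L H"
      and less: "measure X ((a - H) \<union> (H - a)) < d"
      using cylinder_approximation[OF \<open>a \<in> sets X\<close> d] by blast
    have "measure (X \<Otimes>\<^sub>M N) ((ab - H \<times> b) \<union> (H \<times> b - ab))
        \<le> measure (X \<Otimes>\<^sub>M N) (((a - H) \<union> (H - a)) \<times> space N)"
      using sets.sets_into_space[OF \<open>b \<in> sets N\<close>] unfolding ab
      by (intro P.finite_measure_mono) auto
    also have "\<dots> = measure X ((a - H) \<union> (H - a))"
      by (simp add: measure_def N.emeasure_pair_measure_Times N.emeasure_space_1)
    finally have "measure (X \<Otimes>\<^sub>M N) ((ab - H \<times> b) \<union> (H \<times> b - ab)) < d" using less by simp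
    moreover have "dep L (H \<times> b)" 
      unfolding dep_def
    proof (intro ballI allI impI)
      fix x x' y assume x: "x \<in> space X" "x' \<in> space X" "\<forall>l\<in>L. x l = x' l"
      then have "x \<in> H \<longleftrightarrow> x' \<in> H" using L(3)[unfolded depends_on_def, rule_format, OF x(1,2)] by blast
      then show "(x, y) \<in> H \<times> b \<longleftrightarrow> (x', y) \<in> H \<times> b" by simp
    qed
    ultimately show "\<exists>H\<in>cyl. measure (X \<Otimes>\<^sub>M N) ((ab - H) \<union> (H - ab)) < d"
      using L by (intro bexI[of _ "H \<times> b"] cylI[of "H \<times> b" L]) simp_all
  qed
  then obtain H where H: "H \<in> cyl" "measure (X \<Otimes>\<^sub>M N) ((A - H) \<union> (H - A)) < e" by (rule bexE)
  from cylE(1)[OF H(1)] obtain L where L: "finite L" "L \<subseteq> carrier G" "dep L H" by auto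
  show ?thesis
    by (rule exI[of _ H], rule exI[of _ L], intro conjI cylE(2)[OF H(1)] L(1,2) H(2) L(3)[unfolded dep_def])
qed

end

section \<open>A zero-one law for exchangeable events with unequal marginals\<close>

context bernoulli
begin

lemma measure_cylinder:
  assumes "finite J" "J \<subseteq> carrier G"
  shows "measure X {x\<in>space X. \<forall>j\<in>J. x j \<in> S j} = (\<Prod>j\<in>J. measure (\<mu> j) (S j))"
proof -
  have "AE x in X. flip j x \<in> space X \<longleftrightarrow> x \<in> space X" if "j \<in> carrier G" for j
    using AE_space by eventually_elim (simp add: flip_space[OF that])
  from measure_flip_invariant_cylinder[OF sets.top this assms, of S] show ?thesis
    by (simp add: prob_space)
qed

lemma measure_coordinate: "j \<in> carrier G \<Longrightarrow> measure X {x\<in>space X. x j = b} = p j b"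
  using measure_cylinder[of "{j}" "\<lambda>_. {b}"] by (simp add: measure_pmf_single)

lemma measure_two_coordinates:
  assumes "i \<in> carrier G" "j \<in> carrier G" "i \<noteq> j"
  shows "measure X {x\<in>space X. x i = b \<and> x j = c} = p i b * p j c"
  using measure_cylinder[of "{i, j}" "\<lambda>k. if k = i then {b} else {c}"] assms
  by (simp add: measure_pmf_single cong: conj_cong)

text \<open>A weak law of large numbers. The coordinates are independent, so the variance of the sum
  is at most its mean \<open>s\<close>, and after division by \<open>s\<close> at most
  \<open>1 / s\<close>, hence at most \<open>d\<^sup>2\<close>.\<close>

lemma expectation_coordinate_sum:
  assumes J: "finite J" "J \<subseteq> carrier G" and s: "s = (\<Sum>j\<in>J. p j b)" "0 < s" and d: "0 < d" "1 / d\<^sup>2 \<le> s"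
  shows "(\<integral>x. \<bar>1 - (\<Sum>j\<in>J. indicator {x\<in>space X. x j = b} x) / s\<bar> \<partial>X) \<le> d"
proof -
  define C where "C j = {x\<in>space X. x j = b}" for j
  have C[measurable]: "C j \<in> sets X" if "j \<in> J" for j
    unfolding C_def using coordinate_sets[of j "{b}"] J that by auto
  define f where "f j x = indicator (C j) x - p j b" for j x
  have int_f: "integrable X (\<lambda>x. f i x * f j x)" if "i \<in> J" "j \<in> J" for i j
  proof (rule integrable_const_bound[where B=1])
    have "\<bar>f j x\<bar> \<le> 1" for j x
      unfolding f_def using pmf_le_1[of "\<mu> j" b] pmf_nonneg[of "\<mu> j" b] by (auto simp: indicator_def)
    then show "AE x in X. norm (f i x * f j x) \<le> 1"
      by (auto simp: abs_mult intro!: mult_le_one)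
    show "(\<lambda>x. f i x * f j x) \<in> borel_measurable X"
      unfolding f_def using that by measurable
  qed
  \<comment> \<open>Off the diagonal this is independence. On the diagonal the variance of the
    indicator is its probability less the square of it.\<close>
  have E: "(\<integral>x. f i x * f j x \<partial>X) \<le> (if i = j then p j b else 0)" if ij: "i \<in> J" "j \<in> J" for i j
  proof -
    have "(\<integral>x. f i x * f j x \<partial>X) = (\<integral>x. indicator (C i \<inter> C j) x - p i b * indicator (C j) x
        - p j b * indicator (C i) x + p i b * p j b \<partial>X)"
      by (intro Bochner_Integration.integral_cong refl) (simp add: f_def indicator_inter_arith algebra_simps)
    also have "\<dots> = measure X (C i \<inter> C j) - p i b * measure X (C j) - p j b * measure X (C i) + p i b * p j b"
      using C ij by (simp add: prob_space emeasure_eq_measure)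
    also have "measure X (C i) = p i b"
      using ij J unfolding C_def by (auto simp: measure_coordinate)
    also have "measure X (C j) = p j b"
      using ij J unfolding C_def by (auto simp: measure_coordinate)
    also have "measure X (C i \<inter> C j) = (if i = j then p j b else p i b * p j b)"
      using measure_two_coordinates[of i j b b] measure_coordinate[of j b] ij J
      by (auto simp: C_def Int_def conj_ac subset_eq cong: conj_cong)
    finally show ?thesis using pmf_nonneg[of "\<mu> j" b] by auto
  qed
  define Q where "Q x = (\<Sum>j\<in>J. indicator (C j) x) / s" for x
  have Qm: "Q \<in> borel_measurable X" unfolding Q_def by measurable
  have sq: "(1 - Q x)\<^sup>2 = (\<Sum>i\<in>J. \<Sum>j\<in>J. f i x * f j x) / s\<^sup>2" for x
  proof -
    have "1 - Q x = - (\<Sum>j\<in>J. f j x) / s"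
      using s by (simp add: Q_def f_def sum_subtractf field_simps)
    then have "(1 - Q x)\<^sup>2 = (\<Sum>j\<in>J. f j x)\<^sup>2 / s\<^sup>2" by (simp add: power_divide)
    then show ?thesis by (simp add: power2_eq_square sum_product)
  qed
  have int_sq: "integrable X (\<lambda>x. (1 - Q x)\<^sup>2)"
    unfolding sq using int_f by auto
  have "(\<integral>x. (1 - Q x)\<^sup>2 \<partial>X) = (\<Sum>i\<in>J. \<Sum>j\<in>J. (\<integral>x. f i x * f j x \<partial>X)) / s\<^sup>2"
    unfolding sq using int_f by simp
  also have "\<dots> \<le> (\<Sum>i\<in>J. \<Sum>j\<in>J. (if i = j then p j b else 0)) / s\<^sup>2"
    by (intro divide_right_mono sum_mono E) auto
  also have "\<dots> = s / s\<^sup>2" using J s by simp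
  also have "\<dots> = 1 / s" using s by (simp add: power2_eq_square)
  also have "\<dots> \<le> d\<^sup>2" using d s by (simp add: field_simps)
  finally have var: "(\<integral>x. (1 - Q x)\<^sup>2 \<partial>X) \<le> d\<^sup>2" .
  \<comment> \<open>The inequality \<open>2 * d * y \<le> y\<^sup>2 + d * d\<close> for
    \<open>y = \<bar>1 - Q x\<bar>\<close> stands in for Cauchy-Schwarz.\<close>
  have "(\<integral>x. \<bar>1 - Q x\<bar> \<partial>X) \<le> (\<integral>x. ((1 - Q x)\<^sup>2 / d + d) / 2 \<partial>X)"
  proof (rule integral_mono')
    show "integrable X (\<lambda>x. ((1 - Q x)\<^sup>2 / d + d) / 2)" using int_sq by auto
    fix x
    have "0 \<le> (\<bar>1 - Q x\<bar> - d)\<^sup>2" by simp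
    then have "2 * d * \<bar>1 - Q x\<bar> \<le> (1 - Q x)\<^sup>2 + d * d"
      by (simp add: power2_diff power2_eq_square algebra_simps)
    then show "\<bar>1 - Q x\<bar> \<le> ((1 - Q x)\<^sup>2 / d + d) / 2"
      using d by (simp add: field_simps)
    then show "0 \<le> ((1 - Q x)\<^sup>2 / d + d) / 2"
      by (rule order_trans[OF abs_ge_zero])
  qed
  also have "\<dots> = ((\<integral>x. (1 - Q x)\<^sup>2 \<partial>X) / d + d) / 2"
    using int_sq by (simp add: prob_space)
  also have "\<dots> \<le> (d\<^sup>2 / d + d) / 2"
    using var d by (intro divide_right_mono add_right_mono) auto
  also have "\<dots> = d" using d by (simp add: power2_eq_square)
  finally show ?thesis by (simp add: Q_def C_def)
qed

text \<open>A configuration with \<open>x e \<noteq> b\<close> is compared with \<open>flip e x\<close> by exchanging the value at \<open>e\<close> with that at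
  a randomly chosen far away coordinate \<open>j\<close> where \<open>x j = b\<close>: an approximating cylinder set does not
  notice the change at \<open>j\<close>.\<close>

lemma swap_invariant_imp_flip_invariant:
  assumes A[measurable]: "A \<in> sets X"
    and swap: "\<And>i j. i \<in> carrier G \<Longrightarrow> j \<in> carrier G \<Longrightarrow> i \<noteq> j \<Longrightarrow>
       AE x in X. x i \<noteq> x j \<longrightarrow> (flip i (flip j x) \<in> A \<longleftrightarrow> x \<in> A)"
    and e: "e \<in> carrier G"
    and big: "\<And>B L. finite L \<Longrightarrow> \<exists>J. finite J \<and> J \<subseteq> carrier G - L \<and> (\<forall>j\<in>J. p j b \<le> 1 / 2) \<and> B \<le> (\<Sum>j\<in>J. p j b)"
  shows "AE x in X. x e \<noteq> b \<longrightarrow> (flip e x \<in> A \<longleftrightarrow> x \<in> A)"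
proof -
  note [measurable] = flip_measurable[OF e] coordinate_measurable[OF measurable_ident_sets[OF refl] e]
  define c where "c = odds e b"
  have c: "0 < c" unfolding c_def by (rule odds_pos[OF e])
  let ?\<Delta> = "{x\<in>space X. x e \<noteq> b \<and> (flip e x \<in> A) \<noteq> (x \<in> A)}"
  have "measure X ?\<Delta> \<le> (1 + 3 * c) * d" if d: "0 < d" for d
  proof -
    obtain H L where H[measurable]: "H \<in> sets X" and L: "finite L" "L \<subseteq> carrier G" "depends_on L H"
      and less: "measure X ((A - H) \<union> (H - A)) < d"
      using cylinder_approximation[OF A d] by blast
    define S where "S = (A - H) \<union> (H - A)"
    have S[measurable]: "S \<in> sets X" unfolding S_def by measurable
    obtain J where J: "finite J" "J \<subseteq> carrier G - insert e L" "\<forall>j\<in>J. p j b \<le> 1 / 2" "1 / d\<^sup>2 \<le> (\<Sum>j\<in>J. p j b)"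
      using big[of "insert e L" "1 / d\<^sup>2"] L by auto
    define s where "s = (\<Sum>j\<in>J. p j b)"
    have "0 < 1 / d\<^sup>2" using d by simp
    then have s: "0 < s" using J(4) unfolding s_def by linarith
    have flipS: "measure X {x\<in>space X. x e \<noteq> b \<and> flip e x \<in> S} \<le> c * measure X S"
    proof -
      have "emeasure X {x\<in>space X. x e \<noteq> b \<and> flip e x \<in> S} = (\<integral>\<^sup>+x. indicator {x\<in>space X. x e \<noteq> b \<and> flip e x \<in> S} x \<partial>X)"
        by (rule nn_integral_indicator[symmetric]) measurable
      also have "\<dots> = (\<integral>\<^sup>+x. of_bool (x e = (\<not> b)) * indicator S (flip e x) \<partial>X)"
        by (intro nn_integral_cong) (auto simp: indicator_def)
      also have "\<dots> \<le> ennreal c * (\<integral>\<^sup>+x. indicator S x \<partial>X)"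
        using nn_integral_flip_le[OF e, of "indicator S" "\<not> b"] unfolding c_def by simp
      finally show ?thesis
        using c by (simp add: emeasure_eq_measure ennreal_mult'[symmetric])
    qed
    \<comment> \<open>The flipped point is tested against the cylinder set \<open>H\<close>, which
      is blind to the coordinates in \<open>J\<close>. Passing from \<open>A\<close> to
      \<open>H\<close> there is paid for by \<open>flipS\<close>.\<close>
    let ?\<Delta>1 = "{x\<in>space X. x e \<noteq> b \<and> (x \<in> A) \<noteq> (flip e x \<in> H)}"
    have D1[measurable]: "?\<Delta>1 \<in> sets X" by measurable
    have D1j: "measure X {x\<in>?\<Delta>1. x j = b} \<le> 2 * p j b * (c * measure X S)" if j: "j \<in> J" for j
    proof -
      have jc: "j \<in> carrier G" "j \<noteq> e" "j \<notin> L" using j J by auto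
      note [measurable] = flip_measurable[OF jc(1)] coordinate_measurable[OF measurable_ident_sets[OF refl] jc(1)]
      let ?E = "{x\<in>space X. x e \<noteq> b \<and> flip e x \<in> S}"
      have "emeasure X {x\<in>?\<Delta>1. x j = b} = (\<integral>\<^sup>+x. indicator {x\<in>?\<Delta>1. x j = b} x \<partial>X)"
      proof (rule nn_integral_indicator[symmetric])
        have "{x\<in>?\<Delta>1. x j = b} = {x\<in>space X. x \<in> ?\<Delta>1 \<and> x j = b}" by auto
        also have "\<dots> \<in> sets X" by measurable
        finally show "{x\<in>?\<Delta>1. x j = b} \<in> sets X" .
      qed
      also have "\<dots> \<le> (\<integral>\<^sup>+x. of_bool (x j = b) * indicator ?E (flip j x) \<partial>X)"
      proof (rule nn_integral_mono_AE)
        show "AE x in X. indicator {x\<in>?\<Delta>1. x j = b} x \<le> (of_bool (x j = b) * indicator ?E (flip j x) :: ennreal)"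
          using swap[OF e jc(1) jc(2)[symmetric]] AE_space
        proof eventually_elim
          case (elim x)
          show ?case
          proof (cases "x \<in> {x\<in>?\<Delta>1. x j = b}")
            case True
            then have x: "x e \<noteq> b" "x j = b" "(x \<in> A) \<noteq> (flip e x \<in> H)" by auto
            have "flip e (flip j x) \<in> A \<longleftrightarrow> x \<in> A" using elim x by simp
            moreover have "flip e (flip j x) \<in> H \<longleftrightarrow> flip e x \<in> H"
            proof -
              have "\<forall>l\<in>L. flip e (flip j x) l = flip e x l"
                using jc by (auto simp: flip_def)
              then show ?thesis
                using L(3) flip_space[OF e flip_space[OF jc(1) elim(2)]] flip_space[OF e elim(2)]
                unfolding depends_on_def by blast
            qed
            ultimately have "flip e (flip j x) \<in> S" using x unfolding S_def by blast
            then have "flip j x \<in> ?E" using x jc flip_space[OF jc(1) elim(2)] by simp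
            then show ?thesis using x by (simp add: indicator_def)
          qed simp
        qed
      qed
      also have "\<dots> \<le> ennreal (odds j (\<not> b)) * (\<integral>\<^sup>+x. indicator ?E x \<partial>X)"
        by (rule nn_integral_flip_le[OF jc(1)]) measurable
      also have "(\<integral>\<^sup>+x. indicator ?E x \<partial>X) = emeasure X ?E"
        by (rule nn_integral_indicator) measurable
      finally have "measure X {x\<in>?\<Delta>1. x j = b} \<le> odds j (\<not> b) * measure X ?E"
        using odds_pos[OF jc(1)] by (simp add: emeasure_eq_measure ennreal_mult''[symmetric] less_imp_le)
      also have "\<dots> \<le> (2 * p j b) * (c * measure X S)"
      proof (rule mult_mono)
        \<comment> \<open>The condition \<open>p j b \<le> 1 / 2\<close> keeps the cost of flipping
          \<open>j\<close> away from \<open>b\<close> within \<open>2 * p j b\<close>. Summed over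
          \<open>J\<close> this is \<open>2 * s\<close>, which the division by \<open>s\<close>
          cancels.\<close>
        have "1 / 2 \<le> p j (\<not> b)" using J(3) j p_not[of j b] by auto
        then show "odds j (\<not> b) \<le> 2 * p j b"
          using p_pos[OF jc(1), of b] by (simp add: odds_def field_simps)
      qed (use flipS in auto)
      finally show ?thesis .
    qed
    \<comment> \<open>\<open>Q\<close> has mean 1 and, by the choice of \<open>J\<close>, small
      deviation. So the indicator of \<open>?\<Delta>1\<close> can be replaced by the sum of its
      restrictions to \<open>x j = b\<close> divided by \<open>s\<close>, at the cost of the mean of
      \<open>\<bar>1 - Q x\<bar>\<close>.\<close>
    define Q where "Q x = (\<Sum>j\<in>J. indicator {x\<in>space X. x j = b} x) / s" for x
    have Cm[measurable]: "{x\<in>space X. x j = b} \<in> sets X" if "j \<in> J" for j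
      using coordinate_sets[of j "{b}"] J that by auto
    have Dj[measurable]: "{x\<in>?\<Delta>1. x j = b} \<in> sets X" if "j \<in> J" for j
    proof -
      have "{x\<in>?\<Delta>1. x j = b} = ?\<Delta>1 \<inter> {x\<in>space X. x j = b}" by auto
      then show ?thesis using D1 Cm[OF that] by auto
    qed
    have ind: "integrable X (indicat_real B)" if "B \<in> sets X" for B
      using that by (simp add: emeasure_eq_measure)
    have Qint: "integrable X Q" unfolding Q_def
      by (intro Bochner_Integration.integrable_divide Bochner_Integration.integrable_sum ind Cm)
    have "measure X ?\<Delta>1 = (\<integral>x. indicator ?\<Delta>1 x \<partial>X)" using D1 by simp
    also have "\<dots> \<le> (\<integral>x. \<bar>1 - Q x\<bar> + (\<Sum>j\<in>J. indicator {x\<in>?\<Delta>1. x j = b} x) / s \<partial>X)"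
    proof (rule integral_mono)
      show "integrable X (indicator ?\<Delta>1 :: _ \<Rightarrow> real)" by (rule ind[OF D1])
      show "integrable X (\<lambda>x. \<bar>1 - Q x\<bar> + (\<Sum>j\<in>J. indicator {x\<in>?\<Delta>1. x j = b} x) / s)"
        using Qint by (intro Bochner_Integration.integrable_add integrable_abs Bochner_Integration.integrable_diff
            Bochner_Integration.integrable_divide Bochner_Integration.integrable_sum ind Dj) auto
      fix x assume x: "x \<in> space X"
      have nn: "0 \<le> (\<Sum>j\<in>J. indicator {x\<in>?\<Delta>1. x j = b} x) / s"
        using s by (intro divide_nonneg_nonneg sum_nonneg) auto
      show "indicator ?\<Delta>1 x \<le> \<bar>1 - Q x\<bar> + (\<Sum>j\<in>J. indicator {x\<in>?\<Delta>1. x j = b} x) / s"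
      proof (cases "x \<in> ?\<Delta>1")
        case True
        then have "(\<Sum>j\<in>J. indicator {x\<in>?\<Delta>1. x j = b} x) / s = Q x"
          unfolding Q_def by (intro arg_cong2[where f="(/)"] sum.cong) (auto simp: indicator_def)
        then show ?thesis using True by simp
      qed (use nn in simp)
    qed
    also have "\<dots> = (\<integral>x. \<bar>1 - Q x\<bar> \<partial>X) + (\<Sum>j\<in>J. measure X {x\<in>?\<Delta>1. x j = b}) / s"
    proof -
      have "(\<integral>x. (\<Sum>j\<in>J. indicator {x\<in>?\<Delta>1. x j = b} x) / s \<partial>X) = (\<Sum>j\<in>J. measure X {x\<in>?\<Delta>1. x j = b}) / s"
        using Dj ind by (subst integral_divide_zero, subst Bochner_Integration.integral_sum) auto
      moreover have "integrable X (\<lambda>x. \<bar>1 - Q x\<bar>)"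
        using Qint by (intro integrable_abs Bochner_Integration.integrable_diff) auto
      moreover have "integrable X (\<lambda>x. (\<Sum>j\<in>J. indicator {x\<in>?\<Delta>1. x j = b} x) / s)"
        by (intro Bochner_Integration.integrable_divide Bochner_Integration.integrable_sum ind Dj)
      ultimately show ?thesis by simp
    qed
    also have "\<dots> \<le> d + 2 * (c * measure X S)"
    proof (rule add_mono)
      show "(\<integral>x. \<bar>1 - Q x\<bar> \<partial>X) \<le> d"
        unfolding Q_def using J s d by (intro expectation_coordinate_sum) (auto simp: s_def)
      have "(\<Sum>j\<in>J. measure X {x\<in>?\<Delta>1. x j = b}) \<le> (\<Sum>j\<in>J. 2 * p j b * (c * measure X S))"
        by (rule sum_mono) (rule D1j)
      also have "\<dots> = 2 * (c * measure X S) * s"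
        by (simp add: s_def sum_distrib_left mult_ac)
      finally show "(\<Sum>j\<in>J. measure X {x\<in>?\<Delta>1. x j = b}) / s \<le> 2 * (c * measure X S)"
        using s by (simp add: field_simps)
    qed
    finally have D1_le: "measure X ?\<Delta>1 \<le> d + 2 * (c * measure X S)" .
    have "measure X ?\<Delta> \<le> measure X (?\<Delta>1 \<union> {x\<in>space X. x e \<noteq> b \<and> flip e x \<in> S})"
      by (rule finite_measure_mono) (auto simp: S_def)
    also have "\<dots> \<le> measure X ?\<Delta>1 + measure X {x\<in>space X. x e \<noteq> b \<and> flip e x \<in> S}"
      by (rule measure_Un_le) measurable
    also have "\<dots> \<le> d + 3 * (c * measure X S)" using D1_le flipS by simp
    also have "\<dots> \<le> d + 3 * (c * d)"
      using less c unfolding S_def by (intro add_left_mono mult_left_mono) auto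
    also have "\<dots> = (1 + 3 * c) * d" by (simp add: algebra_simps)
    finally show ?thesis .
  qed
  note bound = this
  have "measure X ?\<Delta> \<le> 0"
  proof (rule field_le_epsilon)
    fix r :: real assume r: "0 < r"
    have "measure X ?\<Delta> \<le> (1 + 3 * c) * (r / (1 + 3 * c))"
      using c r by (intro bound) simp
    then show "measure X ?\<Delta> \<le> 0 + r" using c by simp
  qed
  then have "measure X ?\<Delta> = 0" using measure_nonneg by (intro antisym)
  then have "emeasure X ?\<Delta> = 0" by (simp add: emeasure_eq_measure)
  moreover have "?\<Delta> \<in> sets X" by measurable
  ultimately show ?thesis by (intro AE_I[where N="?\<Delta>"]) auto
qed

text \<open>At each coordinate one of the two values has probability at most \<open>1 / 2\<close>.
  As the sums of the minima are unbounded, some value \<open>b\<close> has, beyond every finite set,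
  unbounded total probability on coordinates where it is at most \<open>1 / 2\<close>. These
  coordinates are the exchange partners needed to turn swaps into flips.\<close>

lemma swap_zero_one:
  assumes A: "A \<in> sets X"
    and swap: "\<And>i j. i \<in> carrier G \<Longrightarrow> j \<in> carrier G \<Longrightarrow> i \<noteq> j \<Longrightarrow>
       AE x in X. x i \<noteq> x j \<longrightarrow> (flip i (flip j x) \<in> A \<longleftrightarrow> x \<in> A)"
    and unbounded: "\<And>B. \<exists>J. finite J \<and> J \<subseteq> carrier G \<and> B \<le> (\<Sum>j\<in>J. min (p j True) (p j False))"
  shows "measure X A = 0 \<or> measure X A = 1"
proof -
  have "\<exists>b. \<forall>B L. finite L \<longrightarrow> (\<exists>J. finite J \<and> J \<subseteq> carrier G - L \<and> (\<forall>j\<in>J. p j b \<le> 1 / 2) \<and> B \<le> (\<Sum>j\<in>J. p j b))"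
  proof (rule ccontr)
    assume "\<not> ?thesis"
    then have "\<forall>b. \<exists>B L. finite L \<and> (\<forall>J. finite J \<and> J \<subseteq> carrier G - L \<and> (\<forall>j\<in>J. p j b \<le> 1 / 2) \<longrightarrow> (\<Sum>j\<in>J. p j b) < B)"
      by (meson not_le)
    then obtain B L where L: "\<And>b. finite (L b)"
      and B: "\<And>b J. finite J \<Longrightarrow> J \<subseteq> carrier G - L b \<Longrightarrow> (\<forall>j\<in>J. p j b \<le> 1 / 2) \<Longrightarrow> (\<Sum>j\<in>J. p j b) < B b"
      by metis
    let ?m = "\<lambda>j. min (p j True) (p j False)"
    obtain J where J: "finite J" "J \<subseteq> carrier G"
      "B True + B False + card (L True) + card (L False) \<le> (\<Sum>j\<in>J. ?m j)"
      using unbounded by blast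
    define Jb where "Jb b = {j\<in>J - L b. p j b \<le> 1 / 2}" for b
    have un: "(\<Sum>j\<in>P \<union> Q. ?m j) \<le> (\<Sum>j\<in>P. ?m j) + (\<Sum>j\<in>Q. ?m j)" if "finite P" "finite Q" for P Q
      unfolding sum_Un[OF that] by (simp add: sum_nonneg)
    have m: "0 \<le> ?m j" "?m j \<le> 1" for j by (auto simp: pmf_le_1 min_le_iff_disj)
    have "J \<subseteq> (Jb True \<union> Jb False) \<union> (L True \<union> L False)"
    proof
      fix j assume "j \<in> J"
      moreover have "p j True \<le> 1 / 2 \<or> p j False \<le> 1 / 2" using p_not[of j True] by auto
      ultimately show "j \<in> (Jb True \<union> Jb False) \<union> (L True \<union> L False)" by (auto simp: Jb_def)
    qed
    moreover have fin: "finite (Jb b)" for b using J by (auto simp: Jb_def)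
    ultimately have "(\<Sum>j\<in>J. ?m j) \<le> (\<Sum>j\<in>(Jb True \<union> Jb False) \<union> (L True \<union> L False). ?m j)"
      using m L by (intro sum_mono2) auto
    also have "\<dots> \<le> ((\<Sum>j\<in>Jb True. ?m j) + (\<Sum>j\<in>Jb False. ?m j)) + ((\<Sum>j\<in>L True. ?m j) + (\<Sum>j\<in>L False. ?m j))"
      using L fin by (intro order_trans[OF un] add_mono un) auto
    also have "\<dots> \<le> ((\<Sum>j\<in>Jb True. p j True) + (\<Sum>j\<in>Jb False. p j False)) + ((\<Sum>j\<in>L True. 1) + (\<Sum>j\<in>L False. 1))"
      using m by (intro add_mono sum_mono) auto
    also have "\<dots> < B True + B False + card (L True) + card (L False)"
    proof -
      have "(\<Sum>j\<in>Jb b. p j b) < B b" for b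
        using J fin by (intro B) (auto simp: Jb_def)
      from this[of True] this[of False] show ?thesis by simp
    qed
    finally show False using J(3) by simp
  qed
  then obtain b where big: "\<And>B L. finite L \<Longrightarrow>
      \<exists>J. finite J \<and> J \<subseteq> carrier G - L \<and> (\<forall>j\<in>J. p j b \<le> 1 / 2) \<and> B \<le> (\<Sum>j\<in>J. p j b)"
    by blast
  have "AE x in X. flip e x \<in> A \<longleftrightarrow> x \<in> A" if e: "e \<in> carrier G" for e
  proof -
    have *: "AE x in X. x e \<noteq> b \<longrightarrow> (flip e x \<in> A \<longleftrightarrow> x \<in> A)"
      by (rule swap_invariant_imp_flip_invariant[OF A swap e big])
    \<comment> \<open>If \<open>x e = b\<close>, then \<open>flip e x\<close> is a point to which
      \<open>*\<close> applies.\<close>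
    from * AE_flip[OF e *] show ?thesis
      by eventually_elim auto
  qed
  then show ?thesis by (rule flip_zero_one[OF A])
qed

end

section \<open>Perturbations and ergodicity on products\<close>

context quasi_invariant_action
begin

lemma perturbation_diagonal:
  fixes N :: "'y measure"
  assumes N: "prob_space N" "pmp_action G N \<psi>"
    and pert: "perturbation G M \<phi> w \<tau> X0 c t \<kappa> Bad"
  shows "perturbation G (M \<Otimes>\<^sub>M N) (diagonal_action M \<phi> N \<psi>) (\<lambda>g z. w g (fst z))
           (\<lambda>z. (\<tau> (fst z), snd z)) (X0 \<times> space N) c t \<kappa> Bad"
proof -
  interpret N: prob_space N by fact
  interpret P: pair_prob_space M N ..
  interpret T: perturbation G M \<phi> w \<tau> X0 c t \<kappa> Bad by fact
  interpret D: quasi_invariant_action G "M \<Otimes>\<^sub>M N" "diagonal_action M \<phi> N \<psi>" "\<lambda>g z. w g (fst z)"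
    by (rule quasi_invariant_diagonal) fact+
  note [measurable] = T.tau_measurable T.X0_sets
  have D: "diagonal_action M \<phi> N \<psi> g z = (\<phi> g (fst z), \<psi> g (snd z))" if "z \<in> space (M \<Otimes>\<^sub>M N)" for g z
    using that by (simp add: diagonal_action_def)
  have X0: "x \<in> X0 \<Longrightarrow> x \<in> space M" for x using sets.sets_into_space[OF T.X0_sets] by auto
  have sp: "\<psi> g y \<in> space N" if "g \<in> carrier G" "y \<in> space N" for g y
    using N(2) that by (auto simp: pmp_action_def borel_action_def dest: measurable_space)
  show ?thesis
  proof unfold_locales
    show "(\<lambda>z. (\<tau> (fst z), snd z)) \<in> measurable (M \<Otimes>\<^sub>M N) (M \<Otimes>\<^sub>M N)" by measurable
    show "X0 \<times> space N \<in> sets (M \<Otimes>\<^sub>M N)" by measurable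
    show "c < \<infinity>" by (rule T.c_finite)
    show "1 \<le> \<kappa>" by (rule T.kappa)
    show "k \<in> carrier G - Bad \<Longrightarrow> 1 / \<kappa> \<le> t k \<and> t k \<le> \<kappa>" for k by (rule T.t_bounds)
    fix u :: "_ \<Rightarrow> ennreal" assume [measurable]: "u \<in> borel_measurable (M \<Otimes>\<^sub>M N)"
    have "(\<integral>\<^sup>+z. indicator (X0 \<times> space N) z * u (\<tau> (fst z), snd z) \<partial>(M \<Otimes>\<^sub>M N))
        = (\<integral>\<^sup>+z. indicator X0 (fst z) * u (\<tau> (fst z), snd z) \<partial>(M \<Otimes>\<^sub>M N))"
      by (intro nn_integral_cong) (auto simp: indicator_def space_pair_measure)
    also have "\<dots> = (\<integral>\<^sup>+x. \<integral>\<^sup>+y. indicator X0 x * u (\<tau> x, y) \<partial>N \<partial>M)"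
      by (subst N.nn_integral_fst[symmetric]) auto
    also have "\<dots> = (\<integral>\<^sup>+x. indicator X0 x * (\<integral>\<^sup>+y. u (\<tau> x, y) \<partial>N) \<partial>M)"
    proof (intro nn_integral_cong nn_integral_cmult)
      fix x assume "x \<in> space M"
      from T.tau_space[OF this] show "(\<lambda>y. u (\<tau> x, y)) \<in> borel_measurable N" by measurable
    qed
    also have "\<dots> \<le> c * (\<integral>\<^sup>+x. (\<integral>\<^sup>+y. u (x, y) \<partial>N) \<partial>M)"
      by (rule T.tau_bound[of "\<lambda>x. \<integral>\<^sup>+y. u (x, y) \<partial>N"]) measurable
    also have "(\<integral>\<^sup>+x. (\<integral>\<^sup>+y. u (x, y) \<partial>N) \<partial>M) = (\<integral>\<^sup>+z. u z \<partial>(M \<Otimes>\<^sub>M N))"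
      by (rule N.nn_integral_fst) auto
    finally show "(\<integral>\<^sup>+z. indicator (X0 \<times> space N) z * u (\<tau> (fst z), snd z) \<partial>(M \<Otimes>\<^sub>M N)) \<le> c * (\<integral>\<^sup>+z. u z \<partial>(M \<Otimes>\<^sub>M N))" .
  next
    have "AE z in M \<Otimes>\<^sub>M N. fst z \<in> X0 \<longrightarrow> (\<forall>h\<in>carrier G. \<exists>r. 0 < r \<and> r < \<infinity> \<and>
           (\<forall>h'\<in>carrier G. w (inv h') (\<phi> h (\<tau> (fst z)))
              = w (inv h') (\<phi> h (fst z)) * ennreal (t (inv h' \<otimes> h)) * r))"
      by (rule AE_distrD[OF measurable_fst[of M N]], unfold N.distr_pair_fst, rule T.deriv_tau)
    with AE_space show "AE z in M \<Otimes>\<^sub>M N. z \<in> X0 \<times> space N \<longrightarrow> (\<forall>h\<in>carrier G. \<exists>r. 0 < r \<and> r < \<infinity> \<and>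
           (\<forall>h'\<in>carrier G. w (inv h') (fst (diagonal_action M \<phi> N \<psi> h (\<tau> (fst z), snd z)))
              = w (inv h') (fst (diagonal_action M \<phi> N \<psi> h z)) * ennreal (t (inv h' \<otimes> h)) * r))"
    proof eventually_elim
      case (elim z)
      have "(\<tau> (fst z), snd z) \<in> space (M \<Otimes>\<^sub>M N)"
        using elim(1) T.tau_space by (auto simp: space_pair_measure)
      then show ?case using elim by (auto simp: D)
    qed
  next
    fix e :: real assume "0 < e"
    from T.Bad_escape[OF this] obtain K' \<Phi> where *: "finite K'" "K' \<subseteq> carrier G" "\<Phi> \<in> sets M"
      "emeasure M \<Phi> < ennreal e" "\<forall>k\<in>Bad \<inter> carrier G - K'. \<forall>x\<in>X0. \<phi> k x \<in> \<Phi> \<and> \<phi> k (\<tau> x) \<in> \<Phi>"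
      by blast
    show "\<exists>K' \<Phi>. finite K' \<and> K' \<subseteq> carrier G \<and> \<Phi> \<in> sets (M \<Otimes>\<^sub>M N) \<and> emeasure (M \<Otimes>\<^sub>M N) \<Phi> < ennreal e \<and>
        (\<forall>k\<in>Bad \<inter> carrier G - K'. \<forall>x\<in>X0 \<times> space N. diagonal_action M \<phi> N \<psi> k x \<in> \<Phi> \<and>
            diagonal_action M \<phi> N \<psi> k (\<tau> (fst x), snd x) \<in> \<Phi>)"
    proof (rule exI[of _ K'], rule exI[of _ "\<Phi> \<times> space N"], intro conjI ballI)
      show "emeasure (M \<Otimes>\<^sub>M N) (\<Phi> \<times> space N) < ennreal e"
        using * by (simp add: N.emeasure_pair_measure_Times N.emeasure_space_1)
      fix k z assume k: "k \<in> Bad \<inter> carrier G - K'" and z: "z \<in> X0 \<times> space N"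
      have "z \<in> space (M \<Otimes>\<^sub>M N)" "(\<tau> (fst z), snd z) \<in> space (M \<Otimes>\<^sub>M N)"
        using z X0 T.tau_space by (auto simp: space_pair_measure)
      then show "diagonal_action M \<phi> N \<psi> k z \<in> \<Phi> \<times> space N"
         "diagonal_action M \<phi> N \<psi> k (\<tau> (fst z), snd z) \<in> \<Phi> \<times> space N"
        using *(5) k z sp by (auto simp: D)
    qed (use * in auto)
  qed
qed

text \<open>The \<open>y\<close> whose section is conull form an invariant set, since by
  \<open>AE_act\<close> the section at \<open>y\<close> is conull when that at
  \<open>\<psi> g y\<close> is. Almost all other sections are null, so this set has the measure of
  \<open>A\<close>, and ergodicity of the second action decides.\<close>

lemma ergodic_diagonal_action:
  fixes N :: "'y measure"
  assumes N: "prob_space N" "pmp_action G N \<psi>" "ergodic_action G N \<psi>"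
    and sections: "\<And>A. A \<in> sets (M \<Otimes>\<^sub>M N) \<Longrightarrow>
        (\<And>g z. g \<in> carrier G \<Longrightarrow> z \<in> space (M \<Otimes>\<^sub>M N) \<Longrightarrow> diagonal_action M \<phi> N \<psi> g z \<in> A \<longleftrightarrow> z \<in> A) \<Longrightarrow>
        AE y in N. measure M {x\<in>space M. (x, y) \<in> A} = 0 \<or> measure M {x\<in>space M. (x, y) \<in> A} = 1"
  shows "ergodic_action G (M \<Otimes>\<^sub>M N) (diagonal_action M \<phi> N \<psi>)"
  unfolding ergodic_action_def
proof (intro ballI impI)
  interpret N: prob_space N by fact
  interpret P: pair_prob_space M N ..
  interpret D: quasi_invariant_action G "M \<Otimes>\<^sub>M N" "diagonal_action M \<phi> N \<psi>" "\<lambda>g z. w g (fst z)"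
    by (rule quasi_invariant_diagonal) fact+
  have act: "group_action G (space N) \<psi>" and meas: "\<And>g. g \<in> carrier G \<Longrightarrow> \<psi> g \<in> measurable N N"
    using N(2) by (auto simp: pmp_action_def borel_action_def)
  interpret act: group_action G "space N" \<psi> by (rule act)
  fix A assume A[measurable]: "A \<in> sets (M \<Otimes>\<^sub>M N)"
    and im: "\<forall>g\<in>carrier G. diagonal_action M \<phi> N \<psi> g ` A = A"
  have Asp: "A \<subseteq> space (M \<Otimes>\<^sub>M N)" by (rule sets.sets_into_space[OF A])
  have inv: "diagonal_action M \<phi> N \<psi> g z \<in> A \<longleftrightarrow> z \<in> A" if g: "g \<in> carrier G" and z: "z \<in> space (M \<Otimes>\<^sub>M N)" for g z
  proof
    assume "z \<in> A" then show "diagonal_action M \<phi> N \<psi> g z \<in> A" using im g by blast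
  next
    assume "diagonal_action M \<phi> N \<psi> g z \<in> A"
    then have "diagonal_action M \<phi> N \<psi> (inv g) (diagonal_action M \<phi> N \<psi> g z) \<in> A" using im g by blast
    then show "z \<in> A" using D.act_inv[OF g z] by simp
  qed
  let ?B = "{y\<in>space N. AE x in M. (x, y) \<in> A}"
  have B_iff: "(AE x in M. (x, y) \<in> A) \<longleftrightarrow> emeasure M {x\<in>space M. (x, y) \<in> A} = 1" if "y \<in> space N" for y
  proof -
    have "(AE x in M. (x, y) \<in> A) \<longleftrightarrow> (AE x in M. x \<in> {x\<in>space M. (x, y) \<in> A})"
      by (intro AE_cong) simp
    also have "\<dots> \<longleftrightarrow> emeasure M {x\<in>space M. (x, y) \<in> A} = 1"
      by (subst AE_in_set_eq_1) (use that in \<open>auto simp: emeasure_eq_measure\<close>)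
    finally show ?thesis .
  qed
  have m: "(\<lambda>y. emeasure M {x\<in>space M. (x, y) \<in> A}) \<in> borel_measurable N"
  proof -
    have "{x\<in>space M. (x, y) \<in> A} = (\<lambda>x. (x, y)) -` A" for y
      using Asp by (auto simp: space_pair_measure)
    then show ?thesis using P.measurable_emeasure_Pair2[OF A] by simp
  qed
  have "?B = {y\<in>space N. emeasure M {x\<in>space M. (x, y) \<in> A} = 1}" using B_iff by auto
  also have "\<dots> \<in> sets N" using m by measurable
  finally have Bm: "?B \<in> sets N" .
  have step: "AE x in M. (x, y) \<in> A" if g: "g \<in> carrier G" and y: "y \<in> space N" and *: "AE x in M. (x, \<psi> g y) \<in> A" for g y
    using AE_act[OF g *] AE_space
  proof eventually_elim
    case (elim x)
    then have "(x, y) \<in> space (M \<Otimes>\<^sub>M N)" using y by (simp add: space_pair_measure)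
    then show ?case using inv[OF g, of "(x, y)"] elim by (simp add: diagonal_action_def)
  qed
  have sp: "\<psi> g y \<in> space N" if "g \<in> carrier G" "y \<in> space N" for g y
    using measurable_space[OF meas] that by simp
  have inv1: "\<psi> (inv g) (\<psi> g y) = y" "\<psi> g (\<psi> (inv g) y) = y" if "g \<in> carrier G" "y \<in> space N" for g y
    using that act.composition_rule[of y "inv g" g] act.composition_rule[of y g "inv g"] act.id_eq_one
    by (simp_all add: fun_eq_iff restrict_def) metis+
  have Binv: "\<psi> g ` ?B = ?B" if g: "g \<in> carrier G" for g
  proof (intro equalityI subsetI)
    fix y assume "y \<in> \<psi> g ` ?B"
    then obtain y' where y': "y = \<psi> g y'" "y' \<in> space N" "AE x in M. (x, y') \<in> A" by auto
    have "AE x in M. (x, y) \<in> A"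
      by (rule step[of "inv g"]) (use y' g sp[OF g y'(2)] in \<open>auto simp: inv1\<close>)
    then show "y \<in> ?B" using y' sp[OF g y'(2)] by simp
  next
    fix y assume "y \<in> ?B"
    then have y: "y \<in> space N" "AE x in M. (x, y) \<in> A" by auto
    have y': "\<psi> (inv g) y \<in> space N" using sp y g by simp
    have "AE x in M. (x, \<psi> (inv g) y) \<in> A"
      by (rule step[of g]) (use y y' g in \<open>auto simp: inv1\<close>)
    then show "y \<in> \<psi> g ` ?B" using y y' inv1[OF g y(1)] by (intro image_eqI[of _ _ "\<psi> (inv g) y"]) auto
  qed
  have "emeasure N ?B = 0 \<or> emeasure N ?B = 1"
    by (rule N(3)[unfolded ergodic_action_def, rule_format, OF Bm Binv])
  moreover have sec: "emeasure (M \<Otimes>\<^sub>M N) A = (\<integral>\<^sup>+y. emeasure M {x\<in>space M. (x, y) \<in> A} \<partial>N)"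
  proof -
    have "{x\<in>space M. (x, y) \<in> A} = (\<lambda>x. (x, y)) -` A" for y
      using Asp by (auto simp: space_pair_measure)
    then show ?thesis using P.emeasure_pair_measure_alt2[OF A] by simp
  qed
  moreover have "emeasure (M \<Otimes>\<^sub>M N) A = emeasure N ?B"
  proof -
    have s01: "AE y in N. measure M {x\<in>space M. (x, y) \<in> A} = 0 \<or> measure M {x\<in>space M. (x, y) \<in> A} = 1"
      by (rule sections[OF A inv])
    have "(\<integral>\<^sup>+y. emeasure M {x\<in>space M. (x, y) \<in> A} \<partial>N) = (\<integral>\<^sup>+y. indicator ?B y \<partial>N)"
    proof (rule nn_integral_cong_AE)
      show "AE y in N. emeasure M {x\<in>space M. (x, y) \<in> A} = indicator ?B y"
        using s01 AE_space
        by eventually_elim (auto simp: B_iff indicator_def emeasure_eq_measure)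
    qed
    then show ?thesis using Bm by (simp add: sec)
  qed
  ultimately show "emeasure (M \<Otimes>\<^sub>M N) A = 0 \<or> emeasure (M \<Otimes>\<^sub>M N) A = 1" by simp
qed

end

section \<open>Nonsingular Bernoulli actions\<close>

locale nonsingular_bernoulli = bernoulli G \<mu>
  for G :: "('g, 'b) monoid_scheme" (structure) and \<mu> +
  assumes nonsingular: "nonsingular_action G X (bernoulli_action G)"
begin

abbreviation shift :: "'g \<Rightarrow> ('g \<Rightarrow> bool) \<Rightarrow> 'g \<Rightarrow> bool" where "shift \<equiv> bernoulli_action G"

abbreviation w :: "'g \<Rightarrow> ('g \<Rightarrow> bool) \<Rightarrow> ennreal" where "w \<equiv> action_deriv G X shift"

sublocale act: quasi_invariant_action G X shift w
  by (rule quasi_invariant_action_action_deriv[OF group_axioms prob_space_axioms countable_G nonsingular])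

lemma shift_apply:
  "x \<in> space X \<Longrightarrow> h \<in> carrier G \<Longrightarrow> shift g x h = x (inv g \<otimes> h)"
  by (simp add: bernoulli_action_def space_X)

lemma shift_mult_apply:
  assumes "x \<in> space X" "g \<in> carrier G" "j \<in> carrier G"
  shows "shift g x (g \<otimes> j) = x j"
  using assms by (simp add: shift_apply m_assoc[symmetric])

lemma shift_flip:
  assumes x: "x \<in> space X" and g: "g \<in> carrier G" and j: "j \<in> carrier G"
  shows "shift g (flip j x) = flip (g \<otimes> j) (shift g x)"
proof
  fix h
  show "shift g (flip j x) h = flip (g \<otimes> j) (shift g x) h"
  proof (cases "h \<in> carrier G")
    case True
    have "inv g \<otimes> h = j \<longleftrightarrow> h = g \<otimes> j"
      using True g j by (metis inv_solve_left')
    then show ?thesis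
      using True x g j flip_space[OF j x] by (auto simp: shift_apply flip_def)
  next
    case False
    moreover have "h \<noteq> g \<otimes> j" using False g j by auto
    ultimately show ?thesis
      using x flip_space[OF j x] by (simp add: bernoulli_action_def space_X flip_def)
  qed
qed

text \<open>Translation by \<open>g\<close> turns a flip at \<open>j\<close> into a flip at
  \<open>g \<otimes> j\<close>. Computing the density of the composite in the two orders gives the
  identity; both odds are taken at \<open>x j\<close> because this is also the value of
  \<open>shift g x\<close> at \<open>g \<otimes> j\<close>.\<close>

lemma deriv_flip_mult:
  assumes g: "g \<in> carrier G" and j: "j \<in> carrier G"
  shows "AE x in X. w g (flip j x) * ennreal (odds j (x j)) = w g x * ennreal (odds (g \<otimes> j) (x j))"
proof (rule AE_eq_of_nn_integral_indicator_eq)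
  have gj: "g \<otimes> j \<in> carrier G" "inv g \<in> carrier G" using g j by auto
  note [measurable] = flip_measurable[OF j] flip_measurable[OF gj(1)] act.act_measurable[OF g]
    act.act_measurable[OF gj(2)] act.deriv_measurable[OF g]
    coordinate_measurable[OF measurable_ident_sets[OF refl] j]
    coordinate_measurable[OF measurable_ident_sets[OF refl] gj(1)]
  show "(\<lambda>x. w g (flip j x) * ennreal (odds j (x j))) \<in> borel_measurable X"
    "(\<lambda>x. w g x * ennreal (odds (g \<otimes> j) (x j))) \<in> borel_measurable X"
    by measurable
  fix A assume [measurable]: "A \<in> sets X"
  let ?u = "indicator A :: _ \<Rightarrow> ennreal"
  have "(\<integral>\<^sup>+x. ?u x * (w g (flip j x) * ennreal (odds j (x j))) \<partial>X)
      = (\<integral>\<^sup>+x. (?u (flip j (flip j x)) * w g (flip j x)) * ennreal (odds j (x j)) \<partial>X)"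
    by (simp add: mult.assoc)
  also have "\<dots> = (\<integral>\<^sup>+x. ?u (flip j x) * w g x \<partial>X)"
    by (rule nn_integral_flip[OF j]) measurable
  also have "\<dots> = (\<integral>\<^sup>+z. ?u (flip j (shift (inv g) z)) \<partial>X)"
    by (rule act.nn_integral_deriv[OF g]) measurable
  also have "\<dots> = (\<integral>\<^sup>+z. ?u (shift (inv g) (flip (g \<otimes> j) z)) \<partial>X)"
  proof (rule nn_integral_cong)
    fix z assume z: "z \<in> space X"
    have "inv g \<otimes> (g \<otimes> j) = j" using g j by (simp add: m_assoc[symmetric])
    then show "?u (flip j (shift (inv g) z)) = ?u (shift (inv g) (flip (g \<otimes> j) z))"
      using shift_flip[OF z gj(2,1)] by simp
  qed
  also have "\<dots> = (\<integral>\<^sup>+z. ?u (shift (inv g) (flip (g \<otimes> j) (flip (g \<otimes> j) z)))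
      * ennreal (odds (g \<otimes> j) (z (g \<otimes> j))) \<partial>X)"
    by (rule nn_integral_flip[OF gj(1), symmetric]) measurable
  also have "\<dots> = (\<integral>\<^sup>+x. ?u (shift (inv g) (shift g x))
      * ennreal (odds (g \<otimes> j) (shift g x (g \<otimes> j))) * w g x \<partial>X)"
    by (subst act.nn_integral_act[OF g, symmetric]) auto
  also have "\<dots> = (\<integral>\<^sup>+x. ?u x * (w g x * ennreal (odds (g \<otimes> j) (x j))) \<partial>X)"
    using g j by (intro nn_integral_cong) (simp add: shift_mult_apply mult_ac)
  finally show "(\<integral>\<^sup>+x. ?u x * (w g (flip j x) * ennreal (odds j (x j))) \<partial>X)
      = (\<integral>\<^sup>+x. ?u x * (w g x * ennreal (odds (g \<otimes> j) (x j))) \<partial>X)" .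
qed

lemma deriv_flip:
  assumes g: "g \<in> carrier G" and j: "j \<in> carrier G"
  shows "AE x in X. w g (flip j x) = w g x * ennreal (odds (g \<otimes> j) (x j)) * ennreal (1 / odds j (x j))"
  using deriv_flip_mult[OF g j]
proof eventually_elim
  case (elim x)
  have "0 < odds j (x j)" by (rule odds_pos[OF j])
  then have "ennreal (odds j (x j)) * ennreal (1 / odds j (x j)) = 1"
    by (simp flip: ennreal_mult)
  then have "w g (flip j x) = w g (flip j x) * ennreal (odds j (x j)) * ennreal (1 / odds j (x j))"
    by (simp add: mult.assoc)
  then show ?case unfolding elim .
qed

text \<open>The element \<open>h'\<close> enters the correction only through the displacement
  \<open>inv h' \<otimes> h\<close>. The last factor depends on \<open>h\<close> alone and is the
  constant \<open>r\<close> allowed in \<open>deriv_tau\<close>.\<close>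

lemma deriv_shift_flip:
  assumes j: "j \<in> carrier G"
  shows "AE x in X. \<forall>h\<in>carrier G. \<forall>h'\<in>carrier G. w (inv h') (shift h (flip j x)) =
     w (inv h') (shift h x) * ennreal (odds (inv h' \<otimes> h \<otimes> j) (x j)) * ennreal (1 / odds (h \<otimes> j) (x j))"
  unfolding AE_ball_countable[OF countable_G]
proof (intro ballI)
  fix h h' assume h: "h \<in> carrier G" "h' \<in> carrier G"
  have hj: "h \<otimes> j \<in> carrier G" "inv h' \<in> carrier G" using h j by auto
  show "AE x in X. w (inv h') (shift h (flip j x)) =
     w (inv h') (shift h x) * ennreal (odds (inv h' \<otimes> h \<otimes> j) (x j)) * ennreal (1 / odds (h \<otimes> j) (x j))"
    using act.AE_act[OF h(1) deriv_flip[OF hj(2,1)]] AE_space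
    by eventually_elim (use h j in \<open>simp add: shift_flip shift_mult_apply m_assoc\<close>)
qed

text \<open>A change at \<open>j \<in> J\<close> is visible at \<open>l \<in> L\<close> after
  translation by \<open>k\<close> only if \<open>k = l \<otimes> inv j\<close>, which leaves
  finitely many \<open>k\<close>.\<close>

lemma eventually_agree:
  assumes J: "finite J" "J \<subseteq> carrier G" and L: "finite L" "L \<subseteq> carrier G"
  shows "\<exists>K. finite K \<and> K \<subseteq> carrier G \<and> (\<forall>k\<in>carrier G - K. \<forall>x\<in>space X. \<forall>x'\<in>space X.
     (\<forall>h\<in>carrier G - J. x h = x' h) \<longrightarrow> (\<forall>l\<in>L. shift k x l = shift k x' l))"
proof (intro exI[of _ "(\<lambda>(l, j). l \<otimes> inv j) ` (L \<times> J)"] conjI ballI impI)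
  show "finite ((\<lambda>(l, j). l \<otimes> inv j) ` (L \<times> J))" using J L by auto
  show "(\<lambda>(l, j). l \<otimes> inv j) ` (L \<times> J) \<subseteq> carrier G" using J L by auto
  fix k x x' l
  assume k: "k \<in> carrier G - (\<lambda>(l, j). l \<otimes> inv j) ` (L \<times> J)" and x: "x \<in> space X" "x' \<in> space X"
    and eq: "\<forall>h\<in>carrier G - J. x h = x' h" and l: "l \<in> L"
  have lc: "l \<in> carrier G" using l L by auto
  have "inv k \<otimes> l \<notin> J"
  proof
    assume *: "inv k \<otimes> l \<in> J"
    have "l \<otimes> inv (inv k \<otimes> l) = k"
      using k lc by (simp add: inv_mult_group m_assoc[symmetric])
    then have "k \<in> (\<lambda>(l, j). l \<otimes> inv j) ` (L \<times> J)"
      using * l by (intro image_eqI[of _ _ "(l, inv k \<otimes> l)"]) auto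
    then show False using k by simp
  qed
  then show "shift k x l = shift k x' l"
    using eq k lc x by (simp add: shift_apply)
qed

text \<open>As \<open>\<tau>\<close> alters only the finitely many coordinates in \<open>J\<close>,
  an approximating cylinder set distinguishes \<open>shift k x\<close> from
  \<open>shift k (\<tau> x)\<close> for finitely many \<open>k\<close> only. Fubini turns invariance
  on the product into invariance of almost all sections.\<close>

lemma diagonal_invariant_under_tau:
  fixes N :: "'y measure"
  assumes pert: "perturbation G X shift w \<tau> X0 c t \<kappa> Bad"
    and J: "finite J" "J \<subseteq> carrier G" "\<And>x h. h \<in> carrier G - J \<Longrightarrow> \<tau> x h = x h"
    and collision: "\<And>e::real. (0::real) < e \<Longrightarrow> \<exists>\<eta>. (\<integral>\<^sup>+h. \<eta> h \<partial>count_space (carrier G)) = 1 \<and>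
        (\<forall>h. \<eta> h < \<infinity>) \<and> act.collision \<eta> < ennreal e"
    and N: "prob_space N" "pmp_action G N \<psi>"
    and A: "A \<in> sets (X \<Otimes>\<^sub>M N)"
      "\<And>g z. g \<in> carrier G \<Longrightarrow> z \<in> space (X \<Otimes>\<^sub>M N) \<Longrightarrow> diagonal_action X shift N \<psi> g z \<in> A \<longleftrightarrow> z \<in> A"
  shows "AE y in N. AE x in X. x \<in> X0 \<longrightarrow> (\<tau> x \<in> {x\<in>space X. (x, y) \<in> A} \<longleftrightarrow> x \<in> {x\<in>space X. (x, y) \<in> A})"
proof -
  interpret N: prob_space N by fact
  interpret P: pair_prob_space X N ..
  interpret T: perturbation G X shift w \<tau> X0 c t \<kappa> Bad by fact
  interpret D: perturbation G "X \<Otimes>\<^sub>M N" "diagonal_action X shift N \<psi>" "\<lambda>g z. w g (fst z)"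
     "\<lambda>z. (\<tau> (fst z), snd z)" "X0 \<times> space N" c t \<kappa> Bad
    by (rule act.perturbation_diagonal[OF N pert])
  note [measurable] = T.tau_measurable T.X0_sets A(1)
  have coll: "\<exists>\<eta>. (\<integral>\<^sup>+h. \<eta> h \<partial>count_space (carrier G)) = 1 \<and>
        (\<forall>h. \<eta> h < \<infinity>) \<and> D.collision \<eta> < ennreal e" if "0 < e" for e :: real
    using collision[OF that] act.collision_diagonal[OF N] by simp
  have approx: "\<exists>H K. H \<in> sets (X \<Otimes>\<^sub>M N) \<and> emeasure (X \<Otimes>\<^sub>M N) ((A - H) \<union> (H - A)) < ennreal e \<and>
        finite K \<and> K \<subseteq> carrier G \<and> (\<forall>k\<in>carrier G - K. \<forall>z\<in>X0 \<times> space N.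
            diagonal_action X shift N \<psi> k z \<in> H \<longleftrightarrow> diagonal_action X shift N \<psi> k (\<tau> (fst z), snd z) \<in> H)"
    if e: "0 < e" for e :: real
  proof -
    obtain H L where H: "H \<in> sets (X \<Otimes>\<^sub>M N)" and L: "finite L" "L \<subseteq> carrier G"
      and dep: "\<forall>x\<in>space X. \<forall>x'\<in>space X. \<forall>y. (\<forall>l\<in>L. x l = x' l) \<longrightarrow> ((x, y) \<in> H \<longleftrightarrow> (x', y) \<in> H)"
      and less: "measure (X \<Otimes>\<^sub>M N) ((A - H) \<union> (H - A)) < e"
      using cylinder_approximation_pair[OF N(1) A(1) e] by blast
    obtain K where K: "finite K" "K \<subseteq> carrier G" "\<forall>k\<in>carrier G - K. \<forall>x\<in>space X. \<forall>x'\<in>space X.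
     (\<forall>h\<in>carrier G - J. x h = x' h) \<longrightarrow> (\<forall>l\<in>L. shift k x l = shift k x' l)"
      using eventually_agree[OF J(1,2) L] by blast
    have "diagonal_action X shift N \<psi> k z \<in> H \<longleftrightarrow> diagonal_action X shift N \<psi> k (\<tau> (fst z), snd z) \<in> H"
      if k: "k \<in> carrier G - K" and z: "z \<in> X0 \<times> space N" for k z
    proof -
      have x: "fst z \<in> space X" using z sets.sets_into_space[OF T.X0_sets] by auto
      note tx = T.tau_space[OF x]
      have zz: "z \<in> space (X \<Otimes>\<^sub>M N)" "(\<tau> (fst z), snd z) \<in> space (X \<Otimes>\<^sub>M N)"
        using z x tx by (auto simp: space_pair_measure)
      have "\<forall>l\<in>L. shift k (fst z) l = shift k (\<tau> (fst z)) l"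
        by (intro ballI, rule K(3)[rule_format, OF k x tx]) (use J(3) in auto)
      then have "(shift k (fst z), \<psi> k (snd z)) \<in> H \<longleftrightarrow> (shift k (\<tau> (fst z)), \<psi> k (snd z)) \<in> H"
        using dep[rule_format, of "shift k (fst z)" "shift k (\<tau> (fst z))" "\<psi> k (snd z)"]
          act.act_space[of k] k x tx by blast
      then show ?thesis using zz by (simp add: diagonal_action_def)
    qed
    then show ?thesis
      using H K less e by (intro exI[of _ H] exI[of _ K]) (auto simp: P.emeasure_eq_measure ennreal_lessI)
  qed
  have "AE z in X \<Otimes>\<^sub>M N. z \<in> X0 \<times> space N \<longrightarrow> (z \<in> A \<longleftrightarrow> (\<tau> (fst z), snd z) \<in> A)"
    by (rule D.invariant_under_tau[OF coll A approx])
  then have "AE z in X \<Otimes>\<^sub>M N. fst z \<in> X0 \<longrightarrow> (z \<in> A \<longleftrightarrow> (\<tau> (fst z), snd z) \<in> A)"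
    using AE_space by eventually_elim (auto simp: space_pair_measure)
  then have "AE x in X. AE y in N. x \<in> X0 \<longrightarrow> ((x, y) \<in> A \<longleftrightarrow> (\<tau> x, y) \<in> A)"
    by (rule P.AE_pair[of "\<lambda>z. fst z \<in> X0 \<longrightarrow> (z \<in> A \<longleftrightarrow> (\<tau> (fst z), snd z) \<in> A)", unfolded fst_conv snd_conv])
  then have "AE y in N. AE x in X. x \<in> X0 \<longrightarrow> ((x, y) \<in> A \<longleftrightarrow> (\<tau> x, y) \<in> A)"
    by (subst (asm) P.AE_commute) measurable
  with AE_space show ?thesis
  proof eventually_elim
    case (elim y)
    from elim(2) AE_space show ?case by eventually_elim (auto dest: T.tau_space)
  qed
qed

end

section \<open>Abelian groups\<close>

lemma ennreal_inverse_antimono: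
  fixes a b :: ennreal
  assumes "a \<le> b"
  shows "inverse b \<le> inverse a"
proof (cases "a = 0 \<or> b = \<infinity>")
  case False
  then obtain r s where rs: "a = ennreal r" "b = ennreal s" "0 < r" "0 \<le> s"
    using assms by (cases a; cases b) (auto simp: top_unique less_le)
  then have "r \<le> s" using assms by simp
  then show ?thesis using rs by (simp add: inverse_ennreal ennreal_leI le_imp_inverse_le)
qed auto

lemma nn_integral_count_space_subset_mono:
  fixes f :: "'a \<Rightarrow> ennreal"
  assumes "A \<subseteq> B"
  shows "(\<integral>\<^sup>+x. f x \<partial>count_space A) \<le> (\<integral>\<^sup>+x. f x \<partial>count_space B)"
proof -
  have "(\<integral>\<^sup>+x. f x \<partial>count_space A) = (\<integral>\<^sup>+x. f x * indicator A x \<partial>count_space A)"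
    by (intro nn_integral_cong) simp
  also have "\<dots> = (\<integral>\<^sup>+x. f x * indicator A x \<partial>count_space B)"
    using assms by (intro nn_integral_count_space_eq) auto
  also have "\<dots> \<le> (\<integral>\<^sup>+x. f x \<partial>count_space B)"
    by (intro nn_integral_mono) (auto simp: indicator_def)
  finally show ?thesis .
qed

text \<open>Reiter's condition for amenability, established one element at a time. Averaging over
  translates by the powers of a new element \<open>k\<close> makes the weights almost invariant
  under \<open>k\<close>, as the difference telescopes. It does not spoil the invariance under
  earlier elements, as translations commute.\<close>

lemma (in comm_group) almost_invariant_weights:
  assumes "finite K" "K \<subseteq> carrier G" and d: "0 < (d::real)"
  shows "\<exists>\<eta>::'a \<Rightarrow> real. (\<forall>g. 0 \<le> \<eta> g) \<and> (\<integral>\<^sup>+g. ennreal (\<eta> g) \<partial>count_space (carrier G)) = 1 \<and>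
     (\<forall>k\<in>K. (\<integral>\<^sup>+g. ennreal \<bar>\<eta> g - \<eta> (g \<otimes> inv k)\<bar> \<partial>count_space (carrier G)) \<le> ennreal d)"
  using assms(1,2)
proof induction
  case empty
  show ?case
    by (intro exI[of _ "indicator {\<one>}"]) (auto simp: ennreal_indicator)
next
  case (insert k K)
  let ?N = "count_space (carrier G)"
  have k: "k \<in> carrier G" using insert by auto
  obtain \<eta> :: "'a \<Rightarrow> real" where eta: "\<And>g. 0 \<le> \<eta> g" "(\<integral>\<^sup>+g. ennreal (\<eta> g) \<partial>?N) = 1"
    "\<And>k. k \<in> K \<Longrightarrow> (\<integral>\<^sup>+g. ennreal \<bar>\<eta> g - \<eta> (g \<otimes> inv k)\<bar> \<partial>?N) \<le> ennreal d"
    using insert.IH insert.prems by auto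
  \<comment> \<open>Telescoping leaves two end terms, each of total mass \<open>1 / n\<close>, so
    \<open>2 / n \<le> d\<close> is required.\<close>
  obtain n :: nat where n: "0 < n" "2 / d < n"
    using reals_Archimedean2[of "2 / d"] d by (metis divide_pos_pos less_trans of_nat_0_less_iff zero_less_numeral)
  define \<eta>' where "\<eta>' g = (\<Sum>a<n. \<eta> (g \<otimes> inv (k [^] a))) / n" for g
  have reindex: "(\<integral>\<^sup>+g. f (g \<otimes> h) \<partial>?N) = (\<integral>\<^sup>+g. f g \<partial>?N)" if "h \<in> carrier G" for f :: "'a \<Rightarrow> ennreal" and h
  proof (rule nn_integral_bij_count_space)
    show "bij_betw (\<lambda>g. g \<otimes> h) (carrier G) (carrier G)"
      by (rule bij_betw_byWitness[where f'="\<lambda>g. g \<otimes> inv h"]) (use that in \<open>auto simp: m_assoc\<close>)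
  qed
  have avg: "(\<integral>\<^sup>+g. ennreal ((\<Sum>a<n. f (g \<otimes> inv (k [^] a))) / n) \<partial>?N) = (\<integral>\<^sup>+g. ennreal (f g) \<partial>?N)"
    if f: "\<And>g. 0 \<le> f g" for f :: "'a \<Rightarrow> real"
  proof -
    have "(\<integral>\<^sup>+g. ennreal ((\<Sum>a<n. f (g \<otimes> inv (k [^] a))) / n) \<partial>?N)
        = (\<integral>\<^sup>+g. ennreal (1 / n) * (\<Sum>a<n. ennreal (f (g \<otimes> inv (k [^] a)))) \<partial>?N)"
      using f by (intro nn_integral_cong) (simp add: sum_ennreal ennreal_mult'[symmetric] sum_nonneg)
    also have "\<dots> = ennreal (1 / n) * (\<Sum>a<n. \<integral>\<^sup>+g. ennreal (f (g \<otimes> inv (k [^] a))) \<partial>?N)"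
      by (subst nn_integral_cmult) (auto simp: nn_integral_sum)
    also have "\<dots> = ennreal (1 / n) * (\<Sum>a<n. \<integral>\<^sup>+g. ennreal (f g) \<partial>?N)"
      using k by (intro arg_cong2[where f="(*)"] sum.cong refl reindex[of _ "\<lambda>g. ennreal (f g)"]) auto
    also have "\<dots> = (ennreal (1 / n) * ennreal n) * (\<integral>\<^sup>+g. ennreal (f g) \<partial>?N)"
      by (simp add: mult.assoc ennreal_of_nat_eq_real_of_nat)
    also have "ennreal (1 / n) * ennreal n = 1"
      using n by (simp flip: ennreal_mult)
    finally show ?thesis by simp
  qed
  show ?case
  proof (intro exI[of _ \<eta>'] conjI ballI allI)
    show "0 \<le> \<eta>' g" for g unfolding \<eta>'_def using eta(1) by (intro divide_nonneg_nonneg sum_nonneg) auto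
    show "(\<integral>\<^sup>+g. ennreal (\<eta>' g) \<partial>?N) = 1"
      unfolding \<eta>'_def using avg[of \<eta>] eta by simp
    fix k' assume "k' \<in> insert k K"
    then consider "k' = k" | "k' \<in> K" "k' \<in> carrier G" using insert.prems by auto
    then show "(\<integral>\<^sup>+g. ennreal \<bar>\<eta>' g - \<eta>' (g \<otimes> inv k')\<bar> \<partial>?N) \<le> ennreal d"
    proof cases
      case 1
      have le: "\<bar>\<eta>' g - \<eta>' (g \<otimes> inv k)\<bar> \<le> \<eta> g / n + \<eta> (g \<otimes> inv (k [^] n)) / n" if g: "g \<in> carrier G" for g
      proof -
        have "\<eta>' (g \<otimes> inv k) = (\<Sum>a<n. \<eta> (g \<otimes> inv (k [^] Suc a))) / n"
          unfolding \<eta>'_def using g k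
          by (intro arg_cong2[where f="(/)"] sum.cong refl arg_cong[where f=\<eta>])
             (simp add: m_assoc inv_mult_group)
        then have "\<eta>' g - \<eta>' (g \<otimes> inv k) = (\<Sum>a<n. \<eta> (g \<otimes> inv (k [^] a)) - \<eta> (g \<otimes> inv (k [^] Suc a))) / n"
          by (simp add: \<eta>'_def sum_subtractf diff_divide_distrib)
        also have "\<dots> = (\<eta> (g \<otimes> inv (k [^] (0::nat))) - \<eta> (g \<otimes> inv (k [^] n))) / n"
          by (subst sum_lessThan_telescope') simp
        also have "\<dots> = (\<eta> g - \<eta> (g \<otimes> inv (k [^] n))) / n" using g by simp
        finally have "\<bar>\<eta>' g - \<eta>' (g \<otimes> inv k)\<bar> = \<bar>\<eta> g - \<eta> (g \<otimes> inv (k [^] n))\<bar> / n"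
          by simp
        also have "\<dots> \<le> (\<eta> g + \<eta> (g \<otimes> inv (k [^] n))) / n"
          using eta(1)[of g] eta(1)[of "g \<otimes> inv (k [^] n)"] by (intro divide_right_mono) auto
        finally show ?thesis by (simp add: add_divide_distrib)
      qed
      have "(\<integral>\<^sup>+g. ennreal \<bar>\<eta>' g - \<eta>' (g \<otimes> inv k)\<bar> \<partial>?N)
          \<le> (\<integral>\<^sup>+g. ennreal (1 / n) * ennreal (\<eta> g) + ennreal (1 / n) * ennreal (\<eta> (g \<otimes> inv (k [^] n))) \<partial>?N)"
        using le eta(1)
        by (intro nn_integral_mono) (simp add: ennreal_mult'[symmetric] ennreal_plus[symmetric] ennreal_leI del: ennreal_plus)
      also have "\<dots> = ennreal (1 / n) + ennreal (1 / n)"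
        using k reindex[of "inv (k [^] n)" "\<lambda>g. ennreal (\<eta> g)"]
        by (simp add: nn_integral_add nn_integral_cmult eta)
      also have "\<dots> \<le> ennreal d"
        using n d by (simp add: ennreal_plus[symmetric] field_simps del: ennreal_plus)
      finally show ?thesis using 1 by simp
    next
      case 2
      have le: "\<bar>\<eta>' g - \<eta>' (g \<otimes> inv k')\<bar> \<le> (\<Sum>a<n. \<bar>\<eta> (g \<otimes> inv (k [^] a)) - \<eta> (g \<otimes> inv (k [^] a) \<otimes> inv k')\<bar>) / n"
        if g: "g \<in> carrier G" for g
      proof -
        \<comment> \<open>Commutativity: the translation by \<open>k'\<close> is moved past the
          powers of \<open>k\<close>.\<close>
        have "\<eta>' (g \<otimes> inv k') = (\<Sum>a<n. \<eta> (g \<otimes> inv (k [^] a) \<otimes> inv k')) / n"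
          unfolding \<eta>'_def using g k 2
          by (intro arg_cong2[where f="(/)"] sum.cong refl arg_cong[where f=\<eta>]) (simp add: m_ac)
        then have "\<eta>' g - \<eta>' (g \<otimes> inv k') = (\<Sum>a<n. \<eta> (g \<otimes> inv (k [^] a)) - \<eta> (g \<otimes> inv (k [^] a) \<otimes> inv k')) / n"
          by (simp add: \<eta>'_def sum_subtractf diff_divide_distrib)
        then show ?thesis by (simp add: divide_right_mono sum_abs)
      qed
      have "(\<integral>\<^sup>+g. ennreal \<bar>\<eta>' g - \<eta>' (g \<otimes> inv k')\<bar> \<partial>?N)
         \<le> (\<integral>\<^sup>+g. ennreal ((\<Sum>a<n. \<bar>\<eta> (g \<otimes> inv (k [^] a)) - \<eta> (g \<otimes> inv (k [^] a) \<otimes> inv k')\<bar>) / n) \<partial>?N)"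
        using le by (intro nn_integral_mono ennreal_leI) auto
      also have "\<dots> = (\<integral>\<^sup>+g. ennreal \<bar>\<eta> g - \<eta> (g \<otimes> inv k')\<bar> \<partial>?N)"
        by (rule avg[of "\<lambda>g. \<bar>\<eta> g - \<eta> (g \<otimes> inv k')\<bar>"]) simp
      also have "\<dots> \<le> ennreal d" by (rule eta(3)[OF 2(1)])
      finally show ?thesis .
    qed
  qed
qed

section \<open>Conservativity and small collision probabilities\<close>

context quasi_invariant_action
begin

text \<open>The partial sums increase to \<open>\<infinity>\<close>, so their inverses tend to 0.
  Keeping \<open>\<one>\<close> in every finite set, where the derivative is 1, bounds the inverses
  by 1 and permits dominated convergence.\<close>

lemma inverse_partial_sums_small:
  assumes inf: "infinite (carrier G)" and cons: "AE x in M. (\<integral>\<^sup>+k. w k x \<partial>count_space (carrier G)) = \<infinity>" and e: "0 < (e::real)"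
  shows "\<exists>K. finite K \<and> K \<subseteq> carrier G \<and> \<one> \<in> K \<and> (\<integral>\<^sup>+x. inverse (\<Sum>k\<in>K. w k x) \<partial>M) < ennreal e"
proof -
  define en where "en = from_nat_into (carrier G)"
  have bij: "bij_betw en UNIV (carrier G)"
    unfolding en_def by (rule bij_betw_from_nat_into[OF countable_carrier inf])
  then have en: "en n \<in> carrier G" for n by (auto simp: bij_betw_def)
  define K where "K n = insert \<one> (en ` {..<n})" for n
  have K: "finite (K n)" "K n \<subseteq> carrier G" "\<one> \<in> K n" for n using en by (auto simp: K_def)
  have m: "(\<lambda>x. inverse (\<Sum>k\<in>K n. w k x)) \<in> borel_measurable M" for n
    using K(2) deriv_measurable
    by (intro measurable_compose[OF _ borel_measurable_inverse_ennreal] borel_measurable_sum) auto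
  have "(\<lambda>n. \<integral>\<^sup>+x. inverse (\<Sum>k\<in>K n. w k x) \<partial>M) \<longlonglongrightarrow> (\<integral>\<^sup>+x. 0 \<partial>M)"
  proof (rule nn_integral_dominated_convergence[where w="\<lambda>_. 1"])
    show "AE x in M. inverse (\<Sum>k\<in>K n. w k x) \<le> 1" for n
      using deriv_one
    proof eventually_elim
      case (elim x)
      have "w \<one> x \<le> (\<Sum>k\<in>K n. w k x)" using K by (intro member_le_sum) auto
      then have "inverse (\<Sum>k\<in>K n. w k x) \<le> inverse 1"
        unfolding elim by (rule ennreal_inverse_antimono)
      then show ?case by simp
    qed
    show "AE x in M. (\<lambda>n. inverse (\<Sum>k\<in>K n. w k x)) \<longlonglongrightarrow> 0"
      using cons
    proof eventually_elim
      case (elim x)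
      have "(\<integral>\<^sup>+k. w k x \<partial>count_space (carrier G)) = (\<Sum>n. w (en n) x)"
        by (simp add: nn_integral_bij_count_space[OF bij, symmetric] nn_integral_count_space_nat)
      then have lim: "(\<lambda>n. \<Sum>i<n. w (en i) x) \<longlonglongrightarrow> \<infinity>"
        using summable_LIMSEQ[of "\<lambda>i. w (en i) x"] elim by (simp add: summableI)
      have le: "(\<Sum>i<n. w (en i) x) \<le> (\<Sum>k\<in>K n. w k x)" for n
      proof -
        have "(\<Sum>i<n. w (en i) x) = (\<Sum>k\<in>en ` {..<n}. w k x)"
          using bij by (subst sum.reindex) (auto simp: bij_betw_def intro: inj_on_subset)
        also have "\<dots> \<le> (\<Sum>k\<in>K n. w k x)" by (rule sum_mono2) (auto simp: K_def)
        finally show ?thesis .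
      qed
      have "(\<lambda>n. \<Sum>k\<in>K n. w k x) \<longlonglongrightarrow> \<infinity>"
        by (rule tendsto_sandwich[OF _ _ lim tendsto_const]) (simp_all add: le)
      then have "(\<lambda>n. inverse (\<Sum>k\<in>K n. w k x)) \<longlonglongrightarrow> inverse \<infinity>"
        by (intro continuous_on_tendsto_compose[of UNIV "inverse :: ennreal \<Rightarrow> ennreal"]
            continuous_on_inverse_ennreal continuous_on_id) auto
      then show ?case by simp
    qed
  qed (use m in \<open>auto simp: emeasure_space_1\<close>)
  then have "(\<lambda>n. \<integral>\<^sup>+x. inverse (\<Sum>k\<in>K n. w k x) \<partial>M) \<longlonglongrightarrow> 0" by simp
  then have "\<forall>\<^sub>F n in sequentially. (\<integral>\<^sup>+x. inverse (\<Sum>k\<in>K n. w k x) \<partial>M) < ennreal e"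
    using e by (intro order_tendstoD(2)) auto
  then obtain n where "(\<integral>\<^sup>+x. inverse (\<Sum>k\<in>K n. w k x) \<partial>M) < ennreal e"
    by (auto dest: eventually_happens)
  then show ?thesis by (intro exI[of _ "K n"] conjI K)
qed

text \<open>For almost invariant weights the terms with \<open>k \<in> K\<close> alone already make the inner integral small,
  except for \<open>g\<close> in a set of small weight, where the term \<open>k = \<one>\<close> bounds it by \<open>1\<close>.\<close>

lemma conservative_imp_collision_small:
  assumes comm: "comm_group G" and inf: "infinite (carrier G)"
    and cons: "AE x in M. (\<integral>\<^sup>+k. w k x \<partial>count_space (carrier G)) = \<infinity>" and e: "0 < (e::real)"
  shows "\<exists>\<eta>. (\<integral>\<^sup>+h. \<eta> h \<partial>count_space (carrier G)) = 1 \<and> (\<forall>h. \<eta> h < \<infinity>) \<and> collision \<eta> < ennreal e"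
proof -
  interpret comm_group G by fact
  let ?N = "count_space (carrier G)"
  have e4: "0 < e / 4" using e by simp
  obtain K where K: "finite K" "K \<subseteq> carrier G" "\<one> \<in> K" "(\<integral>\<^sup>+x. inverse (\<Sum>k\<in>K. w k x) \<partial>M) < ennreal (e / 4)"
    using inverse_partial_sums_small[OF inf cons e4] by blast
  \<comment> \<open>The exceptional \<open>g\<close> will contribute at most
    \<open>2 * card K * d\<close>, which is \<open>e / 4\<close>, and the others less than
    \<open>2 * (e / 4)\<close>.\<close>
  define d where "d = e / (8 * card K)"
  have cK: "0 < card K" using K by (auto simp: card_gt_0_iff)
  have d: "0 < d" using e cK by (simp add: d_def)
  obtain \<eta> :: "'g \<Rightarrow> real" where eta: "\<And>g. 0 \<le> \<eta> g" "(\<integral>\<^sup>+g. ennreal (\<eta> g) \<partial>?N) = 1"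
    "\<And>k. k \<in> K \<Longrightarrow> (\<integral>\<^sup>+g. ennreal \<bar>\<eta> g - \<eta> (g \<otimes> inv k)\<bar> \<partial>?N) \<le> ennreal d"
    using almost_invariant_weights[OF K(1,2) d] by auto
  let ?I = "\<lambda>g. \<integral>\<^sup>+x. inverse (\<integral>\<^sup>+k. ennreal (\<eta> (g \<otimes> inv k)) * w k x \<partial>?N) \<partial>M"
  let ?J = "\<integral>\<^sup>+x. inverse (\<Sum>k\<in>K. w k x) \<partial>M"
  have Km: "(\<lambda>x. inverse (\<Sum>k\<in>K. w k x)) \<in> borel_measurable M"
    using K(2) deriv_measurable
    by (intro measurable_compose[OF _ borel_measurable_inverse_ennreal] borel_measurable_sum) auto
  have bound: "(ennreal (\<eta> g))\<^sup>2 * ?I g \<le> 2 * ennreal (\<eta> g) * ?J + 2 * (\<Sum>k\<in>K. ennreal \<bar>\<eta> g - \<eta> (g \<otimes> inv k)\<bar>)"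
    if g: "g \<in> carrier G" for g
  proof (cases "\<eta> g = 0")
    case False
    then have pos: "0 < \<eta> g" using eta(1)[of g] by simp
    show ?thesis
    \<comment> \<open>If some \<open>k \<in> K\<close> violates this, \<open>\<eta> g\<close> is
      less than twice the difference of \<open>\<eta> g\<close> and
      \<open>\<eta> (g \<otimes> inv k)\<close>. So the exceptional \<open>g\<close> have total
      weight at most twice the sum of the invariance defects over \<open>K\<close>.\<close>
    proof (cases "\<forall>k\<in>K. \<eta> g \<le> 2 * \<eta> (g \<otimes> inv k)")
      case True
      have "?I g \<le> (\<integral>\<^sup>+x. ennreal (2 / \<eta> g) * inverse (\<Sum>k\<in>K. w k x) \<partial>M)"
      proof (rule nn_integral_mono)
        fix x
        have "ennreal (\<eta> g / 2) * (\<Sum>k\<in>K. w k x) = (\<Sum>k\<in>K. ennreal (\<eta> g / 2) * w k x)"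
          by (rule sum_distrib_left)
        also have "\<dots> \<le> (\<Sum>k\<in>K. ennreal (\<eta> (g \<otimes> inv k)) * w k x)"
          using True by (intro sum_mono mult_right_mono ennreal_leI) auto
        also have "\<dots> = (\<integral>\<^sup>+k. ennreal (\<eta> (g \<otimes> inv k)) * w k x \<partial>count_space K)"
          using K by (simp add: nn_integral_count_space_finite)
        also have "\<dots> \<le> (\<integral>\<^sup>+k. ennreal (\<eta> (g \<otimes> inv k)) * w k x \<partial>?N)"
          by (rule nn_integral_count_space_subset_mono[OF K(2)])
        finally have "inverse (\<integral>\<^sup>+k. ennreal (\<eta> (g \<otimes> inv k)) * w k x \<partial>?N) \<le> inverse (ennreal (\<eta> g / 2) * (\<Sum>k\<in>K. w k x))"
          by (rule ennreal_inverse_antimono)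
        also have "\<dots> = inverse (ennreal (\<eta> g / 2)) * inverse (\<Sum>k\<in>K. w k x)"
          using pos by (intro ennreal_inverse_mult') auto
        also have "inverse (ennreal (\<eta> g / 2)) = ennreal (2 / \<eta> g)"
          using pos by (simp add: inverse_ennreal field_simps)
        finally show "inverse (\<integral>\<^sup>+k. ennreal (\<eta> (g \<otimes> inv k)) * w k x \<partial>?N) \<le> ennreal (2 / \<eta> g) * inverse (\<Sum>k\<in>K. w k x)" .
      qed
      also have "\<dots> = ennreal (2 / \<eta> g) * ?J" by (rule nn_integral_cmult[OF Km])
      finally have "(ennreal (\<eta> g))\<^sup>2 * ?I g \<le> (ennreal (\<eta> g))\<^sup>2 * (ennreal (2 / \<eta> g) * ?J)"
        by (rule mult_left_mono) simp
      also have "\<dots> = ennreal ((\<eta> g)\<^sup>2 * (2 / \<eta> g)) * ?J"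
        by (subst ennreal_mult) (use pos in \<open>simp_all add: mult.assoc ennreal_power\<close>)
      also have "(\<eta> g)\<^sup>2 * (2 / \<eta> g) = 2 * \<eta> g" using pos by (simp add: power2_eq_square)
      also have "ennreal (2 * \<eta> g) = 2 * ennreal (\<eta> g)" using pos by (simp add: ennreal_mult)
      finally show ?thesis by (rule order_trans) simp
    next
      case False
      then obtain k where k: "k \<in> K" "2 * \<eta> (g \<otimes> inv k) < \<eta> g" by auto
      have "?I g \<le> (\<integral>\<^sup>+x. ennreal (1 / \<eta> g) \<partial>M)"
      proof (rule nn_integral_mono_AE)
        show "AE x in M. inverse (\<integral>\<^sup>+k. ennreal (\<eta> (g \<otimes> inv k)) * w k x \<partial>?N) \<le> ennreal (1 / \<eta> g)"
          using deriv_one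
        proof eventually_elim
          case (elim x)
          have "ennreal (\<eta> g) = ennreal (\<eta> (g \<otimes> inv \<one>)) * w \<one> x" using g elim by simp
          also have "\<dots> \<le> (\<integral>\<^sup>+k. ennreal (\<eta> (g \<otimes> inv k)) * w k x \<partial>?N)"
            by (rule nn_integral_ge_point) simp
          finally have "inverse (\<integral>\<^sup>+k. ennreal (\<eta> (g \<otimes> inv k)) * w k x \<partial>?N) \<le> inverse (ennreal (\<eta> g))"
            by (rule ennreal_inverse_antimono)
          then show ?case using pos by (simp add: inverse_ennreal divide_inverse)
        qed
      qed
      also have "\<dots> = ennreal (1 / \<eta> g)" by (simp add: emeasure_space_1)
      finally have "(ennreal (\<eta> g))\<^sup>2 * ?I g \<le> (ennreal (\<eta> g))\<^sup>2 * ennreal (1 / \<eta> g)"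
        by (rule mult_left_mono) simp
      also have "\<dots> = ennreal (\<eta> g)"
        using pos by (simp add: ennreal_power ennreal_mult[symmetric] power2_eq_square)
      also have "\<dots> \<le> 2 * ennreal \<bar>\<eta> g - \<eta> (g \<otimes> inv k)\<bar>"
      proof -
        have "ennreal (\<eta> g) \<le> ennreal (2 * \<bar>\<eta> g - \<eta> (g \<otimes> inv k)\<bar>)"
        proof (rule ennreal_leI)
          have "\<eta> g \<le> 2 * (\<eta> g - \<eta> (g \<otimes> inv k))" using k(2) by simp
          also have "\<dots> \<le> 2 * \<bar>\<eta> g - \<eta> (g \<otimes> inv k)\<bar>" by (intro mult_left_mono abs_ge_self) simp
          finally show "\<eta> g \<le> 2 * \<bar>\<eta> g - \<eta> (g \<otimes> inv k)\<bar>" .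
        qed
        then show ?thesis by (simp add: ennreal_mult)
      qed
      also have "\<dots> \<le> 2 * (\<Sum>k\<in>K. ennreal \<bar>\<eta> g - \<eta> (g \<otimes> inv k)\<bar>)"
        using k K by (intro mult_left_mono member_le_sum) auto
      finally show ?thesis by (rule order_trans) simp
    qed
  qed simp
  have "collision (\<lambda>g. ennreal (\<eta> g)) = (\<integral>\<^sup>+g. (ennreal (\<eta> g))\<^sup>2 * ?I g \<partial>?N)"
    by (rule collision_eq[OF eta(2)])
  also have "\<dots> \<le> (\<integral>\<^sup>+g. 2 * ennreal (\<eta> g) * ?J + 2 * (\<Sum>k\<in>K. ennreal \<bar>\<eta> g - \<eta> (g \<otimes> inv k)\<bar>) \<partial>?N)"
    by (intro nn_integral_mono bound) simp
  also have "\<dots> = 2 * ?J + 2 * (\<Sum>k\<in>K. \<integral>\<^sup>+g. ennreal \<bar>\<eta> g - \<eta> (g \<otimes> inv k)\<bar> \<partial>?N)"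
    by (simp add: nn_integral_add nn_integral_multc nn_integral_cmult nn_integral_sum eta del: sum_ennreal)
  also have "\<dots> \<le> 2 * ?J + 2 * (\<Sum>k\<in>K. ennreal d)"
    by (intro add_left_mono mult_left_mono sum_mono eta(3)) auto
  also have "(\<Sum>k\<in>K. ennreal d) = ennreal (e / 8)"
    using cK d by (simp add: d_def ennreal_of_nat_eq_real_of_nat ennreal_mult'[symmetric])
  also have "2 * ?J + 2 * ennreal (e / 8) < ennreal e"
  proof -
    obtain r where r: "?J = ennreal r" "0 \<le> r" using K(4) by (cases ?J) auto
    then have r4: "r < e / 4" using K(4) e by (simp add: ennreal_less_iff)
    have two: "(2::ennreal) = ennreal 2" by simp
    have eq: "2 * ?J + 2 * ennreal (e / 8) = ennreal (2 * r + 2 * (e / 8))"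
      unfolding two r(1) using r(2) e
      by (simp add: ennreal_mult'[symmetric] ennreal_plus[symmetric] del: ennreal_plus ennreal_numeral)
    show ?thesis
      unfolding eq using r4 r(2) e by (intro ennreal_lessI) auto
  qed
  finally show ?thesis using eta by (intro exI[of _ "\<lambda>g. ennreal (\<eta> g)"]) auto
qed

end

section \<open>Strongly conservative actions with marginals away from 0 and 1\<close>

context nonsingular_bernoulli
begin

lemma strongly_conservative_imp_collision_small:
  assumes sc: "strongly_conservative G X shift" and e: "0 < (e::real)"
  shows "\<exists>\<eta>. (\<integral>\<^sup>+h. \<eta> h \<partial>count_space (carrier G)) = 1 \<and> (\<forall>h. \<eta> h < \<infinity>) \<and> act.collision \<eta> < ennreal e"
proof -
  obtain q :: "nat \<Rightarrow> 'g pmf" where q: "\<And>n. set_pmf (q n) \<subseteq> carrier G"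
    and lim: "(\<lambda>n. \<integral>\<^sup>+g. ennreal ((pmf (q n) g)\<^sup>2) *
                (\<integral>\<^sup>+x. inverse (\<integral>\<^sup>+k. ennreal (pmf (q n) (g \<otimes> inv k)) * w k x
                                  \<partial>count_space (carrier G)) \<partial>X)
              \<partial>count_space (carrier G)) \<longlonglongrightarrow> 0"
    using sc unfolding strongly_conservative_def by blast
  have total: "(\<integral>\<^sup>+h. ennreal (pmf (q n) h) \<partial>count_space (carrier G)) = 1" for n
  proof -
    have "(\<integral>\<^sup>+h. ennreal (pmf (q n) h) \<partial>count_space (carrier G)) = emeasure (measure_pmf (q n)) (carrier G)"
      by (rule nn_integral_pmf)
    also have "\<dots> = 1"
      using q[of n] by (subst measure_pmf.emeasure_eq_1_AE) (auto intro!: AE_pmfI)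
    finally show ?thesis .
  qed
  have "(\<lambda>n. act.collision (\<lambda>h. ennreal (pmf (q n) h))) \<longlonglongrightarrow> 0"
    using lim by (simp add: act.collision_eq[OF total] ennreal_power)
  then have "\<forall>\<^sub>F n in sequentially. act.collision (\<lambda>h. ennreal (pmf (q n) h)) < ennreal e"
    using e by (intro order_tendstoD(2)) auto
  then obtain n where "act.collision (\<lambda>h. ennreal (pmf (q n) h)) < ennreal e"
    by (auto dest: eventually_happens)
  then show ?thesis using total[of n] by (intro exI[of _ "\<lambda>h. ennreal (pmf (q n) h)"]) auto
qed

lemma weakly_mixing_if_sections_trivial:
  assumes "\<And>(N :: 'y measure) \<psi> A. prob_space N \<Longrightarrow> pmp_action G N \<psi> \<Longrightarrow> A \<in> sets (X \<Otimes>\<^sub>M N) \<Longrightarrow>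
      (\<And>g z. g \<in> carrier G \<Longrightarrow> z \<in> space (X \<Otimes>\<^sub>M N) \<Longrightarrow> diagonal_action X shift N \<psi> g z \<in> A \<longleftrightarrow> z \<in> A) \<Longrightarrow>
      AE y in N. measure X {x\<in>space X. (x, y) \<in> A} = 0 \<or> measure X {x\<in>space X. (x, y) \<in> A} = 1"
  shows "weakly_mixing TYPE('y) G X shift"
  unfolding weakly_mixing_def
proof (intro allI impI)
  fix N :: "'y measure" and \<psi>
  assume "standard_prob_space N \<and> pmp_action G N \<psi> \<and> ergodic_action G N \<psi>"
  then have N: "prob_space N" "pmp_action G N \<psi>" "ergodic_action G N \<psi>"
    by (auto simp: standard_prob_space_def)
  show "ergodic_action G (X \<Otimes>\<^sub>M N) (diagonal_action X shift N \<psi>)"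
    by (rule act.ergodic_diagonal_action[OF N assms[OF N(1,2)]])
qed

lemma section_sets:
  fixes N :: "'y measure"
  assumes A: "A \<in> sets (X \<Otimes>\<^sub>M N)" and y: "y \<in> space N"
  shows "{x\<in>space X. (x, y) \<in> A} \<in> sets X"
proof -
  have "{x\<in>space X. (x, y) \<in> A} = (\<lambda>x. (x, y)) -` A"
    using sets.sets_into_space[OF A] by (auto simp: space_pair_measure)
  then show ?thesis using sets_Pair2[OF A, of y] by simp
qed

text \<open>All \<open>odds\<close> lie between \<open>d\<close> and \<open>1 / d\<close>, so no
  displacement is bad. The value \<open>b\<close> at \<open>j\<close> is fixed on the domain because
  the density factor of a perturbation is a function of \<open>k\<close> alone.\<close>

lemma perturbation_flip:
  assumes d: "0 < d" "\<And>g. g \<in> carrier G \<Longrightarrow> p g False \<in> {d..1 - d}" and j: "j \<in> carrier G"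
  shows "perturbation G X shift w (flip j) {x\<in>space X. x j = b} (ennreal (odds j (\<not> b)))
           (\<lambda>k. odds (k \<otimes> j) b) (1 / d) {}"
proof unfold_locales
  have bd: "d \<le> p g c \<and> p g c \<le> 1" if "g \<in> carrier G" for g c
    using d(2)[OF that] p_not[of g False] pmf_le_1[of "\<mu> g" c] by (cases c) auto
  have d1: "d \<le> 1" using bd[OF j, of True] by linarith
  show "flip j \<in> measurable X X" by (rule flip_measurable[OF j])
  show "{x\<in>space X. x j = b} \<in> sets X" using coordinate_sets[OF j, of "{b}"] by simp
  show "ennreal (odds j (\<not> b)) < \<infinity>" by simp
  show "1 \<le> 1 / d" using d1 d by simp
  show "(\<integral>\<^sup>+x. indicator {x\<in>space X. x j = b} x * u (flip j x) \<partial>X) \<le> ennreal (odds j (\<not> b)) * (\<integral>\<^sup>+x. u x \<partial>X)"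
    if "u \<in> borel_measurable X" for u
  proof -
    have "(\<integral>\<^sup>+x. indicator {x\<in>space X. x j = b} x * u (flip j x) \<partial>X) = (\<integral>\<^sup>+x. of_bool (x j = b) * u (flip j x) \<partial>X)"
      by (intro nn_integral_cong) (auto simp: indicator_def)
    with nn_integral_flip_le[OF j that, of b] show ?thesis by simp
  qed
  show "1 / (1 / d) \<le> odds (k \<otimes> j) b \<and> odds (k \<otimes> j) b \<le> 1 / d" if "k \<in> carrier G - {}" for k
  proof -
    have kj: "k \<otimes> j \<in> carrier G" using that j by simp
    have "d * p (k \<otimes> j) b \<le> p (k \<otimes> j) (\<not> b) * 1" 
      using bd[OF kj] d by (intro order_trans[OF mult_left_le]) auto
    moreover have "p (k \<otimes> j) (\<not> b) * d \<le> 1 * p (k \<otimes> j) b"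
      using bd[OF kj] d by (intro mult_mono) auto
    ultimately show ?thesis
      using p_pos[OF kj, of b] d by (simp add: odds_def field_simps)
  qed
  show "AE x in X. x \<in> {x\<in>space X. x j = b} \<longrightarrow> (\<forall>h\<in>carrier G. \<exists>r. 0 < r \<and> r < \<infinity> \<and>
         (\<forall>h'\<in>carrier G. w (inv h') (shift h (flip j x)) =
             w (inv h') (shift h x) * ennreal (odds (inv h' \<otimes> h \<otimes> j) b) * r))"
    using deriv_shift_flip[OF j]
  proof eventually_elim
    case (elim x)
    have "0 < ennreal (1 / odds (h \<otimes> j) b)" if "h \<in> carrier G" for h
      using odds_pos[of "h \<otimes> j" b] that j by simp
    then show ?case using elim by (intro impI ballI exI[of _ "ennreal (1 / odds (_ \<otimes> j) b)"]) auto
  qed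
  show "\<exists>K' \<Phi>. finite K' \<and> K' \<subseteq> carrier G \<and> \<Phi> \<in> sets X \<and> emeasure X \<Phi> < ennreal e \<and>
       (\<forall>k\<in>{} \<inter> carrier G - K'. \<forall>x\<in>{x\<in>space X. x j = b}. shift k x \<in> \<Phi> \<and> shift k (flip j x) \<in> \<Phi>)"
    if "0 < e" for e :: real
    using that by (intro exI[of _ "{}"]) auto
qed

lemma strongly_conservative_imp_weakly_mixing:
  assumes sc: "strongly_conservative G X shift"
    and d: "0 < d" "\<And>g. g \<in> carrier G \<Longrightarrow> p g False \<in> {d..1 - d}"
  shows "weakly_mixing TYPE('y) G X shift"
proof (rule weakly_mixing_if_sections_trivial)
  fix N :: "'y measure" and \<psi> A
  assume N: "prob_space N" "pmp_action G N \<psi>" and A: "A \<in> sets (X \<Otimes>\<^sub>M N)"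
    "\<And>g z. g \<in> carrier G \<Longrightarrow> z \<in> space (X \<Otimes>\<^sub>M N) \<Longrightarrow> diagonal_action X shift N \<psi> g z \<in> A \<longleftrightarrow> z \<in> A"
  let ?A = "\<lambda>y. {x\<in>space X. (x, y) \<in> A}"
  have "AE y in N. AE x in X. x \<in> {x\<in>space X. x j = b} \<longrightarrow> (flip j x \<in> ?A y \<longleftrightarrow> x \<in> ?A y)"
    if j: "j \<in> carrier G" for j b
  proof -
    have pf: "perturbation G X shift w (flip j) {x\<in>space X. x j = b} (ennreal (odds j (\<not> b)))
           (\<lambda>k. odds (k \<otimes> j) b) (1 / d) {}"
      using d j by (rule perturbation_flip)
    show ?thesis
      by (rule diagonal_invariant_under_tau[where J="{j}", OF pf _ _ _
            strongly_conservative_imp_collision_small[OF sc] N A]) (use j in auto)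
  qed
  \<comment> \<open>There are countably many coordinates and two values, so one null set of
    \<open>y\<close> serves all flips.\<close>
  then have "AE y in N. \<forall>b. \<forall>j\<in>carrier G. AE x in X. x \<in> {x\<in>space X. x j = b} \<longrightarrow> (flip j x \<in> ?A y \<longleftrightarrow> x \<in> ?A y)"
    unfolding AE_all_countable AE_ball_countable[OF countable_G] by blast
  with AE_space show "AE y in N. measure X (?A y) = 0 \<or> measure X (?A y) = 1"
  proof eventually_elim
    case (elim y)
    have "AE x in X. flip j x \<in> ?A y \<longleftrightarrow> x \<in> ?A y" if j: "j \<in> carrier G" for j
      using elim(2)[THEN spec, of True, THEN bspec, OF j] elim(2)[THEN spec, of False, THEN bspec, OF j] AE_space
      by eventually_elim auto
    then show ?case by (intro flip_zero_one section_sets[OF A(1) elim(1)])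
  qed
qed

end

lemma min_one_le_geometric:
  fixes v :: ennreal
  assumes s: "0 < (s::real)"
  shows "2 * min v 1 \<le> v * ennreal (1 / s) + ennreal s"
proof (cases v)
  case (real r)
  have "2 * min r 1 \<le> r * (1 / s) + s"
  proof (cases "r \<le> 1")
    case True
    have "2 * r * s \<le> r\<^sup>2 + s\<^sup>2" by (rule sum_squares_bound)
    also have "r\<^sup>2 \<le> r" using True real by (simp add: power2_eq_square mult_left_le)
    finally show ?thesis using s True by (simp add: field_simps power2_eq_square)
  next
    case False
    have "2 * 1 * s \<le> 1\<^sup>2 + s\<^sup>2" by (rule sum_squares_bound)
    then show ?thesis using s False by (simp add: field_simps power2_eq_square)
  qed
  then have "ennreal (2 * min r 1) \<le> ennreal (r * (1 / s) + s)" by (rule ennreal_leI)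
  moreover have "ennreal (2 * min r 1) = 2 * min v 1"
  proof -
    have "ennreal (2 * min r 1) = ennreal 2 * ennreal (min r 1)" using real by (intro ennreal_mult) auto
    also have "ennreal (min r 1) = min v 1" using real by (simp add: min_def)
    finally show ?thesis by simp
  qed
  moreover have "ennreal (r * (1 / s) + s) = v * ennreal (1 / s) + ennreal s"
    using real s by (simp add: ennreal_mult[symmetric] ennreal_plus[symmetric] del: ennreal_plus)
  ultimately show ?thesis by simp
next
  case top
  then show ?thesis using s by (simp add: ennreal_top_mult)
qed

lemma sqrt_quotient: "0 \<le> a \<Longrightarrow> a * (sqrt b / sqrt a) = sqrt a * sqrt b"
  by (metis real_div_sqrt times_divide_eq_left times_divide_eq_right)

text \<open>The first half of the Borel-Cantelli lemma: bounded finite sums make the measures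
  summable, and a tail of the sum bounds the measure of the corresponding union.\<close>

lemma (in finite_measure) tail_union_small:
  assumes B: "countable B" and E: "\<And>k. k \<in> B \<Longrightarrow> E k \<in> sets M"
    and bounded: "\<And>F. finite F \<Longrightarrow> F \<subseteq> B \<Longrightarrow> (\<Sum>k\<in>F. measure M (E k)) \<le> C" and e: "0 < (e::real)"
  shows "\<exists>K. finite K \<and> K \<subseteq> B \<and> (\<Union>k\<in>B - K. E k) \<in> sets M \<and> measure M (\<Union>k\<in>B - K. E k) < e"
proof (cases "finite B")
  case True
  then show ?thesis using e by (intro exI[of _ B]) auto
next
  case False
  define en where "en = from_nat_into B"
  have bij: "bij_betw en UNIV B"
    unfolding en_def by (rule bij_betw_from_nat_into[OF B False])
  have en: "en n \<in> B" for n using bij by (auto simp: bij_betw_def)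
  have inj: "inj en" using bij by (simp add: bij_betw_def)
  have sm: "summable (\<lambda>n. measure M (E (en n)))"
  proof (rule summableI_nonneg_bounded)
    fix n
    have "(\<Sum>i<n. measure M (E (en i))) = (\<Sum>k\<in>en ` {..<n}. measure M (E k))"
      using inj by (subst sum.reindex) (auto intro: inj_on_subset)
    also have "\<dots> \<le> C" using en by (intro bounded) auto
    finally show "(\<Sum>i<n. measure M (E (en i))) \<le> C" .
  qed simp
  obtain N where N: "norm (\<Sum>i. measure M (E (en (i + N)))) < e"
    using suminf_exist_split[OF e sm] by blast
  let ?K = "en ` {..<N}"
  have eq: "(\<Union>k\<in>B - ?K. E k) = (\<Union>i. E (en (i + N)))"
  proof (intro equalityI subsetI)
    fix x assume "x \<in> (\<Union>k\<in>B - ?K. E k)"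
    then obtain n where n: "en n \<notin> ?K" "x \<in> E (en n)" using bij by (auto simp: bij_betw_def)
    then have "N \<le> n" by (metis imageI lessThan_iff not_le)
    then show "x \<in> (\<Union>i. E (en (i + N)))" using n by (intro UN_I[of "n - N"]) auto
  next
    fix x assume "x \<in> (\<Union>i. E (en (i + N)))"
    then obtain i where i: "x \<in> E (en (i + N))" by auto
    have "en (i + N) \<notin> ?K" using inj by (auto simp: inj_eq)
    then show "x \<in> (\<Union>k\<in>B - ?K. E k)" using i en by blast
  qed
  have "measure M (\<Union>i. E (en (i + N))) \<le> (\<Sum>i. measure M (E (en (i + N))))"
    using E en sm by (intro finite_measure_subadditive_countably) (auto intro: summable_ignore_initial_segment)
  then have "measure M (\<Union>k\<in>B - ?K. E k) < e" unfolding eq using N by simp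
  moreover have "(\<Union>k\<in>B - ?K. E k) \<in> sets M" unfolding eq using E en by auto
  ultimately show ?thesis using en by (intro exI[of _ ?K]) auto
qed

section \<open>Hellinger distances and Kakutani's criterion\<close>

context bernoulli
begin

lemma nn_integral_prod_coordinates:
  assumes F: "finite F" "F \<subseteq> carrier G" and f: "\<And>h b. 0 \<le> (f h b :: real)"
  shows "(\<integral>\<^sup>+x. ennreal (\<Prod>h\<in>F. f h (x h)) \<partial>X) = ennreal (\<Prod>h\<in>F. \<Sum>b\<in>UNIV. p h b * f h b)"
  using F
proof induction
  case empty
  then show ?case by (simp add: emeasure_space_1)
next
  case (insert i F)
  define R where "R = PiM (carrier G - {i}) (\<lambda>g. measure_pmf (\<mu> g))"
  have i: "i \<in> carrier G" using insert by simp
  have mF: "(\<lambda>x. ennreal (\<Prod>h\<in>J. f h (x h))) \<in> borel_measurable X" if "J \<subseteq> carrier G" for J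
    using that by (intro measurable_compose[OF _ measurable_ennreal] borel_measurable_prod
        measurable_compose[OF coordinate_measurable[OF measurable_ident_sets[OF refl]]]) auto
  have upd: "(\<Prod>h\<in>F. f h ((x(i := b)) h)) = (\<Prod>h\<in>F. f h (x h))" for x b
    using insert by (intro prod.cong) auto
  have upd': "(\<Prod>h\<in>insert i F. f h ((x(i := b)) h)) = f i b * (\<Prod>h\<in>F. f h (x h))" for x b
    using insert.hyps by (simp add: upd fun_upd_same del: fun_upd_apply)
  let ?I = "\<integral>\<^sup>+x. ennreal (\<Prod>h\<in>F. f h (x h)) \<partial>R"
  have mR: "(\<lambda>x. ennreal (\<Prod>h\<in>F. f h (x h))) \<in> borel_measurable R"
    unfolding R_def using insert
    by (intro measurable_compose[OF _ measurable_ennreal] borel_measurable_prod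
        measurable_compose[OF measurable_component_singleton]) auto
  have pb: "0 \<le> (\<Prod>h\<in>F. f h (x h))" for x by (intro prod_nonneg f) 
  have "(\<integral>\<^sup>+x. ennreal (\<Prod>h\<in>F. f h (x h)) \<partial>X) = (ennreal (p i True) + ennreal (p i False)) * ?I"
    using insert by (subst nn_integral_coordinate[OF i mF]) (simp_all only: upd R_def distrib_right insert_subset)
  also have "ennreal (p i True) + ennreal (p i False) = 1"
    using p_sum[of i True] by (simp add: ennreal_plus[symmetric] del: ennreal_plus)
  finally have I: "?I = ennreal (\<Prod>h\<in>F. \<Sum>b\<in>UNIV. p h b * f h b)"
    using insert by simp
  have "(\<integral>\<^sup>+x. ennreal (\<Prod>h\<in>insert i F. f h (x h)) \<partial>X)
      = ennreal (p i True) * (\<integral>\<^sup>+x. ennreal (f i True) * ennreal (\<Prod>h\<in>F. f h (x h)) \<partial>R)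
      + ennreal (p i False) * (\<integral>\<^sup>+x. ennreal (f i False) * ennreal (\<Prod>h\<in>F. f h (x h)) \<partial>R)"
    using insert.prems
    by (subst nn_integral_coordinate[OF i mF]) (simp_all only: upd' R_def ennreal_mult'[OF f])
  also have "\<dots> = (ennreal (p i True * f i True) + ennreal (p i False * f i False)) * ?I"
    using f by (simp add: nn_integral_cmult[OF mR] ennreal_mult' distrib_right mult.assoc)
  also have "\<dots> = ennreal (\<Sum>b\<in>UNIV. p i b * f i b) * ?I"
    using f by (simp add: UNIV_bool add.commute)
  also have "\<dots> = ennreal (\<Prod>h\<in>insert i F. \<Sum>b\<in>UNIV. p h b * f h b)"
    unfolding I using insert f by (simp add: ennreal_mult' sum_nonneg)
  finally show ?case .
qed

definition hellinger :: "'g \<Rightarrow> 'g \<Rightarrow> real" where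
  "hellinger g h = (\<Sum>b\<in>UNIV. (sqrt (p g b) - sqrt (p h b))\<^sup>2)"

lemma hellinger_eq: "(\<Sum>b\<in>UNIV. sqrt (p g b) * sqrt (p h b)) = 1 - hellinger g h / 2"
proof -
  have "hellinger g h = (\<Sum>b\<in>UNIV. p g b + p h b - 2 * (sqrt (p g b) * sqrt (p h b)))"
    unfolding hellinger_def by (intro sum.cong refl) (simp add: power2_diff)
  also have "\<dots> = 2 - 2 * (\<Sum>b\<in>UNIV. sqrt (p g b) * sqrt (p h b))"
    using p_sum[of g True] p_sum[of h True] by (simp add: UNIV_bool algebra_simps)
  finally show ?thesis by linarith
qed

text \<open>Cauchy-Schwarz for the difference of the square roots of \<open>p g b * p h (\<not> b)\<close> and
  \<open>p g (\<not> b) * p h b\<close>. If these differ by a factor of at least \<open>4\<close>, their sum is controlled.\<close>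

lemma unbalanced_le_hellinger:
  assumes far: "4 * (p g (\<not> b) * p h b) \<le> p g b * p h (\<not> b)"
  shows "p g b * p h (\<not> b) + p g (\<not> b) * p h b \<le> 5 * hellinger g h"
proof -
  define u where "u = sqrt (p g b) * sqrt (p h (\<not> b))"
  define v where "v = sqrt (p g (\<not> b)) * sqrt (p h b)"
  have u2: "u\<^sup>2 = p g b * p h (\<not> b)" and v2: "v\<^sup>2 = p g (\<not> b) * p h b"
    by (simp_all add: u_def v_def power_mult_distrib)
  have nn: "0 \<le> u" "0 \<le> v" by (simp_all add: u_def v_def)
  \<comment> \<open>The constant \<open>5\<close> is \<open>4 + 1\<close>: from
    \<open>2 * v \<le> u\<close> follow both \<open>u \<le> 2 * (u - v)\<close> and
    \<open>v \<le> u - v\<close>.\<close>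
  have "(2 * v)\<^sup>2 \<le> u\<^sup>2" using far u2 v2 by (simp add: power_mult_distrib)
  then have "2 * v \<le> u" using nn(1) by (rule power2_le_imp_le)
  then have "(u / 2)\<^sup>2 \<le> (u - v)\<^sup>2" using nn by (intro power_mono) auto
  then have 1: "u\<^sup>2 \<le> 4 * (u - v)\<^sup>2" by (simp add: power_divide)
  have 2: "v\<^sup>2 \<le> (u - v)\<^sup>2" using nn \<open>2 * v \<le> u\<close> by (intro power_mono) auto
  let ?A = "sqrt (p g b)" and ?B = "sqrt (p g (\<not> b))"
  let ?S = "sqrt (p h (\<not> b)) - sqrt (p g (\<not> b))" and ?T = "sqrt (p g b) - sqrt (p h b)"
  \<comment> \<open>Lagrange's identity is Cauchy-Schwarz with its defect. The vector
    \<open>(?A, ?B)\<close> has length 1, and \<open>u - v\<close> is its inner product with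
    \<open>(?S, ?T)\<close>, whose squared length is \<open>hellinger g h\<close>.\<close>
  have lagrange: "(x * y + z * t)\<^sup>2 + (x * t - z * y)\<^sup>2 = (x\<^sup>2 + z\<^sup>2) * (y\<^sup>2 + t\<^sup>2)" for x y z t :: real
    by (simp add: power2_eq_square algebra_simps)
  have uv: "u - v = ?A * ?S + ?B * ?T" by (simp add: u_def v_def algebra_simps)
  have "(?A * ?S + ?B * ?T)\<^sup>2 + (?A * ?T - ?B * ?S)\<^sup>2 = (?A\<^sup>2 + ?B\<^sup>2) * (?S\<^sup>2 + ?T\<^sup>2)"
    by (rule lagrange)
  also have "?A\<^sup>2 + ?B\<^sup>2 = 1" using p_sum[of g b] by simp
  finally have eq: "(?A * ?S + ?B * ?T)\<^sup>2 + (?A * ?T - ?B * ?S)\<^sup>2 = 1 * (?S\<^sup>2 + ?T\<^sup>2)" .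
  have drop: "a \<le> s" if "a + d = 1 * s" "0 \<le> d" for a d s :: real
    using that by simp
  have "(u - v)\<^sup>2 \<le> ?S\<^sup>2 + ?T\<^sup>2" unfolding uv by (rule drop[OF eq zero_le_power2])
  also have "\<dots> = hellinger g h"
    unfolding hellinger_def by (cases b) (simp_all add: UNIV_bool power2_commute)
  finally show ?thesis using 1 2 unfolding u2[symmetric] v2[symmetric] by linarith
qed

end

context nonsingular_bernoulli
begin

text \<open>The necessity half of Kakutani's criterion. On the coordinates in \<open>F\<close> the translated measure has
  density \<open>s\<^sup>2\<close>, and \<open>min v 1 \<le> sqrt v \<le> (v / s + s) / 2\<close> for the derivative \<open>v\<close>, so the
  positive number \<open>c\<close> is at most the product over \<open>F\<close> of the affinities.\<close>

lemma hellinger_bounded: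
  assumes g: "g \<in> carrier G"
  shows "\<exists>C. \<forall>F. finite F \<and> F \<subseteq> carrier G \<longrightarrow> (\<Sum>h\<in>F. hellinger h (g \<otimes> h)) \<le> C"
proof -
  note wm[measurable] = act.deriv_measurable[OF g]
  \<comment> \<open>The mass common to the measure and its translate. Nonsingularity enters through
    its positivity, which follows from the derivative being positive almost everywhere.\<close>
  define I where "I = (\<integral>\<^sup>+x. min (w g x) 1 \<partial>X)"
  have "I \<le> (\<integral>\<^sup>+x. 1 \<partial>X)" unfolding I_def by (intro nn_integral_mono) simp
  then have "I \<le> 1" by (simp add: emeasure_space_1)
  then obtain c where c: "I = ennreal c" "0 \<le> c" by (cases I) (auto simp: top_unique)
  have "I \<noteq> 0"
  proof
    assume "I = 0"
    then have "AE x in X. min (w g x) 1 = 0"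
      unfolding I_def by (subst (asm) nn_integral_0_iff_AE) auto
    with act.deriv_pos[OF g] have "AE x in X. False"
      by eventually_elim (auto simp: min_def split: if_splits)
    then show False by simp
  qed
  then have cpos: "0 < c" using c by (auto simp: less_le)
  have "(\<Sum>h\<in>F. hellinger h (g \<otimes> h)) \<le> - 2 * ln c" if F: "finite F" "F \<subseteq> carrier G" for F
  proof -
    define r where "r h b = sqrt (p (g \<otimes> h) b) / sqrt (p h b)" for h b
    have gF: "g \<otimes> h \<in> carrier G" if "h \<in> F" for h using that F g by auto
    have rpos: "0 < r h b" if "h \<in> F" for h b
      using that F p_pos[OF gF[OF that], of b] p_pos[of h b] by (auto simp: r_def)
    define s where "s x = (\<Prod>h\<in>F. r h (x h))" for x
    have spos: "0 < s x" for x unfolding s_def using rpos by (intro prod_pos) auto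
    have sm[measurable]: "s \<in> borel_measurable X"
      unfolding s_def using F by (intro borel_measurable_prod
        measurable_compose[OF coordinate_measurable[OF measurable_ident_sets[OF refl]]]) auto
    let ?a = "\<lambda>h. 1 - hellinger h (g \<otimes> h) / 2"
    have r_nn: "0 \<le> r h b" for h b by (simp add: r_def)
    have sr: "p h b * r h b = sqrt (p h b) * sqrt (p (g \<otimes> h) b)" if "h \<in> F" for h b
      using sqrt_quotient[of "p h b" "p (g \<otimes> h) b"] by (simp add: r_def)
    have sr': "p (g \<otimes> h) b * (1 / r h b) = sqrt (p h b) * sqrt (p (g \<otimes> h) b)" if "h \<in> F" for h b
      using sqrt_quotient[of "p (g \<otimes> h) b" "p h b"] by (simp add: r_def mult.commute)
    have 1: "(\<integral>\<^sup>+x. ennreal (s x) \<partial>X) = ennreal (\<Prod>h\<in>F. ?a h)"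
    proof -
      have "(\<integral>\<^sup>+x. ennreal (s x) \<partial>X) = ennreal (\<Prod>h\<in>F. \<Sum>b\<in>UNIV. p h b * r h b)"
        unfolding s_def by (rule nn_integral_prod_coordinates[OF F r_nn])
      also have "(\<Prod>h\<in>F. \<Sum>b\<in>UNIV. p h b * r h b) = (\<Prod>h\<in>F. ?a h)"
        by (intro prod.cong refl) (simp add: sr hellinger_eq)
      finally show ?thesis .
    qed
    \<comment> \<open>The factor \<open>w g x\<close> moves the integration to the translated
      measure, where the coordinate \<open>h\<close> has the marginal of
      \<open>g \<otimes> h\<close>. There \<open>1 / s\<close> has the same product of affinities as
      its mean as \<open>s\<close> has in \<open>1\<close>.\<close>
    have 2: "(\<integral>\<^sup>+x. w g x * ennreal (1 / s x) \<partial>X) = ennreal (\<Prod>h\<in>F. ?a h)"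
    proof -
      let ?F = "(\<lambda>h. g \<otimes> h) ` F"
      let ?f = "\<lambda>k b. 1 / r (inv g \<otimes> k) b"
      have ig: "inv g \<otimes> (g \<otimes> h) = h" if "h \<in> F" for h
      proof -
        have "h \<in> carrier G" using that F by auto
        then show ?thesis using g by (simp add: m_assoc[symmetric])
      qed
      have inj: "inj_on (\<lambda>h. g \<otimes> h) F" by (rule inj_on_inverseI[of _ "\<lambda>k. inv g \<otimes> k"]) (rule ig)
      have "(\<integral>\<^sup>+x. w g x * ennreal (1 / s x) \<partial>X) = (\<integral>\<^sup>+x. ennreal (1 / s x) * w g x \<partial>X)"
        by (simp add: mult.commute)
      also have "\<dots> = (\<integral>\<^sup>+z. ennreal (1 / s (shift (inv g) z)) \<partial>X)"
        by (rule act.nn_integral_deriv[OF g]) measurable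
      also have "\<dots> = (\<integral>\<^sup>+z. ennreal (\<Prod>k\<in>?F. ?f k (z k)) \<partial>X)"
      proof (rule nn_integral_cong)
        fix z assume z: "z \<in> space X"
        have "s (shift (inv g) z) = (\<Prod>h\<in>F. r h (z (g \<otimes> h)))"
          unfolding s_def using F g z
          by (intro prod.cong refl arg_cong2[where f=r]) (simp add: shift_apply subsetD)
        then have "1 / s (shift (inv g) z) = (\<Prod>h\<in>F. 1 / r h (z (g \<otimes> h)))"
          by (simp add: prod_dividef)
        also have "\<dots> = (\<Prod>k\<in>?F. ?f k (z k))"
          by (simp add: prod.reindex[OF inj] ig)
        finally show "ennreal (1 / s (shift (inv g) z)) = ennreal (\<Prod>k\<in>?F. ?f k (z k))" by simp
      qed
      also have "\<dots> = ennreal (\<Prod>k\<in>?F. \<Sum>b\<in>UNIV. p k b * ?f k b)"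
        using F g r_nn by (intro nn_integral_prod_coordinates) auto
      also have "(\<Prod>k\<in>?F. \<Sum>b\<in>UNIV. p k b * ?f k b) = (\<Prod>h\<in>F. \<Sum>b\<in>UNIV. p (g \<otimes> h) b * (1 / r h b))"
        by (simp add: prod.reindex[OF inj] ig)
      also have "\<dots> = (\<Prod>h\<in>F. ?a h)"
        by (intro prod.cong refl) (simp only: sr' hellinger_eq)
      finally show ?thesis .
    qed
    have a0: "0 \<le> ?a h" for h
      unfolding hellinger_eq[symmetric] by (intro sum_nonneg) auto
    have "2 * I = (\<integral>\<^sup>+x. 2 * min (w g x) 1 \<partial>X)"
      unfolding I_def by (rule nn_integral_cmult[symmetric]) measurable
    also have "\<dots> \<le> (\<integral>\<^sup>+x. w g x * ennreal (1 / s x) + ennreal (s x) \<partial>X)"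
      using spos by (intro nn_integral_mono min_one_le_geometric)
    also have "\<dots> = ennreal (\<Prod>h\<in>F. ?a h) + ennreal (\<Prod>h\<in>F. ?a h)"
      by (subst nn_integral_add) (auto simp: 1 2)
    also have "\<dots> = ennreal (2 * (\<Prod>h\<in>F. ?a h))"
      using a0 by (simp add: ennreal_plus[symmetric] prod_nonneg del: ennreal_plus)
    finally have "ennreal (2 * c) \<le> ennreal (2 * (\<Prod>h\<in>F. ?a h))"
      using c by (simp add: ennreal_mult)
    then have "c \<le> (\<Prod>h\<in>F. ?a h)" using a0 by (simp add: prod_nonneg)
    \<comment> \<open>The inequality \<open>1 - a / 2 \<le> exp (- a / 2)\<close> turns the product
      into the exponential of a sum; this is the origin of the bound
      \<open>- 2 * ln c\<close>.\<close>
    also have "\<dots> \<le> (\<Prod>h\<in>F. exp (- hellinger h (g \<otimes> h) / 2))"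
    proof (rule prod_mono, intro conjI a0)
      fix h show "?a h \<le> exp (- hellinger h (g \<otimes> h) / 2)"
        using exp_ge_add_one_self[of "- hellinger h (g \<otimes> h) / 2"] by simp
    qed
    also have "\<dots> = exp (- (\<Sum>h\<in>F. hellinger h (g \<otimes> h)) / 2)"
      using F by (simp add: exp_sum[symmetric] sum_negf sum_divide_distrib)
    finally have "ln c \<le> - (\<Sum>h\<in>F. hellinger h (g \<otimes> h)) / 2"
      using cpos by (metis exp_le_cancel_iff exp_ln)
    then show ?thesis by simp
  qed
  then show ?thesis by (intro exI[of _ "- 2 * ln c"]) auto
qed

end

lemma nn_integral_count_space_le_if_finite_sums_le:
  assumes B: "countable B" and le: "\<And>F. finite F \<Longrightarrow> F \<subseteq> B \<Longrightarrow> (\<Sum>k\<in>F. f k) \<le> (C::ennreal)"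
  shows "(\<integral>\<^sup>+k. f k \<partial>count_space B) \<le> C"
proof (cases "finite B")
  case True
  then show ?thesis using le[of B] by (simp add: nn_integral_count_space_finite)
next
  case False
  define en where "en = from_nat_into B"
  have bij: "bij_betw en UNIV B"
    unfolding en_def by (rule bij_betw_from_nat_into[OF B False])
  have "(\<integral>\<^sup>+k. f k \<partial>count_space B) = (\<integral>\<^sup>+n. f (en n) \<partial>count_space UNIV)"
    by (rule nn_integral_bij_count_space[OF bij, symmetric])
  also have "\<dots> = (\<Sum>n. f (en n))" by (rule nn_integral_count_space_nat)
  also have "\<dots> \<le> C"
    unfolding suminf_eq_SUP
  proof (rule SUP_least)
    fix n
    have "(\<Sum>i<n. f (en i)) = (\<Sum>k\<in>en ` {..<n}. f k)"
      using bij by (subst sum.reindex) (auto simp: bij_betw_def intro: inj_on_subset)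
    also have "\<dots> \<le> C" using bij by (intro le) (auto simp: bij_betw_def)
    finally show "(\<Sum>i<n. f (en i)) \<le> C" .
  qed
  finally show ?thesis .
qed

text \<open>For \<open>h = \<one>\<close>, \<open>deriv_tau\<close> says that the derivatives at
  \<open>\<tau> x\<close> are those at \<open>x\<close> multiplied by \<open>t k\<close> and by a
  constant. Off \<open>Bad\<close> the factor is at least \<open>1 / \<kappa>\<close>, and
  \<open>Bad\<close> contributes a finite amount at \<open>x\<close>, so divergence carries
  over.\<close>

lemma (in perturbation) conservative_under_tau:
  assumes fin: "AE x in M. x \<in> X0 \<longrightarrow> (\<integral>\<^sup>+k. w k x \<partial>count_space (Bad \<inter> carrier G)) < \<infinity>"
  shows "AE x in M. x \<in> X0 \<longrightarrow> (\<integral>\<^sup>+k. w k x \<partial>count_space (carrier G)) = \<infinity> \<longrightarrow>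
     (\<integral>\<^sup>+k. w k (\<tau> x) \<partial>count_space (carrier G)) = \<infinity>"
  using fin deriv_tau AE_space
proof eventually_elim
  case (elim x)
  show ?case
  proof (intro impI)
    assume x: "x \<in> X0" and inf: "(\<integral>\<^sup>+k. w k x \<partial>count_space (carrier G)) = \<infinity>"
    obtain r where r: "0 < r" "r < \<infinity>" "\<And>h'. h' \<in> carrier G \<Longrightarrow>
        w (inv h') (\<phi> \<one> (\<tau> x)) = w (inv h') (\<phi> \<one> x) * ennreal (t (inv h' \<otimes> \<one>)) * r"
      using elim(2) x by blast
    have eq: "w k (\<tau> x) = w k x * ennreal (t k) * r" if "k \<in> carrier G" for k
      using r(3)[of "inv k"] that elim(3) tau_space[OF elim(3)] by (simp add: act_one)
    let ?N = "count_space (carrier G)"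
    let ?good = "\<integral>\<^sup>+k. w k x * indicator (carrier G - Bad) k \<partial>?N"
    have "(\<integral>\<^sup>+k. w k x \<partial>?N) = (\<integral>\<^sup>+k. w k x * indicator (Bad \<inter> carrier G) k + w k x * indicator (carrier G - Bad) k \<partial>?N)"
      by (intro nn_integral_cong) (auto simp: indicator_def)
    also have "\<dots> = (\<integral>\<^sup>+k. w k x * indicator (Bad \<inter> carrier G) k \<partial>?N) + ?good"
      by (rule nn_integral_add) auto
    also have "(\<integral>\<^sup>+k. w k x * indicator (Bad \<inter> carrier G) k \<partial>?N) = (\<integral>\<^sup>+k. w k x * indicator (Bad \<inter> carrier G) k \<partial>count_space (Bad \<inter> carrier G))"
      by (rule nn_integral_count_space_eq) auto
    also have "\<dots> = (\<integral>\<^sup>+k. w k x \<partial>count_space (Bad \<inter> carrier G))"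
      by (intro nn_integral_cong) simp
    finally have "(\<integral>\<^sup>+k. w k x \<partial>count_space (Bad \<inter> carrier G)) + ?good = \<infinity>" using inf by simp
    moreover have "(\<integral>\<^sup>+k. w k x \<partial>count_space (Bad \<inter> carrier G)) \<noteq> \<infinity>" using elim(1) x by auto
    ultimately have good: "?good = \<infinity>" by (simp add: ennreal_add_eq_top)
    have "\<infinity> = ennreal (1 / \<kappa>) * r * ?good"
      using r kappa unfolding good by (simp add: ennreal_mult_top ennreal_mult_eq_top_iff)
    also have "\<dots> = (\<integral>\<^sup>+k. ennreal (1 / \<kappa>) * r * (w k x * indicator (carrier G - Bad) k) \<partial>?N)"
      by (rule nn_integral_cmult[symmetric]) simp
    also have "\<dots> \<le> (\<integral>\<^sup>+k. w k (\<tau> x) \<partial>?N)"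
    proof (rule nn_integral_mono)
      fix k assume "k \<in> space ?N"
      then have k: "k \<in> carrier G" by simp
      show "ennreal (1 / \<kappa>) * r * (w k x * indicator (carrier G - Bad) k) \<le> w k (\<tau> x)"
      proof (cases "k \<in> Bad")
        case False
        then have "ennreal (1 / \<kappa>) \<le> ennreal (t k)" using t_bounds[of k] k by (intro ennreal_leI) auto
        then have "ennreal (1 / \<kappa>) * (r * w k x) \<le> ennreal (t k) * (r * w k x)" by (rule mult_right_mono) simp
        then show ?thesis using False k by (simp add: eq mult_ac)
      qed simp
    qed
    finally show "(\<integral>\<^sup>+k. w k (\<tau> x) \<partial>?N) = \<infinity>" by (simp add: top_unique)
  qed
qed

section \<open>Exchanging two coordinates in the abelian case\<close>

context nonsingular_bernoulli
begin

text \<open>The likelihood ratio of the values \<open>(\<not> b, b)\<close> against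
  \<open>(b, \<not> b)\<close> at the coordinates \<open>(k \<otimes> i, k \<otimes> j)\<close>. It
  serves as the density factor \<open>t\<close> of an exchange.\<close>

definition swap_ratio :: "'g \<Rightarrow> 'g \<Rightarrow> bool \<Rightarrow> 'g \<Rightarrow> real" where
  "swap_ratio i j b k = odds (k \<otimes> i) b * odds (k \<otimes> j) (\<not> b)"

text \<open>The threshold 4, a factor of 2 between square roots, is the one in
  \<open>unbalanced_le_hellinger\<close>. It becomes the constant \<open>\<kappa>\<close> of the
  perturbation, with these \<open>k\<close> as its bad displacements.\<close>

definition unbalanced :: "'g \<Rightarrow> 'g \<Rightarrow> bool \<Rightarrow> 'g set" where
  "unbalanced i j b = {k\<in>carrier G. \<not> (1 / 4 \<le> swap_ratio i j b k \<and> swap_ratio i j b k \<le> 4)}"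

definition differ :: "'g \<Rightarrow> 'g \<Rightarrow> 'g \<Rightarrow> ('g \<Rightarrow> bool) set" where
  "differ i j k = {x\<in>space X. x (k \<otimes> i) \<noteq> x (k \<otimes> j)}"

lemma differ_sets:
  assumes "i \<in> carrier G" "j \<in> carrier G" "k \<in> carrier G"
  shows "differ i j k \<in> sets X"
proof -
  have kc: "k \<otimes> i \<in> carrier G" "k \<otimes> j \<in> carrier G" using assms by auto
  note [measurable] = coordinate_measurable[OF measurable_ident_sets[OF refl] kc(1)]
    coordinate_measurable[OF measurable_ident_sets[OF refl] kc(2)]
  show ?thesis unfolding differ_def by measurable
qed

lemma measure_differ_le:
  assumes "i \<in> carrier G" "j \<in> carrier G" "k \<in> carrier G" "i \<noteq> j"
  shows "measure X (differ i j k) \<le> p (k \<otimes> i) b * p (k \<otimes> j) (\<not> b) + p (k \<otimes> i) (\<not> b) * p (k \<otimes> j) b"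
proof -
  have c: "k \<otimes> i \<in> carrier G" "k \<otimes> j \<in> carrier G" "k \<otimes> i \<noteq> k \<otimes> j" using assms by auto
  let ?E = "\<lambda>b. {x\<in>space X. x (k \<otimes> i) = b \<and> x (k \<otimes> j) = (\<not> b)}"
  have E: "?E b \<in> sets X" for b
  proof -
    have "?E b = {x\<in>space X. x (k \<otimes> i) \<in> {b}} \<inter> {x\<in>space X. x (k \<otimes> j) \<in> {\<not> b}}" by auto
    then show ?thesis using coordinate_sets[OF c(1), of "{b}"] coordinate_sets[OF c(2), of "{\<not> b}"] by auto
  qed
  have "differ i j k = ?E b \<union> ?E (\<not> b)" by (auto simp: differ_def)
  then have "measure X (differ i j k) \<le> measure X (?E b) + measure X (?E (\<not> b))"
    using E[of b] E[of "\<not> b"] by (simp only: measure_Un_le)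
  then show ?thesis using measure_two_coordinates[OF c, of b "\<not> b"] measure_two_coordinates[OF c, of "\<not> b" b] by simp
qed

lemma measure_differ_unbalanced:
  assumes ij: "i \<in> carrier G" "j \<in> carrier G" "i \<noteq> j" and k: "k \<in> unbalanced i j b"
  shows "measure X (differ i j k) \<le> 5 * hellinger (k \<otimes> i) (k \<otimes> j)"
proof -
  have kc: "k \<in> carrier G" and r: "swap_ratio i j b k < 1 / 4 \<or> 4 < swap_ratio i j b k"
    using k by (auto simp: unbalanced_def)
  define P where "P = p (k \<otimes> i) b * p (k \<otimes> j) (\<not> b)"
  define Q where "Q = p (k \<otimes> i) (\<not> b) * p (k \<otimes> j) b"
  have PQ: "0 < P" "0 < Q" using ij kc by (auto simp: P_def Q_def intro!: mult_pos_pos p_pos)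
  have ratio: "swap_ratio i j b k = Q / P"
    by (simp add: swap_ratio_def odds_def P_def Q_def)
  have "P + Q \<le> 5 * hellinger (k \<otimes> i) (k \<otimes> j)"
    using r
  proof
    assume "swap_ratio i j b k < 1 / 4"
    then have "4 * Q \<le> P" using PQ by (simp add: ratio field_simps)
    then show ?thesis using unbalanced_le_hellinger[of "k \<otimes> i" b "k \<otimes> j"] by (simp add: P_def Q_def)
  next
    assume "4 < swap_ratio i j b k"
    then have "4 * P \<le> Q" using PQ by (simp add: ratio field_simps)
    then show ?thesis using unbalanced_le_hellinger[of "k \<otimes> i" "\<not> b" "k \<otimes> j"] by (simp add: P_def Q_def add.commute)
  qed
  then show ?thesis using measure_differ_le[OF ij(1,2) kc ij(3), of b] by (simp add: P_def Q_def)
qed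

text \<open>By commutativity \<open>k \<otimes> j = g \<otimes> (k \<otimes> i)\<close> with the one
  element \<open>g = j \<otimes> inv i\<close>, so \<open>hellinger_bounded\<close> for this
  \<open>g\<close> controls the pairs belonging to all unbalanced \<open>k\<close> together.\<close>

lemma unbalanced_differ_bounded:
  assumes comm: "comm_group G" and ij: "i \<in> carrier G" "j \<in> carrier G" "i \<noteq> j"
  shows "\<exists>C. \<forall>F. finite F \<and> F \<subseteq> unbalanced i j b \<longrightarrow> (\<Sum>k\<in>F. measure X (differ i j k)) \<le> C"
proof -
  interpret comm_group G by fact
  define g where "g = j \<otimes> inv i"
  have g: "g \<in> carrier G" using ij by (simp add: g_def)
  obtain C where C: "\<And>F. finite F \<Longrightarrow> F \<subseteq> carrier G \<Longrightarrow> (\<Sum>h\<in>F. hellinger h (g \<otimes> h)) \<le> C"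
    using hellinger_bounded[OF g] by auto
  have "(\<Sum>k\<in>F. measure X (differ i j k)) \<le> 5 * C" if F: "finite F" "F \<subseteq> unbalanced i j b" for F
  proof -
    have Fc: "F \<subseteq> carrier G" using F by (auto simp: unbalanced_def)
    have inj: "inj_on (\<lambda>k. k \<otimes> i) F"
      by (rule inj_on_inverseI[of _ "\<lambda>k. k \<otimes> inv i"]) (use Fc ij in \<open>auto simp: m_assoc subset_eq\<close>)
    have "(\<Sum>k\<in>F. measure X (differ i j k)) \<le> (\<Sum>k\<in>F. 5 * hellinger (k \<otimes> i) (k \<otimes> j))"
      using F by (intro sum_mono measure_differ_unbalanced[OF ij]) auto
    also have "\<dots> = 5 * (\<Sum>k\<in>F. hellinger (k \<otimes> i) (g \<otimes> (k \<otimes> i)))"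
    proof -
      have "g \<otimes> (k \<otimes> i) = k \<otimes> j" if "k \<in> F" for k
      proof -
        have kc: "k \<in> carrier G" using that Fc by auto
        have "i \<otimes> (j \<otimes> inv i) = (j \<otimes> inv i) \<otimes> i" using ij by (intro m_comm) auto
        also have "\<dots> = j" using ij by (simp add: m_assoc)
        finally have *: "i \<otimes> (j \<otimes> inv i) = j" .
        have "g \<otimes> (k \<otimes> i) = (k \<otimes> i) \<otimes> g" using g kc ij by (intro m_comm) auto
        also have "\<dots> = k \<otimes> (i \<otimes> (j \<otimes> inv i))" using kc ij unfolding g_def by (simp add: m_assoc)
        finally show ?thesis unfolding * .
      qed
      then show ?thesis by (simp add: sum_distrib_left)
    qed
    also have "\<dots> = 5 * (\<Sum>h\<in>(\<lambda>k. k \<otimes> i) ` F. hellinger h (g \<otimes> h))"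
      by (simp add: sum.reindex[OF inj])
    also have "\<dots> \<le> 5 * C" using F Fc ij by (intro mult_left_mono C) auto
    finally show ?thesis .
  qed
  then show ?thesis by (intro exI[of _ "5 * C"]) auto
qed

text \<open>On the domain the values at \<open>i\<close> and \<open>j\<close> are distinct, and they
  remain so after the exchange. A translation by \<open>k\<close> carries them to the coordinates
  which \<open>differ i j k\<close> inspects, so a tail of the union of these sets, over unbalanced
  \<open>k\<close>, serves as \<open>\<Phi>\<close>.\<close>

lemma perturbation_swap:
  assumes comm: "comm_group G" and i: "i \<in> carrier G" and j: "j \<in> carrier G" and ij: "i \<noteq> j"
  shows "perturbation G X shift w (\<lambda>x. flip i (flip j x)) {x\<in>space X. x i = b \<and> x j = (\<not> b)}
     (ennreal (odds j b) * ennreal (odds i (\<not> b))) (swap_ratio i j b) 4 (unbalanced i j b)"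
proof unfold_locales
  let ?X0 = "{x\<in>space X. x i = b \<and> x j = (\<not> b)}"
  note [measurable] = flip_measurable[OF i] flip_measurable[OF j]
    coordinate_measurable[OF measurable_ident_sets[OF refl] i]
    coordinate_measurable[OF measurable_ident_sets[OF refl] j]
  show "(\<lambda>x. flip i (flip j x)) \<in> measurable X X" by measurable
  show "?X0 \<in> sets X" by measurable
  show "ennreal (odds j b) * ennreal (odds i (\<not> b)) < \<infinity>" by (simp add: ennreal_mult_less_top)
  show "(1::real) \<le> 4" by simp
  show "1 / 4 \<le> swap_ratio i j b k \<and> swap_ratio i j b k \<le> 4" if "k \<in> carrier G - unbalanced i j b" for k
    using that by (auto simp: unbalanced_def)
  show "(\<integral>\<^sup>+x. indicator ?X0 x * u (flip i (flip j x)) \<partial>X) \<le> ennreal (odds j b) * ennreal (odds i (\<not> b)) * (\<integral>\<^sup>+x. u x \<partial>X)"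
    if [measurable]: "u \<in> borel_measurable X" for u
  proof -
    have "(\<integral>\<^sup>+x. indicator ?X0 x * u (flip i (flip j x)) \<partial>X)
        = (\<integral>\<^sup>+x. of_bool (x j = (\<not> b)) * (of_bool (flip j x i = b) * u (flip i (flip j x))) \<partial>X)"
      using ij by (intro nn_integral_cong) (auto simp: indicator_def)
    also have "\<dots> \<le> ennreal (odds j (\<not> \<not> b)) * (\<integral>\<^sup>+x. of_bool (x i = b) * u (flip i x) \<partial>X)"
      by (rule nn_integral_flip_le[OF j, of "\<lambda>x. of_bool (x i = b) * u (flip i x)"]) measurable
    also have "\<dots> \<le> ennreal (odds j (\<not> \<not> b)) * (ennreal (odds i (\<not> b)) * (\<integral>\<^sup>+x. u x \<partial>X))"
      by (intro mult_left_mono nn_integral_flip_le[OF i]) auto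
    finally show ?thesis by (simp add: mult.assoc)
  qed
  show "AE x in X. x \<in> ?X0 \<longrightarrow> (\<forall>h\<in>carrier G. \<exists>r. 0 < r \<and> r < \<infinity> \<and>
         (\<forall>h'\<in>carrier G. w (inv h') (shift h (flip i (flip j x))) =
             w (inv h') (shift h x) * ennreal (swap_ratio i j b (inv h' \<otimes> h)) * r))"
    \<comment> \<open>The density factors of two flips multiply. The one for \<open>i\<close> is
      taken at \<open>flip j x\<close>, whose value at \<open>i\<close> is still that of
      \<open>x\<close>.\<close>
    using deriv_shift_flip[OF j] AE_flip[OF j deriv_shift_flip[OF i]]
  proof eventually_elim
    case (elim x)
    show ?case
    proof (intro impI ballI)
      fix h assume x: "x \<in> ?X0" and h: "h \<in> carrier G"
      let ?r = "ennreal (1 / odds (h \<otimes> j) (\<not> b)) * ennreal (1 / odds (h \<otimes> i) b)"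
      have "0 < odds (h \<otimes> j) (\<not> b)" "0 < odds (h \<otimes> i) b" using h i j by (auto intro: odds_pos)
      then have r: "0 < ?r" "?r < \<infinity>" by (simp_all add: ennreal_zero_less_mult_iff ennreal_mult_less_top)
      have "w (inv h') (shift h (flip i (flip j x))) =
             w (inv h') (shift h x) * ennreal (swap_ratio i j b (inv h' \<otimes> h)) * ?r" if h': "h' \<in> carrier G" for h'
      proof -
        have "0 < odds (inv h' \<otimes> h \<otimes> i) b" "0 < odds (inv h' \<otimes> h \<otimes> j) (\<not> b)"
          using h h' i j by (auto intro: odds_pos)
        then have "ennreal (swap_ratio i j b (inv h' \<otimes> h)) = ennreal (odds (inv h' \<otimes> h \<otimes> i) b) * ennreal (odds (inv h' \<otimes> h \<otimes> j) (\<not> b))"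
          unfolding swap_ratio_def by (intro ennreal_mult) auto
        then show ?thesis
          using elim(1)[rule_format, OF h h'] elim(2)[rule_format, OF h h'] x ij by (simp add: mult_ac)
      qed
      with r show "\<exists>r. 0 < r \<and> r < \<infinity> \<and> (\<forall>h'\<in>carrier G. w (inv h') (shift h (flip i (flip j x))) =
             w (inv h') (shift h x) * ennreal (swap_ratio i j b (inv h' \<otimes> h)) * r)"
        by blast
    qed
  qed
  show "\<exists>K' \<Phi>. finite K' \<and> K' \<subseteq> carrier G \<and> \<Phi> \<in> sets X \<and> emeasure X \<Phi> < ennreal e \<and>
       (\<forall>k\<in>unbalanced i j b \<inter> carrier G - K'. \<forall>x\<in>?X0. shift k x \<in> \<Phi> \<and> shift k (flip i (flip j x)) \<in> \<Phi>)"
    if e: "0 < e" for e :: real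
  proof -
    obtain C where C: "\<And>F. finite F \<Longrightarrow> F \<subseteq> unbalanced i j b \<Longrightarrow> (\<Sum>k\<in>F. measure X (differ i j k)) \<le> C"
      using unbalanced_differ_bounded[OF comm i j ij, of b] by auto
    have uc: "unbalanced i j b \<subseteq> carrier G" by (auto simp: unbalanced_def)
    have cb: "countable (unbalanced i j b)" by (rule countable_subset[OF uc countable_G])
    have ds: "\<And>k. k \<in> unbalanced i j b \<Longrightarrow> differ i j k \<in> sets X" using uc by (intro differ_sets i j) auto
    obtain K where K: "finite K" "K \<subseteq> unbalanced i j b" "(\<Union>k\<in>unbalanced i j b - K. differ i j k) \<in> sets X"
      "measure X (\<Union>k\<in>unbalanced i j b - K. differ i j k) < e"
      using tail_union_small[OF cb ds C e] by blast
    show ?thesis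
    proof (rule exI[of _ K], rule exI[of _ "\<Union>k\<in>unbalanced i j b - K. differ i j k"], intro conjI ballI)
      show "finite K" "K \<subseteq> carrier G" "(\<Union>k\<in>unbalanced i j b - K. differ i j k) \<in> sets X" using K uc by auto
      show "emeasure X (\<Union>k\<in>unbalanced i j b - K. differ i j k) < ennreal e"
        unfolding emeasure_eq_measure by (rule ennreal_lessI[OF e K(4)])
      fix k x assume k: "k \<in> unbalanced i j b \<inter> carrier G - K" and x: "x \<in> ?X0"
      have xs: "x \<in> space X" "flip i (flip j x) \<in> space X" using x flip_space i j by auto
      have "shift k x \<in> differ i j k" "shift k (flip i (flip j x)) \<in> differ i j k"
        using x xs k i j ij act.act_space by (simp_all add: differ_def shift_mult_apply)
      then show "shift k x \<in> (\<Union>k\<in>unbalanced i j b - K. differ i j k)"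
        "shift k (flip i (flip j x)) \<in> (\<Union>k\<in>unbalanced i j b - K. differ i j k)" using k by auto
    qed
  qed
qed

definition conservative_part :: "('g \<Rightarrow> bool) set" where
  "conservative_part = {x\<in>space X. (\<integral>\<^sup>+k. w k x \<partial>count_space (carrier G)) = \<infinity>}"

lemma conservative_part_sets: "conservative_part \<in> sets X"
proof -
  have "(\<lambda>x. \<integral>\<^sup>+k. w k x \<partial>count_space (carrier G)) \<in> borel_measurable X"
    by (intro borel_measurable_nn_integral_count_space countable_G act.deriv_measurable)
  then show ?thesis unfolding conservative_part_def by measurable
qed

text \<open>If \<open>x i \<noteq> x j\<close>, then \<open>shift k x\<close> lies in
  \<open>differ i j k\<close> for every \<open>k\<close>. Weighted by \<open>w k x\<close>, the
  indicators of these events for unbalanced \<open>k\<close> integrate to the measures of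
  \<open>differ i j k\<close>, whose sum is finite. So the unbalanced \<open>k\<close> contribute a
  finite amount to the sum of derivatives almost everywhere, as
  \<open>conservative_under_tau\<close> requires.\<close>

lemma conservative_part_swap:
  assumes comm: "comm_group G" and i: "i \<in> carrier G" and j: "j \<in> carrier G" and ij: "i \<noteq> j"
  shows "AE x in X. x i \<noteq> x j \<longrightarrow> (flip i (flip j x) \<in> conservative_part \<longleftrightarrow> x \<in> conservative_part)"
proof -
  let ?N = "count_space (carrier G)"
  have half: "AE x in X. x i = b \<and> x j = (\<not> b) \<longrightarrow> x \<in> conservative_part \<longrightarrow> flip i (flip j x) \<in> conservative_part" for b
  proof -
    let ?X0 = "{x\<in>space X. x i = b \<and> x j = (\<not> b)}"
    let ?B = "unbalanced i j b"
    interpret T: perturbation G X shift w "\<lambda>x. flip i (flip j x)" ?X0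
      "ennreal (odds j b) * ennreal (odds i (\<not> b))" "swap_ratio i j b" 4 ?B
      by (rule perturbation_swap[OF comm i j ij])
    have uc: "?B \<inter> carrier G = ?B" "?B \<subseteq> carrier G" by (auto simp: unbalanced_def)
    have cb: "countable ?B" by (rule countable_subset[OF uc(2) countable_G])
    obtain C where C: "\<And>F. finite F \<Longrightarrow> F \<subseteq> ?B \<Longrightarrow> (\<Sum>k\<in>F. measure X (differ i j k)) \<le> C"
      using unbalanced_differ_bounded[OF comm i j ij, of b] by auto
    let ?f = "\<lambda>k x. indicator (differ i j k) (shift k x) * w k x"
    have fm: "?f k \<in> borel_measurable X" if "k \<in> ?B" for k
    proof -
      have k: "k \<in> carrier G" using that uc by auto
      note [measurable] = differ_sets[OF i j k] act.act_measurable[OF k] act.deriv_measurable[OF k]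
      show ?thesis by measurable
    qed
    have "(\<integral>\<^sup>+x. \<integral>\<^sup>+k. ?f k x \<partial>count_space ?B \<partial>X) = (\<integral>\<^sup>+k. \<integral>\<^sup>+x. ?f k x \<partial>X \<partial>count_space ?B)"
      by (rule nn_integral_count_space_nn_integral[OF cb fm])
    also have "\<dots> = (\<integral>\<^sup>+k. ennreal (measure X (differ i j k)) \<partial>count_space ?B)"
    proof (rule nn_integral_cong)
      fix k assume "k \<in> space (count_space ?B)"
      then have k: "k \<in> carrier G" using uc by auto
      have "(\<integral>\<^sup>+x. ?f k x \<partial>X) = (\<integral>\<^sup>+x. indicator (differ i j k) x \<partial>X)"
        using differ_sets[OF i j k] by (intro act.nn_integral_act[OF k]) auto
      also have "\<dots> = ennreal (measure X (differ i j k))"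
        using differ_sets[OF i j k] by (simp add: emeasure_eq_measure)
      finally show "(\<integral>\<^sup>+x. ?f k x \<partial>X) = ennreal (measure X (differ i j k))" .
    qed
    also have "\<dots> \<le> ennreal C"
      using C by (intro nn_integral_count_space_le_if_finite_sums_le[OF cb]) (simp add: ennreal_leI)
    finally have "(\<integral>\<^sup>+x. \<integral>\<^sup>+k. ?f k x \<partial>count_space ?B \<partial>X) \<noteq> \<infinity>"
      by (auto simp: top_unique)
    then have "AE x in X. (\<integral>\<^sup>+k. ?f k x \<partial>count_space ?B) \<noteq> \<infinity>"
      by (intro nn_integral_PInf_AE borel_measurable_nn_integral_count_space[OF cb fm])
    then have fin: "AE x in X. x \<in> ?X0 \<longrightarrow> (\<integral>\<^sup>+k. w k x \<partial>count_space (?B \<inter> carrier G)) < \<infinity>"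
    proof eventually_elim
      case (elim x)
      show ?case
      proof
        assume x: "x \<in> ?X0"
        have "(\<integral>\<^sup>+k. ?f k x \<partial>count_space ?B) = (\<integral>\<^sup>+k. w k x \<partial>count_space ?B)"
        proof (rule nn_integral_cong)
          fix k assume "k \<in> space (count_space ?B)"
          then have k: "k \<in> carrier G" using uc by auto
          have "shift k x \<in> differ i j k"
            using x k i j act.act_space by (simp add: differ_def shift_mult_apply)
          then show "?f k x = w k x" by simp
        qed
        then show "(\<integral>\<^sup>+k. w k x \<partial>count_space (?B \<inter> carrier G)) < \<infinity>"
          using elim by (simp add: uc less_top)
      qed
    qed
    show ?thesis
      using T.conservative_under_tau[OF fin] AE_space
      by eventually_elim (use flip_space i j in \<open>auto simp: conservative_part_def\<close>)
  qed
  \<comment> \<open>The exchange is an involution, so the implication at the exchanged point is the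
    converse implication at \<open>x\<close>.\<close>
  have rev: "AE x in X. flip i (flip j x) i = b \<and> flip i (flip j x) j = (\<not> b) \<longrightarrow> flip i (flip j x) \<in> conservative_part \<longrightarrow>
     flip i (flip j (flip i (flip j x))) \<in> conservative_part" for b
    by (rule AE_flip[OF j AE_flip[OF i half]])
  show ?thesis
    using half[of True] half[of False] rev[of True] rev[of False]
  proof eventually_elim
    case (elim x)
    have "flip i (flip j (flip i (flip j x))) = x" using flip_commute[OF ij] by simp
    then show ?case using elim ij by auto
  qed
qed

lemma conservative_imp_weakly_mixing:
  assumes comm: "comm_group G" and inf: "infinite (carrier G)"
    and unbounded: "\<And>B. \<exists>J. finite J \<and> J \<subseteq> carrier G \<and> B \<le> (\<Sum>j\<in>J. min (p j True) (p j False))"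
    and cons: "AE x in X. (\<integral>\<^sup>+k. w k x \<partial>count_space (carrier G)) = \<infinity>"
  shows "weakly_mixing TYPE('y) G X shift"
proof (rule weakly_mixing_if_sections_trivial)
  fix N :: "'y measure" and \<psi> A
  assume N: "prob_space N" "pmp_action G N \<psi>" and A: "A \<in> sets (X \<Otimes>\<^sub>M N)"
    "\<And>g z. g \<in> carrier G \<Longrightarrow> z \<in> space (X \<Otimes>\<^sub>M N) \<Longrightarrow> diagonal_action X shift N \<psi> g z \<in> A \<longleftrightarrow> z \<in> A"
  let ?A = "\<lambda>y. {x\<in>space X. (x, y) \<in> A}"
  have "AE y in N. i \<noteq> j \<longrightarrow> (AE x in X. x \<in> {x\<in>space X. x i = b \<and> x j = (\<not> b)} \<longrightarrow>
      (flip i (flip j x) \<in> ?A y \<longleftrightarrow> x \<in> ?A y))"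
    if i: "i \<in> carrier G" and j: "j \<in> carrier G" for i j b
  proof (cases "i = j")
    case False
    have "AE y in N. AE x in X. x \<in> {x\<in>space X. x i = b \<and> x j = (\<not> b)} \<longrightarrow>
      (flip i (flip j x) \<in> ?A y \<longleftrightarrow> x \<in> ?A y)"
      by (rule diagonal_invariant_under_tau[where J="{i, j}", OF perturbation_swap[OF comm i j False] _ _ _
            act.conservative_imp_collision_small[OF comm inf cons] N A]) (use i j in auto)
    then show ?thesis by eventually_elim simp
  qed simp
  then have "AE y in N. \<forall>b. \<forall>i\<in>carrier G. \<forall>j\<in>carrier G. i \<noteq> j \<longrightarrow> (AE x in X.
      x \<in> {x\<in>space X. x i = b \<and> x j = (\<not> b)} \<longrightarrow> (flip i (flip j x) \<in> ?A y \<longleftrightarrow> x \<in> ?A y))"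
    unfolding AE_all_countable AE_ball_countable[OF countable_G] by blast
  with AE_space show "AE y in N. measure X (?A y) = 0 \<or> measure X (?A y) = 1"
  proof eventually_elim
    case (elim y)
    have sw: "AE x in X. x i \<noteq> x j \<longrightarrow> (flip i (flip j x) \<in> ?A y \<longleftrightarrow> x \<in> ?A y)"
      if ij: "i \<in> carrier G" "j \<in> carrier G" "i \<noteq> j" for i j
      using elim(2)[rule_format, OF ij, of True] elim(2)[rule_format, OF ij, of False] AE_space
      by eventually_elim auto
    show ?case by (rule swap_zero_one[OF section_sets[OF A(1) elim(1)] sw unbounded])
  qed
qed

lemma conservative_part_zero_one:
  assumes "comm_group G"
    and "\<And>B. \<exists>J. finite J \<and> J \<subseteq> carrier G \<and> B \<le> (\<Sum>j\<in>J. min (p j True) (p j False))"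
  shows "measure X conservative_part = 0 \<or> measure X conservative_part = 1"
  by (rule swap_zero_one[OF conservative_part_sets conservative_part_swap[OF assms(1)] assms(2)])

end

section \<open>Essential freeness and dissipativity\<close>

context bernoulli
begin

text \<open>If the sums of the minima were bounded, the configuration taking a likeliest value at
  every coordinate would have positive mass, namely a convergent infinite product, and would be an
  atom.\<close>

lemma nonatomic_imp_unbounded:
  assumes inf: "infinite (carrier G)" and na: "nonatomic X"
  shows "\<exists>J. finite J \<and> J \<subseteq> carrier G \<and> B \<le> (\<Sum>j\<in>J. min (p j True) (p j False))"
proof (rule ccontr)
  let ?m = "\<lambda>j. min (p j True) (p j False)"
  assume "\<not> ?thesis"
  then have B: "\<And>J. finite J \<Longrightarrow> J \<subseteq> carrier G \<Longrightarrow> (\<Sum>j\<in>J. ?m j) < B" by (meson not_le)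
  define en where "en = from_nat_into (carrier G)"
  have bij: "bij_betw en UNIV (carrier G)"
    unfolding en_def by (rule bij_betw_from_nat_into[OF countable_G inf])
  have en: "en n \<in> carrier G" for n using bij by (auto simp: bij_betw_def)
  define z where "z = (\<lambda>h\<in>carrier G. 1 / 2 \<le> p h True)"
  have zs: "z \<in> space X" by (simp add: z_def space_X)
  have pz: "p h (z h) = 1 - ?m h" if "h \<in> carrier G" for h
    using that p_not[of h True] by (cases "1 / 2 \<le> p h True") (auto simp: z_def min_def)
  define E where "E n = {x\<in>space X. \<forall>h\<in>en ` {..<n}. x h \<in> {z h}}" for n
  have Es: "E n \<in> sets X" for n unfolding E_def using en by (intro cylinder_sets) auto
  have ge: "exp (- 2 * B) \<le> measure X (E n)" for n
  proof -
    let ?J = "en ` {..<n}"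
    have J: "finite ?J" "?J \<subseteq> carrier G" using en by auto
    have "exp (- 2 * B) \<le> exp (- 2 * (\<Sum>h\<in>?J. ?m h))" using B[OF J] by simp
    also have "\<dots> = (\<Prod>h\<in>?J. exp (- 2 * ?m h))" using J by (simp add: exp_sum[symmetric] sum_distrib_left)
    also have "\<dots> \<le> (\<Prod>h\<in>?J. p h (z h))"
    proof (rule prod_mono, intro conjI)
      fix h assume h: "h \<in> ?J"
      then have hc: "h \<in> carrier G" using J by auto
      have m: "0 \<le> ?m h" "?m h \<le> 1 / 2"
        using p_not[of h True] pmf_le_1[of "\<mu> h" True] by (auto simp: min_def)
      \<comment> \<open>As \<open>?m h \<le> 1 / 2\<close>, twice its square is at most
        \<open>?m h\<close>, which absorbs the quadratic term in the lower bound for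
        \<open>ln (1 - ?m h)\<close>.\<close>
      have "(?m h)\<^sup>2 \<le> ?m h * (1 / 2)" unfolding power2_eq_square using m by (intro mult_left_mono) auto
      then have "- 2 * ?m h \<le> - ?m h - 2 * (?m h)\<^sup>2" by linarith
      also have "\<dots> \<le> ln (1 - ?m h)" using m by (rule ln_one_minus_pos_lower_bound)
      finally have "exp (- 2 * ?m h) \<le> exp (ln (1 - ?m h))" by simp
      then show "exp (- 2 * ?m h) \<le> p h (z h)" using m pz[OF hc] by simp
    qed simp
    also have "\<dots> = measure X (E n)"
      unfolding E_def using measure_cylinder[OF J, of "\<lambda>h. {z h}"] by (simp add: measure_pmf_single)
    finally show ?thesis .
  qed
  have "(\<lambda>n. measure X (E n)) \<longlonglongrightarrow> measure X (\<Inter>n. E n)"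
    by (rule finite_Lim_measure_decseq) (use Es in \<open>auto simp: decseq_def E_def\<close>)
  then have "exp (- 2 * B) \<le> measure X (\<Inter>n. E n)"
    by (rule LIMSEQ_le_const) (use ge in auto)
  also have "(\<Inter>n. E n) = {z}"
  proof (intro equalityI subsetI)
    fix x assume x: "x \<in> (\<Inter>n. E n)"
    have "x h = z h" for h
    proof (cases "h \<in> carrier G")
      case True
      then obtain n where "h = en n" using bij by (auto simp: bij_betw_def)
      moreover have "x \<in> E (Suc n)" using x by auto
      ultimately show ?thesis by (auto simp: E_def)
    next
      case False
      have "x \<in> space X" using x by (auto simp: E_def)
      then show ?thesis using False zs unfolding space_X by (metis PiE_arb)
    qed
    then show "x \<in> {z}" by auto
  qed (use zs in \<open>auto simp: E_def\<close>)
  finally have pos: "exp (- 2 * B) \<le> measure X {z}" .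
  have "(\<Inter>n. E n) \<in> sets X" using Es by (intro sets.countable_INT) auto
  then have zm: "{z} \<in> sets X" unfolding \<open>(\<Inter>n. E n) = {z}\<close> .
  have "0 < measure X {z}" using pos by (rule less_le_trans[OF exp_gt_zero])
  then have "0 < emeasure X {z}" by (simp add: emeasure_eq_measure)
  then obtain C where "C \<subseteq> {z}" "0 < emeasure X C" "emeasure X C < emeasure X {z}"
    using na zm unfolding nonatomic_def by blast
  moreover then have "C = {} \<or> C = {z}" by blast
  ultimately show False by auto
qed

text \<open>As \<open>g \<otimes> h \<notin> I\<close>, the pairs \<open>{h, g \<otimes> h}\<close>
  are disjoint and their events independent. Independence comes from
  \<open>measure_flip_invariant_coordinate\<close>, used at both coordinates of a new pair, whose
  flips leave the earlier events alone.\<close>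

lemma measure_pairs_equal:
  assumes g: "g \<in> carrier G" "g \<noteq> \<one>" and I: "finite I" "I \<subseteq> carrier G" "\<And>h. h \<in> I \<Longrightarrow> g \<otimes> h \<notin> I"
  shows "measure X {x\<in>space X. \<forall>h\<in>I. x (g \<otimes> h) = x h} = (\<Prod>h\<in>I. p h True * p (g \<otimes> h) True + p h False * p (g \<otimes> h) False)"
  using I
proof induction
  case empty
  then show ?case by (simp add: prob_space)
next
  case (insert i I)
  have ic: "i \<in> carrier G" and gi: "g \<otimes> i \<in> carrier G" using insert g by auto
  have ne: "g \<otimes> i \<noteq> i" using g ic by (metis r_cancel_one)
  have gI: "g \<otimes> h \<noteq> i" "g \<otimes> h \<noteq> g \<otimes> i" "h \<noteq> i" "h \<noteq> g \<otimes> i" if "h \<in> I" for h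
  proof -
    have hc: "h \<in> carrier G" using that insert by auto
    show "g \<otimes> h \<noteq> i" using insert.prems(2)[of h] that by auto
    show "h \<noteq> i" using that insert.hyps by auto
    then show "g \<otimes> h \<noteq> g \<otimes> i" using hc g ic by simp
    show "h \<noteq> g \<otimes> i" using insert.prems(2)[of i] that by auto
  qed
  let ?A = "{x\<in>space X. \<forall>h\<in>I. x (g \<otimes> h) = x h}"
  have "{x\<in>space X. x (g \<otimes> h) = x h} \<in> sets X" if "h \<in> I" for h
  proof -
    have hc: "h \<in> carrier G" "g \<otimes> h \<in> carrier G" using that insert g by auto
    note [measurable] = coordinate_measurable[OF measurable_ident_sets[OF refl] hc(1)]
      coordinate_measurable[OF measurable_ident_sets[OF refl] hc(2)]
    show ?thesis by measurable
  qed
  then have A: "?A \<in> sets X" using insert.hyps by (intro sets.sets_Collect_finite_All) auto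
  have inv: "flip k x \<in> ?A \<longleftrightarrow> x \<in> ?A" if k: "k = i \<or> k = g \<otimes> i" and x: "x \<in> space X" for k x
  proof -
    have kc: "k \<in> carrier G" using k ic gi by auto
    have "flip k x (g \<otimes> h) = x (g \<otimes> h)" "flip k x h = x h" if "h \<in> I" for h
      using gI[OF that] k by (auto simp: flip_def)
    then show ?thesis using x flip_space[OF kc x] by simp
  qed
  have b: "measure X {x\<in>?A. x i = b \<and> x (g \<otimes> i) = b} = measure X ?A * (p i b * p (g \<otimes> i) b)" for b
  proof -
    let ?C = "{x\<in>?A. x i \<in> {b}}"
    have 1: "measure X ?C = measure X ?A * p i b"
    proof -
      have "AE x in X. flip i x \<in> ?A \<longleftrightarrow> x \<in> ?A" using AE_space by eventually_elim (rule inv, auto)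
      from measure_flip_invariant_coordinate[OF ic A this, of "{b}"] show ?thesis
        by (simp add: measure_pmf_single)
    qed
    have C: "?C \<in> sets X"
    proof -
      have "?C = ?A \<inter> {x\<in>space X. x i \<in> {b}}" by auto
      also have "\<dots> \<in> sets X" by (intro sets.Int A coordinate_sets ic)
      finally show ?thesis .
    qed
    have "AE x in X. flip (g \<otimes> i) x \<in> ?C \<longleftrightarrow> x \<in> ?C"
      using AE_space
    proof eventually_elim
      case (elim x)
      have "flip (g \<otimes> i) x i = x i" using ne by simp
      then show ?case using inv[of "g \<otimes> i" x] elim by blast
    qed
    from measure_flip_invariant_coordinate[OF gi C this, of "{b}"]
    have "measure X {x\<in>?C. x (g \<otimes> i) \<in> {b}} = measure X ?C * p (g \<otimes> i) b"
      by (simp add: measure_pmf_single)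
    moreover have "{x\<in>?C. x (g \<otimes> i) \<in> {b}} = {x\<in>?A. x i = b \<and> x (g \<otimes> i) = b}" by auto
    ultimately show ?thesis using 1 by simp
  qed
  have D: "{x\<in>?A. x i = b \<and> x (g \<otimes> i) = b} \<in> sets X" for b
  proof -
    have "{x\<in>?A. x i = b \<and> x (g \<otimes> i) = b} = ?A \<inter> {x\<in>space X. x i \<in> {b}} \<inter> {x\<in>space X. x (g \<otimes> i) \<in> {b}}" by auto
    also have "\<dots> \<in> sets X" by (intro sets.Int A coordinate_sets ic gi)
    finally show ?thesis .
  qed
  have "{x\<in>space X. \<forall>h\<in>insert i I. x (g \<otimes> h) = x h}
      = {x\<in>?A. x i = True \<and> x (g \<otimes> i) = True} \<union> {x\<in>?A. x i = False \<and> x (g \<otimes> i) = False}"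
    by auto
  then have "measure X {x\<in>space X. \<forall>h\<in>insert i I. x (g \<otimes> h) = x h}
      = measure X {x\<in>?A. x i = True \<and> x (g \<otimes> i) = True} + measure X {x\<in>?A. x i = False \<and> x (g \<otimes> i) = False}"
    using finite_measure_Union[OF D[of True] D[of False]] by auto
  also have "\<dots> = measure X ?A * (p i True * p (g \<otimes> i) True + p i False * p (g \<otimes> i) False)"
    unfolding b by (simp add: distrib_left)
  also have "measure X ?A = (\<Prod>h\<in>I. p h True * p (g \<otimes> h) True + p h False * p (g \<otimes> h) False)"
    using insert by auto
  finally show ?case using insert.hyps by (simp add: mult.commute)
qed

text \<open>An average of the two probabilities at one coordinate, with the weights of the other, is
  at most the larger of them, which is 1 minus the smaller. Both versions are needed because a pair
  may be charged to either of its members.\<close>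

lemma pair_equal_le:
  "p h True * p k True + p h False * p k False \<le> exp (- min (p h True) (p h False))"
  "p h True * p k True + p h False * p k False \<le> exp (- min (p k True) (p k False))"
proof -
  have *: "p h True * p k True + p h False * p k False \<le> exp (- min (p h True) (p h False))" for h k
  proof -
    let ?M = "1 - min (p h True) (p h False)"
    have M: "p h True \<le> ?M" "p h False \<le> ?M" using p_not[of h True] by auto
    have "p h True * p k True + p h False * p k False \<le> ?M * p k True + ?M * p k False"
      by (intro add_mono mult_right_mono M) auto
    also have "\<dots> = ?M" using p_sum[of k True] by (simp add: distrib_left[symmetric])
    also have "\<dots> \<le> exp (- min (p h True) (p h False))"
      using exp_ge_add_one_self[of "- min (p h True) (p h False)"] by simp
    finally show ?thesis .
  qed
  show "p h True * p k True + p h False * p k False \<le> exp (- min (p h True) (p h False))" by (rule *)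
  show "p h True * p k True + p h False * p k False \<le> exp (- min (p k True) (p k False))"
    using *[of k h] by (simp add: mult.commute)
qed

text \<open>A maximal \<open>I \<subseteq> E\<close> disjoint from its translate by \<open>g\<close> has the property that \<open>I\<close> and its translates by
  \<open>g\<close> and \<open>g\<^sup>-\<^sup>1\<close> cover \<open>E\<close>, so one of the three carries a third of the sum.\<close>

lemma measure_fixed_le:
  assumes g: "g \<in> carrier G" "g \<noteq> \<one>" and E: "finite E" "E \<subseteq> carrier G"
  shows "measure X {x\<in>space X. \<forall>h\<in>carrier G. x (g \<otimes> h) = x h} \<le> exp (- (\<Sum>h\<in>E. min (p h True) (p h False)) / 3)"
proof -
  let ?m = "\<lambda>h. min (p h True) (p h False)"
  let ?fix = "{x\<in>space X. \<forall>h\<in>carrier G. x (g \<otimes> h) = x h}"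
  let ?P = "{I\<in>Pow E. \<forall>h\<in>I. g \<otimes> h \<notin> I}"
  have "finite ?P" "{} \<in> ?P" using E by auto
  then obtain I where I: "I \<in> ?P" "\<And>J. J \<in> ?P \<Longrightarrow> I \<subseteq> J \<Longrightarrow> I = J"
    using finite_has_maximal2[of ?P "{}"] by auto
  have Ic: "finite I" "I \<subseteq> carrier G" using I(1) E by (auto intro: finite_subset)
  let ?gI = "(\<lambda>h. g \<otimes> h) ` I" and ?hI = "(\<lambda>h. inv g \<otimes> h) ` I"
  have ginv: "g \<otimes> (inv g \<otimes> h) = h" "inv g \<otimes> (g \<otimes> h) = h" if "h \<in> carrier G" for h
    using that g by (simp_all add: m_assoc[symmetric])
  have cover: "E \<subseteq> I \<union> (?gI \<union> ?hI)"
  proof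
    fix h assume h: "h \<in> E"
    then have hc: "h \<in> carrier G" using E by auto
    show "h \<in> I \<union> (?gI \<union> ?hI)"
    proof (rule ccontr)
      assume n: "h \<notin> I \<union> (?gI \<union> ?hI)"
      have "g \<otimes> h \<notin> I"
      proof
        assume "g \<otimes> h \<in> I"
        then have "h \<in> ?hI" using ginv(2)[OF hc] by (intro image_eqI[of _ _ "g \<otimes> h"]) auto
        then show False using n by simp
      qed
      moreover have "g \<otimes> h \<noteq> h" using g hc by (metis r_cancel_one)
      moreover have "g \<otimes> k \<noteq> h" if "k \<in> I" for k using n that by auto
      ultimately have "insert h I \<in> ?P" using I(1) h by auto
      from I(2)[OF this] n show False by auto
    qed
  qed
  have bound: "measure X ?fix \<le> (\<Prod>h\<in>J. p h True * p (g \<otimes> h) True + p h False * p (g \<otimes> h) False)"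
    if J: "finite J" "J \<subseteq> carrier G" "\<And>h. h \<in> J \<Longrightarrow> g \<otimes> h \<notin> J" for J
  proof -
    have sm: "{x\<in>space X. \<forall>h\<in>J. x (g \<otimes> h) = x h} \<in> sets X"
    proof (intro sets.sets_Collect_finite_All J(1))
      fix h assume "h \<in> J"
      then have hc: "h \<in> carrier G" "g \<otimes> h \<in> carrier G" using J g by auto
      note [measurable] = coordinate_measurable[OF measurable_ident_sets[OF refl] hc(1)]
        coordinate_measurable[OF measurable_ident_sets[OF refl] hc(2)]
      show "{x\<in>space X. x (g \<otimes> h) = x h} \<in> sets X" by measurable
    qed
    have "measure X ?fix \<le> measure X {x\<in>space X. \<forall>h\<in>J. x (g \<otimes> h) = x h}"
      using J by (intro finite_measure_mono sm) auto
    then show ?thesis using measure_pairs_equal[OF g J] by simp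
  qed
  \<comment> \<open>The pairs \<open>(h, g \<otimes> h)\<close> with \<open>h \<in> I\<close> are
    charged to their first members here and to their second members in \<open>2\<close>. In
    \<open>3\<close> the pairs have their second member in \<open>I\<close> and are charged to the
    first.\<close>
  have 1: "measure X ?fix \<le> exp (- (\<Sum>h\<in>I. ?m h))"
  proof -
    have "(\<Prod>h\<in>I. p h True * p (g \<otimes> h) True + p h False * p (g \<otimes> h) False) \<le> (\<Prod>h\<in>I. exp (- ?m h))"
      by (intro prod_mono conjI pair_equal_le add_nonneg_nonneg mult_nonneg_nonneg) auto
    then show ?thesis using bound[OF Ic] I(1) Ic by (simp add: exp_sum[symmetric] sum_negf)
  qed
  have 2: "measure X ?fix \<le> exp (- (\<Sum>h\<in>?gI. ?m h))"
  proof -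
    have inj: "inj_on (\<lambda>h. g \<otimes> h) I"
      by (rule inj_on_inverseI[of _ "\<lambda>h. inv g \<otimes> h"]) (use Ic ginv in auto)
    have "(\<Prod>h\<in>I. p h True * p (g \<otimes> h) True + p h False * p (g \<otimes> h) False) \<le> (\<Prod>h\<in>I. exp (- ?m (g \<otimes> h)))"
      by (intro prod_mono conjI pair_equal_le add_nonneg_nonneg mult_nonneg_nonneg) auto
    then show ?thesis using bound[OF Ic] I(1) Ic by (simp add: exp_sum[symmetric] sum_negf sum.reindex[OF inj])
  qed
  have 3: "measure X ?fix \<le> exp (- (\<Sum>h\<in>?hI. ?m h))"
  proof -
    have hI: "finite ?hI" "?hI \<subseteq> carrier G" using Ic g by auto
    have "g \<otimes> h \<notin> ?hI" if h: "h \<in> ?hI" for h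
    proof
      obtain k where k: "k \<in> I" "h = inv g \<otimes> k" using h by auto
      assume "g \<otimes> h \<in> ?hI"
      then obtain l where l: "l \<in> I" "g \<otimes> h = inv g \<otimes> l" by auto
      have kc: "k \<in> carrier G" "l \<in> carrier G" using k l Ic by auto
      then have "k = inv g \<otimes> l" using k l ginv by simp
      then have "g \<otimes> k = l" using ginv kc by simp
      then show False using I(1) k l by auto
    qed
    note hI' = this
    have "(\<Prod>h\<in>?hI. p h True * p (g \<otimes> h) True + p h False * p (g \<otimes> h) False) \<le> (\<Prod>h\<in>?hI. exp (- ?m h))"
      by (intro prod_mono conjI pair_equal_le add_nonneg_nonneg mult_nonneg_nonneg) auto
    also have "\<dots> = exp (- (\<Sum>h\<in>?hI. ?m h))" using hI by (simp add: exp_sum[symmetric] sum_negf)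
    finally show ?thesis using bound[OF hI hI'] by linarith
  qed
  have un: "(\<Sum>j\<in>P \<union> Q. ?m j) \<le> (\<Sum>j\<in>P. ?m j) + (\<Sum>j\<in>Q. ?m j)" if "finite P" "finite Q" for P Q
    unfolding sum_Un[OF that] by (simp add: sum_nonneg)
  have "(\<Sum>h\<in>E. ?m h) \<le> (\<Sum>h\<in>I \<union> (?gI \<union> ?hI). ?m h)"
    using cover Ic by (intro sum_mono2) auto
  also have "\<dots> \<le> (\<Sum>h\<in>I. ?m h) + ((\<Sum>h\<in>?gI. ?m h) + (\<Sum>h\<in>?hI. ?m h))"
    using Ic by (intro order_trans[OF un] add_left_mono un) auto
  finally have "(\<Sum>h\<in>E. ?m h) / 3 \<le> (\<Sum>h\<in>I. ?m h) \<or> (\<Sum>h\<in>E. ?m h) / 3 \<le> (\<Sum>h\<in>?gI. ?m h) \<or> (\<Sum>h\<in>E. ?m h) / 3 \<le> (\<Sum>h\<in>?hI. ?m h)"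
    by linarith
  then show ?thesis
  proof (elim disjE)
    assume "(\<Sum>h\<in>E. ?m h) / 3 \<le> (\<Sum>h\<in>I. ?m h)"
    then have "exp (- (\<Sum>h\<in>I. ?m h)) \<le> exp (- (\<Sum>h\<in>E. ?m h) / 3)" by simp
    with 1 show ?thesis by (rule order_trans)
  next
    assume "(\<Sum>h\<in>E. ?m h) / 3 \<le> (\<Sum>h\<in>?gI. ?m h)"
    then have "exp (- (\<Sum>h\<in>?gI. ?m h)) \<le> exp (- (\<Sum>h\<in>E. ?m h) / 3)" by simp
    with 2 show ?thesis by (rule order_trans)
  next
    assume "(\<Sum>h\<in>E. ?m h) / 3 \<le> (\<Sum>h\<in>?hI. ?m h)"
    then have "exp (- (\<Sum>h\<in>?hI. ?m h)) \<le> exp (- (\<Sum>h\<in>E. ?m h) / 3)" by simp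
    with 3 show ?thesis by (rule order_trans)
  qed
qed

end

section \<open>Freeness and fundamental domains\<close>

context nonsingular_bernoulli
begin

lemma AE_free:
  assumes unbounded: "\<And>B. \<exists>J. finite J \<and> J \<subseteq> carrier G \<and> B \<le> (\<Sum>j\<in>J. min (p j True) (p j False))"
    and g: "g \<in> carrier G" "g \<noteq> \<one>"
  shows "AE x in X. shift g x \<noteq> x"
proof -
  let ?fix = "{x\<in>space X. \<forall>h\<in>carrier G. x (g \<otimes> h) = x h}"
  have "{x\<in>space X. x (g \<otimes> h) = x h} \<in> sets X" if h: "h \<in> carrier G" for h
  proof -
    have gh: "g \<otimes> h \<in> carrier G" using h g by auto
    note [measurable] = coordinate_measurable[OF measurable_ident_sets[OF refl] h]
      coordinate_measurable[OF measurable_ident_sets[OF refl] gh]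
    show ?thesis by measurable
  qed
  then have m: "?fix \<in> sets X"
    by (intro sets.sets_Collect_countable_All' countable_G)
  have le: "measure X ?fix \<le> exp (- B)" for B
  proof -
    obtain E where E: "finite E" "E \<subseteq> carrier G" "3 * B \<le> (\<Sum>h\<in>E. min (p h True) (p h False))"
      using unbounded by blast
    have "measure X ?fix \<le> exp (- (\<Sum>h\<in>E. min (p h True) (p h False)) / 3)"
      by (rule measure_fixed_le[OF g E(1,2)])
    also have "\<dots> \<le> exp (- B)" using E(3) by simp
    finally show ?thesis .
  qed
  have "measure X ?fix = 0"
  proof (rule ccontr)
    assume "measure X ?fix \<noteq> 0"
    then have pos: "0 < measure X ?fix" by (simp add: less_le)
    \<comment> \<open>This choice of \<open>B\<close> makes the bound smaller than the measure
      itself by the factor \<open>exp (- 1)\<close>.\<close>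
    have "measure X ?fix \<le> exp (- (1 - ln (measure X ?fix)))" by (rule le)
    also have "\<dots> = exp (ln (measure X ?fix)) * exp (- 1)" by (simp add: exp_add[symmetric])
    also have "\<dots> = measure X ?fix * exp (- 1)" using pos by simp
    also have "\<dots> < measure X ?fix * 1" using pos by (intro mult_strict_left_mono) auto
    finally show False by simp
  qed
  then have "?fix \<in> null_sets X" using m by (intro null_setsI) (simp_all add: emeasure_eq_measure)
  then have "AE x in X. x \<notin> ?fix" by (rule AE_not_in)
  with AE_space show ?thesis
  proof eventually_elim
    case (elim x)
    show ?case
    proof
      assume eq: "shift g x = x"
      have "x (g \<otimes> h) = x h" if "h \<in> carrier G" for h
        using shift_mult_apply[OF elim(1) g(1) that] unfolding eq .
      then show False using elim by simp
    qed
  qed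
qed

text \<open>A linear order on configurations that is a countable combination of coordinate
  conditions, so that the domain selected with its help is measurable.\<close>

definition lex_less :: "('g \<Rightarrow> bool) \<Rightarrow> ('g \<Rightarrow> bool) \<Rightarrow> bool" where
  "lex_less x y \<longleftrightarrow> (\<exists>n. \<not> x (from_nat_into (carrier G) n) \<and> y (from_nat_into (carrier G) n) \<and>
     (\<forall>m<n. x (from_nat_into (carrier G) m) = y (from_nat_into (carrier G) m)))"

lemma lex_less_irrefl: "\<not> lex_less x x"
  by (simp add: lex_less_def)

lemma lex_less_trans:
  assumes "lex_less x y" "lex_less y z"
  shows "lex_less x z"
proof -
  let ?e = "from_nat_into (carrier G)"
  obtain a where a: "\<not> x (?e a)" "y (?e a)" "\<And>m. m < a \<Longrightarrow> x (?e m) = y (?e m)"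
    using assms(1) unfolding lex_less_def by blast
  obtain b where b: "\<not> y (?e b)" "z (?e b)" "\<And>m. m < b \<Longrightarrow> y (?e m) = z (?e m)"
    using assms(2) unfolding lex_less_def by blast
  show ?thesis
  proof (cases a b rule: linorder_cases)
    case less
    then show ?thesis using a b unfolding lex_less_def by (intro exI[of _ a]) auto
  next
    case equal
    then show ?thesis using a b by simp
  next
    case greater
    then show ?thesis using a b unfolding lex_less_def by (intro exI[of _ b]) auto
  qed
qed

lemma lex_less_total:
  assumes x: "x \<in> space X" "y \<in> space X" "x \<noteq> y"
  shows "lex_less x y \<or> lex_less y x"
proof -
  let ?e = "from_nat_into (carrier G)"
  have "\<exists>h\<in>carrier G. x h \<noteq> y h"
  proof (rule ccontr)
    assume "\<not> ?thesis"
    then have "x = y" using x unfolding space_X by (intro PiE_ext) auto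
    then show False using x by simp
  qed
  then obtain h where h: "h \<in> carrier G" "x h \<noteq> y h" by auto
  then obtain n0 where "?e n0 = h" using from_nat_into_surj[OF countable_G] by blast
  then have ex: "\<exists>n. x (?e n) \<noteq> y (?e n)" using h by auto
  define n where "n = (LEAST n. x (?e n) \<noteq> y (?e n))"
  have n: "x (?e n) \<noteq> y (?e n)" unfolding n_def by (rule LeastI_ex[OF ex])
  have lt: "x (?e m) = y (?e m)" if "m < n" for m
    using not_less_Least that unfolding n_def by blast
  show ?thesis
  proof (cases "x (?e n)")
    case True
    then have "lex_less y x" using n lt unfolding lex_less_def by (intro exI[of _ n]) auto
    then show ?thesis ..
  next
    case False
    then have "lex_less x y" using n lt unfolding lex_less_def by (intro exI[of _ n]) auto
    then show ?thesis ..
  qed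
qed

lemma lex_less_minimum:
  assumes "finite S" "S \<noteq> {}" "S \<subseteq> space X"
  shows "\<exists>y\<in>S. \<forall>z\<in>S. z \<noteq> y \<longrightarrow> lex_less y z"
  using assms
proof (induction rule: finite_ne_induct)
  case (singleton x)
  then show ?case by simp
next
  case (insert x S)
  then obtain y where y: "y \<in> S" "\<And>z. z \<in> S \<Longrightarrow> z \<noteq> y \<Longrightarrow> lex_less y z" by auto
  have "x \<noteq> y" using insert y by auto
  then consider "lex_less x y" | "lex_less y x" using lex_less_total[of x y] insert y by auto
  then show ?case
  proof cases
    case 1
    have "lex_less x z" if "z \<in> S" for z
      using y(2)[OF that] 1 lex_less_trans[of x y z] by (cases "z = y") auto
    then show ?thesis by (intro bexI[of _ x]) auto
  next
    case 2
    then show ?thesis using y by (intro bexI[of _ y]) auto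
  qed
qed

text \<open>A fundamental domain picks from every orbit the point where the derivative is maximal, with
  ties (finitely many, as the derivatives are summable along the orbit) broken by \<open>lex_less\<close>.\<close>

lemma summable_imp_dissipative:
  assumes inf: "infinite (carrier G)"
    and unbounded: "\<And>B. \<exists>J. finite J \<and> J \<subseteq> carrier G \<and> B \<le> (\<Sum>j\<in>J. min (p j True) (p j False))"
    and fin: "AE x in X. (\<integral>\<^sup>+k. w k x \<partial>count_space (carrier G)) < \<infinity>"
  shows "dissipative G X shift"
proof -
  let ?N = "count_space (carrier G)"
  let ?e = "from_nat_into (carrier G)"
  have ec: "?e n \<in> carrier G" for n using inf by (intro from_nat_into) auto
  define P where "P x \<longleftrightarrow> (\<forall>a\<in>carrier G. \<forall>b\<in>carrier G. w (a \<otimes> b) x = w a (shift b x) * w b x) \<and>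
     (\<forall>a\<in>carrier G. 0 < w a x \<and> w a x < \<infinity>) \<and> (\<forall>a\<in>carrier G. a \<noteq> \<one> \<longrightarrow> shift a x \<noteq> x) \<and>
     (\<integral>\<^sup>+k. w k x \<partial>?N) < \<infinity> \<and> w \<one> x = 1" for x
  have P1: "AE x in X. \<forall>a\<in>carrier G. \<forall>b\<in>carrier G. w (a \<otimes> b) x = w a (shift b x) * w b x"
    unfolding AE_ball_countable[OF countable_G] by (intro ballI act.deriv_mult)
  have P2: "AE x in X. \<forall>a\<in>carrier G. 0 < w a x \<and> w a x < \<infinity>"
    unfolding AE_ball_countable[OF countable_G] by (intro ballI AE_conjI act.deriv_pos act.deriv_finite)
  have P3: "AE x in X. \<forall>a\<in>carrier G. a \<noteq> \<one> \<longrightarrow> shift a x \<noteq> x"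
    unfolding AE_ball_countable[OF countable_G]
  proof
    fix a assume a: "a \<in> carrier G"
    show "AE x in X. a \<noteq> \<one> \<longrightarrow> shift a x \<noteq> x"
    proof (cases "a = \<one>")
      case False
      from AE_free[OF unbounded a False] show ?thesis by eventually_elim simp
    qed simp
  qed
  have "AE x in X. P x"
    using P1 P2 P3 fin act.deriv_one unfolding P_def by eventually_elim blast
  then obtain N where N: "{x \<in> space X. \<not> P x} \<subseteq> N" "emeasure X N = 0" "N \<in> sets X"
    by (auto elim: AE_E)
  \<comment> \<open>Disjointness in \<open>dissipative\<close> is exact, not up to null sets.
    Removing all translates of \<open>N\<close> leaves an invariant conull set on which
    \<open>P\<close> holds at every point of every orbit.\<close>
  define Y where "Y = {x\<in>space X. \<forall>c\<in>carrier G. shift c x \<notin> N}"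
  have "{x\<in>space X. shift c x \<notin> N} \<in> sets X" if "c \<in> carrier G" for c
  proof -
    note [measurable] = act.act_measurable[OF that] N(3)
    show ?thesis by measurable
  qed
  then have Ym: "Y \<in> sets X" unfolding Y_def by (intro sets.sets_Collect_countable_All' countable_G)
  have "AE x in X. x \<notin> N" using N by (intro AE_not_in) auto
  then have "AE x in X. \<forall>c\<in>carrier G. shift c x \<notin> N"
    unfolding AE_ball_countable[OF countable_G] by (intro ballI act.AE_act)
  with AE_space have YAE: "AE x in X. x \<in> Y" by eventually_elim (simp add: Y_def)
  have Ysp: "x \<in> space X" if "x \<in> Y" for x using that by (simp add: Y_def)
  have Yinv: "shift c x \<in> Y" if "x \<in> Y" "c \<in> carrier G" for x c
    using that act.act_space act.act_mult[of _ c x, symmetric] by (auto simp: Y_def)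
  have YP: "P x" if x: "x \<in> Y" for x
  proof -
    have "shift \<one> x \<notin> N" using x by (auto simp: Y_def)
    then show ?thesis using N(1) Ysp[OF x] act.act_one[OF Ysp[OF x]] by auto
  qed
  \<comment> \<open>By the chain rule \<open>w g x\<close> is the ratio of the derivatives that lead
    to \<open>shift g x\<close> and to \<open>x\<close> from any base point of the orbit. So the
    condition expresses maximality at \<open>x\<close> without naming a base point.\<close>
  define U where "U = {x\<in>space X. x \<in> Y \<and> (\<forall>g\<in>carrier G. g \<noteq> \<one> \<longrightarrow> w g x < 1 \<or> (w g x = 1 \<and> lex_less x (shift g x)))}"
  have Um: "U \<in> sets X"
    unfolding U_def
  proof (intro sets.sets_Collect_conj sets.sets_Collect_countable_All' countable_G)
    show "{x\<in>space X. x \<in> Y} \<in> sets X" using Ym by simp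
    fix g assume g: "g \<in> carrier G"
    have cm: "(\<lambda>x. x (?e n)) \<in> measurable X (count_space UNIV)" "(\<lambda>x. shift g x (?e n)) \<in> measurable X (count_space UNIV)" for n
      using coordinate_measurable[OF measurable_ident_sets[OF refl] ec[of n]]
        coordinate_measurable[OF act.act_measurable[OF g] ec[of n]] by auto
    note [measurable] = cm act.deriv_measurable[OF g]
    have [measurable]: "Measurable.pred X (\<lambda>x. lex_less x (shift g x))"
      unfolding lex_less_def by measurable
    show "{x\<in>space X. g \<noteq> \<one> \<longrightarrow> w g x < 1 \<or> (w g x = 1 \<and> lex_less x (shift g x))} \<in> sets X"
      by measurable
  qed
  have image: "shift g ` U = {x\<in>space X. shift (inv g) x \<in> U}" if g: "g \<in> carrier G" for g
  proof (intro equalityI subsetI)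
    fix x assume "x \<in> shift g ` U"
    then obtain u where u: "u \<in> U" "x = shift g u" by auto
    then have "u \<in> space X" by (simp add: U_def)
    then show "x \<in> {x\<in>space X. shift (inv g) x \<in> U}" using u g act.act_space by simp
  next
    fix x assume "x \<in> {x\<in>space X. shift (inv g) x \<in> U}"
    then show "x \<in> shift g ` U" using g act.act_inv'[of g x] by (intro image_eqI[of _ _ "shift (inv g) x"]) auto
  qed
  have imm: "shift g ` U \<in> sets X" if g: "g \<in> carrier G" for g
  proof -
    have ig: "inv g \<in> carrier G" using g by simp
    note [measurable] = act.act_measurable[OF ig] Um
    show ?thesis unfolding image[OF g] by measurable
  qed
  \<comment> \<open>For two points of \<open>U\<close> in one orbit, the derivatives from each to
    the other are mutually inverse and at most 1, so both equal 1. Then \<open>lex_less\<close>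
    would hold in both directions.\<close>
  have no_return: "False" if u: "u \<in> U" and k: "k \<in> carrier G" "k \<noteq> \<one>" and v: "shift k u \<in> U" for u k
  proof -
    have uY: "u \<in> Y" using u by (simp add: U_def)
    have ik: "inv k \<in> carrier G" "inv k \<noteq> \<one>" using k by auto
    have "w (inv k \<otimes> k) u = w (inv k) (shift k u) * w k u"
      using YP[OF uY] k ik unfolding P_def by blast
    then have prod1: "w (inv k) (shift k u) * w k u = 1"
      using YP[OF uY] k unfolding P_def by simp
    have ret: "shift (inv k) (shift k u) = u" using k Ysp[OF uY] by simp
    have 1: "w k u < 1 \<or> (w k u = 1 \<and> lex_less u (shift k u))" using u k unfolding U_def by blast
    have 2: "w (inv k) (shift k u) < 1 \<or> (w (inv k) (shift k u) = 1 \<and> lex_less (shift k u) u)"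
      using v ik ret unfolding U_def by auto
    have le: "w (inv k) (shift k u) \<le> 1" using 2 by auto
    show False
      using 1
    proof
      assume "w k u < 1"
      moreover have "w (inv k) (shift k u) * w k u \<le> 1 * w k u" using le by (rule mult_right_mono) simp
      ultimately show False using prod1 by simp
    next
      assume 3: "w k u = 1 \<and> lex_less u (shift k u)"
      then have "w (inv k) (shift k u) = 1" using prod1 by simp
      then have "lex_less (shift k u) u" using 2 by simp
      then show False using 3 lex_less_trans lex_less_irrefl by blast
    qed
  qed
  have disj: "disjoint_family_on (\<lambda>g. shift g ` U) (carrier G)"
    unfolding disjoint_family_on_def
  proof (intro ballI impI)
    fix g h assume g: "g \<in> carrier G" and h: "h \<in> carrier G" and "g \<noteq> h"
    show "shift g ` U \<inter> shift h ` U = {}"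
    proof (rule ccontr)
      assume "shift g ` U \<inter> shift h ` U \<noteq> {}"
      then obtain u v where uv: "u \<in> U" "v \<in> U" "shift g u = shift h v" by auto
      have sp: "u \<in> space X" "v \<in> space X" using uv by (auto simp: U_def)
      have "shift (inv h \<otimes> g) u = shift (inv h) (shift h v)" using g h sp uv by (simp add: act.act_mult)
      then have "shift (inv h \<otimes> g) u = v" using h sp by simp
      moreover have "inv h \<otimes> g \<noteq> \<one>" using g h \<open>g \<noteq> h\<close> by (metis inv_equality inv_inv inv_closed)
      ultimately show False using no_return[OF uv(1), of "inv h \<otimes> g"] uv g h by auto
    qed
  qed
  have hit: "\<exists>g\<in>carrier G. shift g x \<in> U" if x: "x \<in> Y" for x
  proof -
    have xs: "x \<in> space X" by (rule Ysp[OF x])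
    have Px: "w (a \<otimes> b) x = w a (shift b x) * w b x" if "a \<in> carrier G" "b \<in> carrier G" for a b
      using YP[OF x] that unfolding P_def by blast
    have Pp: "0 < w a x" "w a x < \<infinity>" if "a \<in> carrier G" for a using YP[OF x] that unfolding P_def by blast+
    have Pf: "(\<integral>\<^sup>+k. w k x \<partial>?N) < \<infinity>" "w \<one> x = 1" using YP[OF x] unfolding P_def by blast+
    \<comment> \<open>\<open>T\<close> contains \<open>\<one>\<close>, so a maximum over
      \<open>T\<close> is a maximum over the group. Summability of the derivatives makes it finite,
      so the maximum is attained.\<close>
    define T where "T = {k\<in>carrier G. 1 \<le> w k x}"
    have Tfin: "finite T"
    proof (rule ccontr)
      assume "infinite T"
      then have "\<infinity> = emeasure ?N T" by (simp add: T_def emeasure_count_space)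
      also have "\<dots> = (\<integral>\<^sup>+k. indicator T k \<partial>?N)" by (rule nn_integral_indicator[symmetric]) (auto simp: T_def)
      also have "\<dots> \<le> (\<integral>\<^sup>+k. w k x \<partial>?N)" by (intro nn_integral_mono) (auto simp: T_def indicator_def)
      finally show False using Pf(1) by (simp add: top_unique)
    qed
    have T1: "\<one> \<in> T" using Pf by (simp add: T_def)
    define m where "m = Max ((\<lambda>k. w k x) ` T)"
    have m_ge: "w k x \<le> m" if "k \<in> carrier G" for k
    proof (cases "k \<in> T")
      case True
      then show ?thesis unfolding m_def using Tfin by (intro Max_ge) auto
    next
      case False
      then have "w k x \<le> 1" using that by (simp add: T_def)
      also have "\<dots> \<le> m" unfolding m_def using Tfin T1 Pf(2) by (intro Max_ge) (auto intro: image_eqI[of _ _ \<one>])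
      finally show ?thesis .
    qed
    define T' where "T' = {k\<in>T. w k x = m}"
    have "m \<in> (\<lambda>k. w k x) ` T" unfolding m_def using Tfin T1 by (intro Max_in) auto
    then have T'ne: "T' \<noteq> {}" by (auto simp: T'_def)
    have T'c: "T' \<subseteq> carrier G" by (auto simp: T'_def T_def)
    have T'fin: "finite T'" using Tfin by (rule rev_finite_subset) (auto simp: T'_def)
    have T'I: "k \<in> T'" if "k \<in> carrier G" "w k x = m" for k
      using that m_ge[of \<one>] Pf(2) by (simp add: T'_def T_def)
    have "(\<lambda>k. shift k x) ` T' \<subseteq> space X" using T'c act.act_space xs by blast
    then have "\<exists>y\<in>(\<lambda>k. shift k x) ` T'. \<forall>z\<in>(\<lambda>k. shift k x) ` T'. z \<noteq> y \<longrightarrow> lex_less y z"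
      using T'fin T'ne by (intro lex_less_minimum) auto
    then obtain y where y: "y \<in> (\<lambda>k. shift k x) ` T'"
      "\<forall>z\<in>(\<lambda>k. shift k x) ` T'. z \<noteq> y \<longrightarrow> lex_less y z"
      by (rule bexE)
    from y(1) obtain g where g: "g \<in> T'" "y = shift g x" by auto
    have gc: "g \<in> carrier G" and gm: "w g x = m" using g T'c by (auto simp: T'_def)
    have yY: "y \<in> Y" unfolding g(2) by (rule Yinv[OF x gc])
    have m: "0 < m" "m < \<infinity>" using Pp[OF gc] gm by auto
    have "w k y < 1 \<or> (w k y = 1 \<and> lex_less y (shift k y))" if k: "k \<in> carrier G" "k \<noteq> \<one>" for k
    proof -
      have eq: "w (k \<otimes> g) x = w k y * m" using Px[OF k(1) gc] g gm by simp
      show ?thesis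
      proof (cases "w (k \<otimes> g) x = m")
        case True
        then have "w k y * m = 1 * m" using eq by simp
        then have "w k y * m / m = 1 * m / m" by simp
        then have one: "w k y = 1" using m by (simp add: ennreal_mult_divide_eq)
        have "k \<otimes> g \<in> T'" using True k gc by (intro T'I) auto
        moreover have ky: "shift k y = shift (k \<otimes> g) x" using g k gc xs by (simp add: act.act_mult)
        ultimately have "shift k y \<in> (\<lambda>k. shift k x) ` T'" by auto
        \<comment> \<open>Freeness enters here: distinct group elements give distinct points, so
          that the strict order can decide between them.\<close>
        moreover have "shift k y \<noteq> y" using YP[OF yY] k unfolding P_def by blast
        ultimately show ?thesis using one y(2) by blast
      next
        case False
        then have "w (k \<otimes> g) x < m" using m_ge[of "k \<otimes> g"] k gc by simp
        have "w k y < 1"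
        proof (rule ccontr)
          assume "\<not> w k y < 1"
          then have "1 * m \<le> w k y * m" by (intro mult_right_mono) auto
          then show False using eq \<open>w (k \<otimes> g) x < m\<close> by simp
        qed
        then show ?thesis ..
      qed
    qed
    then have "y \<in> U" using yY Ysp[OF yY] by (simp add: U_def)
    then show ?thesis using g gc by auto
  qed
  have "AE x in X. x \<in> (\<Union>g\<in>carrier G. shift g ` U)"
    using YAE
  proof eventually_elim
    case (elim x)
    obtain g where g: "g \<in> carrier G" "shift g x \<in> U" using hit[OF elim] by auto
    then have "x \<in> shift (inv g) ` U" using act.act_inv[OF g(1) Ysp[OF elim]] by (intro image_eqI[of _ _ "shift g x"]) auto
    then show ?case using g by blast
  qed
  then have "emeasure X (\<Union>g\<in>carrier G. shift g ` U) = 1"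
    using imm by (subst emeasure_eq_1_AE) (auto intro: sets.countable_UN' countable_G)
  then show ?thesis unfolding dissipative_def using Um disj by blast
qed

lemma abelian_dissipative_or_weakly_mixing:
  assumes comm: "comm_group G" and inf: "infinite (carrier G)" and na: "nonatomic X"
  shows "dissipative G X shift \<or> weakly_mixing TYPE('y) G X shift"
proof -
  note unbounded = nonatomic_imp_unbounded[OF inf na]
  show ?thesis
    using conservative_part_zero_one[OF comm unbounded]
  proof
    assume "measure X conservative_part = 0"
    then have "conservative_part \<in> null_sets X"
      using conservative_part_sets by (intro null_setsI) (simp_all add: emeasure_eq_measure)
    then have "AE x in X. x \<notin> conservative_part" by (rule AE_not_in)
    with AE_space have "AE x in X. (\<integral>\<^sup>+k. w k x \<partial>count_space (carrier G)) < \<infinity>"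
      by eventually_elim (auto simp: conservative_part_def less_top)
    then have "dissipative G X shift" by (rule summable_imp_dissipative[OF inf unbounded])
    then show ?thesis ..
  next
    assume "measure X conservative_part = 1"
    then have "AE x in X. x \<in> conservative_part"
      using conservative_part_sets by (simp add: prob_eq_1)
    then have "AE x in X. (\<integral>\<^sup>+k. w k x \<partial>count_space (carrier G)) = \<infinity>"
      by eventually_elim (simp add: conservative_part_def)
    then have "weakly_mixing TYPE('y) G X shift"
      by (rule conservative_imp_weakly_mixing[OF comm inf unbounded])
    then show ?thesis ..
  qed
qed

end

theorem theoremA:
  fixes G :: "('g, 'b) monoid_scheme" and \<mu> :: "'g \<Rightarrow> bool pmf"
  assumes "group G" and "countable (carrier G)" and "infinite (carrier G)"
    and "\<forall>g\<in>carrier G. pmf (\<mu> g) False \<in> {0<..<1}"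
    and "nonsingular_action G (bernoulli_space G \<mu>) (bernoulli_action G)"
  shows "(comm_group G \<and> nonatomic (bernoulli_space G \<mu>) \<longrightarrow>
            dissipative G (bernoulli_space G \<mu>) (bernoulli_action G) \<or>
            weakly_mixing TYPE('y) G (bernoulli_space G \<mu>) (bernoulli_action G))
       \<and> (strongly_conservative G (bernoulli_space G \<mu>) (bernoulli_action G) \<and>
          (\<exists>\<delta>>0. \<forall>g\<in>carrier G. pmf (\<mu> g) False \<in> {\<delta>..1 - \<delta>}) \<longrightarrow>
            weakly_mixing TYPE('y) G (bernoulli_space G \<mu>) (bernoulli_action G))"
proof -
  interpret nonsingular_bernoulli G \<mu>
    using assms by (auto simp: nonsingular_bernoulli_def bernoulli_def bernoulli_axioms_def
        nonsingular_bernoulli_axioms_def)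
  show ?thesis
    using abelian_dissipative_or_weakly_mixing[OF _ assms(3)] strongly_conservative_imp_weakly_mixing
    by blast
qed

end
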